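(* Let $p\geq1$, let $\omega:\mathbb N\to(1,+\infty)$ with $\omega(k)\to+\infty$, and let $\mathbf w=(w_n)_{n\geq1}$ be a bounded sequence of positive real numbers such that $\sum_{n\geq1}(w_1\cdots w_n)^{-p}<+\infty$. Let $B_{\mathbf w}$ be the backward weighted shift on $\ell^p(\mathbb Z_+)$, $B_{\mathbf w}((x_n)_{n\geq0})=(w_{n+1}x_{n+1})_{n\geq0}$. Then there exists a $B_{\mathbf w}$-invariant Borel probability measure $\mu$ on $\ell^p(\mathbb Z_+)$ with full support, with respect to which $B_{\mathbf w}$ is strongly mixing, such that $E_\omega\subset L^2(\ell^p(\mathbb Z_+),\mathcal B,\mu)$. Suppose moreover that there exist $C>0$ and $\alpha>1/2$ with $w_1\cdots w_n\geq Cn^\alpha$ for all $n\geq1$. Then (the measure $\mu$ can be chosen so that) for any $f,g\in E_\omega$ there is $C_{f,g,\alpha}$ with, for all $n\geq1$, $|\mathrm{Cov}(f\circ B_{\mathbf w}^n,g)|\leq C_{f,g,\alpha}n^{1-2\alpha}$ if $\alpha\in(1/2,1)$, $\leq C_{f,g,\alpha}\frac{\log(n+1)}n$ if $\alpha=1$, $\leq C_{f,g,\alpha}n^{-\alpha}$ if $\alpha>1$; and if $\alpha>1$, then for every $f\in E_\omega$ with $\int f\,d\mu=0$, $\frac1{\sqrt n}(f+f\circ B_{\mathbf w}+\dots+f\circ B_{\mathbf w}^{n-1})$ converges in distribution to a Gaussian random variable with zero mean and finite variance.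
   Context: For a Banach space $X$, $E_\omega$ denotes the set of functions $f:X\to\mathbb R$ which are infinitely (Fréchet) differentiable at $0$, satisfy $f(x)=\sum_{\kappa=0}^{\infty}\frac{D^\kappa f(0)}{\kappa!}(x,\dots,x)$ for all $x\in X$, and satisfy $\sup_{\kappa\geq0}\|D^\kappa f(0)\|\,\omega(\kappa)^\kappa<+\infty$. $T$-invariant: $\mu(T^{-1}A)=\mu(A)$; full support: $\mu(U)>0$ for nonempty open $U$; strongly mixing: $\mu(A\cap T^{-n}B)\to\mu(A)\mu(B)$ for Borel $A,B$. $\mathrm{Cov}(f,g)=\int fg\,d\mu-\int f\,d\mu\int g\,d\mu$. *)

theory Defs
  imports "HOL-Probability.Probability"
begin

definition lp :: "real \<Rightarrow> (nat \<Rightarrow> real) set" where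
  "lp p = {x. summable (\<lambda>n. \<bar>x n\<bar> powr p)}"

definition lpnorm :: "real \<Rightarrow> (nat \<Rightarrow> real) \<Rightarrow> real" where
  "lpnorm p x = (\<Sum>n. \<bar>x n\<bar> powr p) powr (1 / p)"

definition lp_open :: "real \<Rightarrow> (nat \<Rightarrow> real) set \<Rightarrow> bool" where
  "lp_open p U \<longleftrightarrow> U \<subseteq> lp p \<and>
     (\<forall>x\<in>U. \<exists>e>0. \<forall>y\<in>lp p. lpnorm p (\<lambda>n. y n - x n) < e \<longrightarrow> y \<in> U)"

definition lp_borel :: "real \<Rightarrow> (nat \<Rightarrow> real) measure" where
  "lp_borel p = sigma (lp p) {U. lp_open p U}"

text \<open>Backward weighted shift; the weights w are indexed from 1 (w 0 is unused).\<close>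

definition Bw :: "(nat \<Rightarrow> real) \<Rightarrow> (nat \<Rightarrow> real) \<Rightarrow> (nat \<Rightarrow> real)" where
  "Bw w x = (\<lambda>n. w (Suc n) * x (Suc n))"

text \<open>k-linear forms on l^p are represented as functions of a list of k arguments.\<close>

definition is_mlin :: "real \<Rightarrow> nat \<Rightarrow> ((nat \<Rightarrow> real) list \<Rightarrow> real) \<Rightarrow> bool" where
  "is_mlin p k A \<longleftrightarrow>
     (\<forall>xs ys u v a b. length xs + length ys + 1 = k \<and> set xs \<subseteq> lp p \<and> set ys \<subseteq> lp p
        \<and> u \<in> lp p \<and> v \<in> lp p \<longrightarrow>
        A (xs @ (\<lambda>n. a * u n + b * v n) # ys) = a * A (xs @ u # ys) + b * A (xs @ v # ys))
   \<and> (\<exists>M. \<forall>hs. length hs = k \<and> (\<forall>h\<in>set hs. h \<in> lp p \<and> lpnorm p h \<le> 1) \<longrightarrow> \<bar>A hs\<bar> \<le> M)"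

definition mlnorm :: "real \<Rightarrow> nat \<Rightarrow> ((nat \<Rightarrow> real) list \<Rightarrow> real) \<Rightarrow> real" where
  "mlnorm p k A = (SUP hs \<in> {hs. length hs = k \<and> (\<forall>h\<in>set hs. h \<in> lp p \<and> lpnorm p h \<le> 1)}. \<bar>A hs\<bar>)"

text \<open>D (Suc k) x is the Frechet derivative at x of y |-> D k y (as a map into the
  Banach space of bounded k-linear forms):
  D^(k+1) f(x)(h, h_1..h_k) = (D(D^k f)(x) h)(h_1..h_k).\<close>

definition frechet_step ::
  "real \<Rightarrow> nat \<Rightarrow> (nat \<Rightarrow> (nat \<Rightarrow> real) \<Rightarrow> (nat \<Rightarrow> real) list \<Rightarrow> real) \<Rightarrow> (nat \<Rightarrow> real) \<Rightarrow> bool" where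
  "frechet_step p k D x \<longleftrightarrow>
     (\<forall>\<epsilon>>0. \<exists>\<delta>>0. \<forall>h\<in>lp p. lpnorm p h < \<delta> \<longrightarrow>
        mlnorm p k (\<lambda>hs. D k (\<lambda>n. x n + h n) hs - D k x hs - D (Suc k) x (h # hs))
          \<le> \<epsilon> * lpnorm p h)"

text \<open>f is infinitely Frechet differentiable at 0, with D k x = D^k f(x) near 0:
  for every k, D^k f exists (as bounded k-linear forms) on a ball around 0
  and is Frechet differentiable there with derivative D^(k+1) f.\<close>

definition Cinf_at0 ::
  "real \<Rightarrow> ((nat \<Rightarrow> real) \<Rightarrow> real) \<Rightarrow> (nat \<Rightarrow> (nat \<Rightarrow> real) \<Rightarrow> (nat \<Rightarrow> real) list \<Rightarrow> real) \<Rightarrow> bool" where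
  "Cinf_at0 p f D \<longleftrightarrow> (\<forall>x\<in>lp p. D 0 x [] = f x) \<and>
     (\<forall>k. \<exists>r>0. \<forall>x\<in>lp p. lpnorm p x < r \<longrightarrow>
         is_mlin p k (D k x) \<and> is_mlin p (Suc k) (D (Suc k) x) \<and> frechet_step p k D x)"

definition E_omega :: "real \<Rightarrow> (nat \<Rightarrow> real) \<Rightarrow> ((nat \<Rightarrow> real) \<Rightarrow> real) set" where
  "E_omega p \<omega> = {f. \<exists>D. Cinf_at0 p f D
      \<and> (\<forall>x\<in>lp p. (\<lambda>k. D k (\<lambda>_. 0) (replicate k x) / fact k) sums f x)
      \<and> bdd_above (range (\<lambda>k. mlnorm p k (D k (\<lambda>_. 0)) * \<omega> k ^ k))}"

definition good_measure ::
  "real \<Rightarrow> (nat \<Rightarrow> real) \<Rightarrow> (nat \<Rightarrow> real) \<Rightarrow> (nat \<Rightarrow> real) measure \<Rightarrow> bool" where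
  "good_measure p \<omega> w \<mu> \<longleftrightarrow>
     prob_space \<mu> \<and> sets \<mu> = sets (lp_borel p)
   \<comment> \<open>B_w-invariant\<close>
   \<and> Bw w \<in> measurable \<mu> \<mu>
   \<and> (\<forall>A\<in>sets \<mu>. emeasure \<mu> (Bw w -` A \<inter> space \<mu>) = emeasure \<mu> A)
   \<comment> \<open>full support\<close>
   \<and> (\<forall>U. lp_open p U \<and> U \<noteq> {} \<longrightarrow> emeasure \<mu> U > 0)
   \<comment> \<open>strongly mixing\<close>
   \<and> (\<forall>A\<in>sets \<mu>. \<forall>B\<in>sets \<mu>.
        (\<lambda>n. measure \<mu> (A \<inter> ((Bw w ^^ n) -` B \<inter> space \<mu>))) \<longlonglongrightarrow> measure \<mu> A * measure \<mu> B)
   \<comment> \<open>E_omega is contained in L^2(mu)\<close>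
   \<and> (\<forall>f\<in>E_omega p \<omega>. f \<in> borel_measurable \<mu> \<and> integrable \<mu> (\<lambda>x. (f x)\<^sup>2))"

definition Cov :: "'a measure \<Rightarrow> ('a \<Rightarrow> real) \<Rightarrow> ('a \<Rightarrow> real) \<Rightarrow> real" where
  "Cov \<mu> f g = (\<integral>x. f x * g x \<partial>\<mu>) - (\<integral>x. f x \<partial>\<mu>) * (\<integral>x. g x \<partial>\<mu>)"

definition decay_rate :: "real \<Rightarrow> nat \<Rightarrow> real" where
  "decay_rate \<alpha> n = (if \<alpha> < 1 then real n powr (1 - 2 * \<alpha>)
                      else if \<alpha> = 1 then ln (real n + 1) / real n
                      else real n powr (- \<alpha>))"

definition gaussian0 :: "real \<Rightarrow> real measure" where
  "gaussian0 s = (if s = 0 then return borel 0 else density lborel (normal_density 0 s))"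

end

theory Submission
  imports Defs
begin

text \<open>
  Let \<open>\<xi>\<^sub>0, \<xi>\<^sub>1, \<dots>\<close> be i.i.d. real random variables whose law has full support and light tails, and let \<open>\<mu>\<close> be
  the law of the vector \<open>x\<close> with coordinates \<open>x\<^sub>n = \<xi>\<^sub>n / (w\<^sub>1 \<cdots> w\<^sub>n)\<close>. The backward shift of \<open>x\<close> is the same
  vector built from the shifted sequence, so \<open>B\<^sub>w\<close> is a factor of a Bernoulli shift; this gives
  invariance and mixing. A function \<open>f\<close> in \<open>E\<^sub>\<omega>\<close> satisfies \<open>\<bar>f x\<bar> \<le> K exp \<parallel>x\<parallel>\<close> and a Lipschitz bound with
  constant \<open>K exp R\<close> on the ball of radius \<open>R\<close>, so resampling \<open>\<xi>\<^sub>k\<close> changes \<open>f x\<close> in \<open>L\<^sup>2\<close> by at most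
  a constant times \<open>1 / (w\<^sub>1 \<cdots> w\<^sub>k)\<close>.

  An Efron-Stein inequality bounds a covariance by half the sum over \<open>k\<close> of the products of these
  influences, and the covariance of \<open>f \<circ> B\<^sub>w\<^sup>n\<close> and \<open>g\<close> by the convolution of \<open>1 / (w\<^sub>1 \<cdots> w\<^sub>j)\<close> and
  \<open>1 / (w\<^sub>1 \<cdots> w\<^sub>j\<^sub>+\<^sub>n)\<close>. If the influences are summable, the same inequality shows that the Birkhoff
  sums are approximated in \<open>L\<^sup>2\<close>, uniformly after normalisation, by sums of independent blocks of
  length \<open>L\<close>, with an error that vanishes as \<open>L\<close> grows; the classical central limit theorem for the
  blocks and Levy's continuity theorem then give the Gaussian limit.
\<close>

section \<open>Multilinear forms and entire functions on the sequence space\<close>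

text \<open>The p-th power of the norm of \<open>x\<close> is the sum of c_n |xi_n|^p with c_n =
  (w_1...w_n)^(-p). With C0 the sum of the c_n, convexity of exp bounds exp(8 ||x||^p) by a weighted
  average of the exp(8 C0 |xi_n|^p), so a single exponential moment of the coordinate law controls
  every function in \<open>E_omega\<close>. For p \<ge> 2 the standard normal law has no such
  moment, which is why the law of the coordinates is tailored to C0. The resulting measure is built
  from p and the weights alone, so one measure serves all the claims.

  The Efron-Stein bound is organised around two independent copies of the sequence and permutations
  of their coordinates, which replaces conditional expectations. Projection onto the first N
  coordinates is replaced by setting the remaining ones to zero, an operation that does not increase
  the norm.

  The limiting variance is not computed. Block variances divided by the block length are bounded,
  and any cluster point of them is the limiting variance, because for large n the approximation
  error depends on the block length only.\<close>

lemma lpnorm_nonneg: "lpnorm p x \<ge> 0"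
  unfolding lpnorm_def by simp

lemma lpnorm_powr:
  assumes "p > 0" "x \<in> lp p" shows "lpnorm p x powr p = (\<Sum>n. \<bar>x n\<bar> powr p)"
  using assms suminf_nonneg[of "\<lambda>n. \<bar>x n\<bar> powr p"]
  by (simp add: lpnorm_def powr_powr lp_def)

lemma lpnorm_le_iff:
  assumes "p > 0" "x \<in> lp p" "r \<ge> 0"
  shows "lpnorm p x \<le> r \<longleftrightarrow> (\<Sum>n. \<bar>x n\<bar> powr p) \<le> r powr p"
proof -
  have "lpnorm p x \<le> r \<longleftrightarrow> lpnorm p x powr p \<le> r powr p"
    using assms lpnorm_nonneg by (metis powr_less_mono2 powr_mono2 linorder_not_less less_imp_le)
  then show ?thesis using assms by (simp add: lpnorm_powr)
qed

lemma lp_zero: "(\<lambda>_. 0) \<in> lp p"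
  by (simp add: lp_def)

lemma lpnorm_zero: "lpnorm p (\<lambda>_. 0) = 0"
  by (simp add: lpnorm_def)

lemma lpnorm_eq_0:
  assumes "p > 0" "x \<in> lp p" "lpnorm p x = 0" shows "x n = 0"
proof -
  have s: "summable (\<lambda>n. \<bar>x n\<bar> powr p)" using assms by (simp add: lp_def)
  have "(\<Sum>n. \<bar>x n\<bar> powr p) = 0"
    using lpnorm_powr[of p x] assms by simp
  then have "\<bar>x n\<bar> powr p = 0"
    using suminf_eq_zero_iff[OF s] by auto
  then show ?thesis by simp
qed

lemma lp_scale:
  assumes "x \<in> lp p" shows "(\<lambda>n. a * x n) \<in> lp p"
  using assms by (auto simp: lp_def abs_mult powr_mult intro!: summable_mult)

lemma lpnorm_scale:
  assumes "p > 0" "x \<in> lp p" shows "lpnorm p (\<lambda>n. a * x n) = \<bar>a\<bar> * lpnorm p x"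
proof -
  have s: "summable (\<lambda>n. \<bar>x n\<bar> powr p)" using assms by (simp add: lp_def)
  have "(\<Sum>n. \<bar>a * x n\<bar> powr p) = \<bar>a\<bar> powr p * (\<Sum>n. \<bar>x n\<bar> powr p)"
    using s by (simp add: abs_mult powr_mult suminf_mult)
  then show ?thesis using assms suminf_nonneg[OF s]
    by (simp add: lpnorm_def powr_mult powr_powr)
qed

lemma powr_convex_combination:
  fixes x y t p :: real
  assumes "p \<ge> 1" "x \<ge> 0" "y \<ge> 0" "0 \<le> t" "t \<le> 1"
  shows "((1 - t) * x + t * y) powr p \<le> (1 - t) * x powr p + t * y powr p"
proof -
  \<comment> \<open>When \<open>x\<close> or \<open>y\<close> is 0 the claim reduces to s^p \<le> s
    for 0 \<le> s \<le> 1.\<close>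
  have *: "(s * z) powr p \<le> s * z powr p" if "0 \<le> s" "s \<le> 1" "0 \<le> z" for s z :: real
  proof -
    have "s powr p \<le> s powr 1" if "s > 0"
      using that \<open>s \<le> 1\<close> assms(1) by (intro powr_mono') auto
    then have "s powr p \<le> s" using that(1) by (cases "s = 0") auto
    then show ?thesis using that by (simp add: powr_mult mult_right_mono)
  qed
  consider "x = 0" | "y = 0" | "x > 0" "y > 0" using assms by linarith
  then show ?thesis
  proof cases
    case 1 then show ?thesis using *[of t y] assms by auto
  next
    case 2 then show ?thesis using *[of "1 - t" x] assms by auto
  next
    case 3 then show ?thesis
      using convex_onD[OF powr_convex[OF assms(1)], of t x y] assms by auto
  qed
qed

lemma powr_abs_add_le:
  fixes x y p :: real
  assumes "p \<ge> 1"
  shows "\<bar>x + y\<bar> powr p \<le> 2 powr p * (\<bar>x\<bar> powr p + \<bar>y\<bar> powr p)"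
proof -
  have "\<bar>x + y\<bar> \<le> 2 * max \<bar>x\<bar> \<bar>y\<bar>" by linarith
  then have "\<bar>x + y\<bar> powr p \<le> (2 * max \<bar>x\<bar> \<bar>y\<bar>) powr p"
    using assms by (intro powr_mono2) auto
  also have "\<dots> = 2 powr p * max \<bar>x\<bar> \<bar>y\<bar> powr p" by (simp add: powr_mult)
  also have "\<dots> \<le> 2 powr p * (\<bar>x\<bar> powr p + \<bar>y\<bar> powr p)"
    by (intro mult_left_mono) (auto simp: max_def)
  finally show ?thesis .
qed

lemma lp_add:
  assumes "p \<ge> 1" "x \<in> lp p" "y \<in> lp p" shows "(\<lambda>n. x n + y n) \<in> lp p"
  unfolding lp_def
proof (safe, rule summable_comparison_test)
  show "\<exists>N. \<forall>n\<ge>N. norm (\<bar>x n + y n\<bar> powr p) \<le> 2 powr p * (\<bar>x n\<bar> powr p + \<bar>y n\<bar> powr p)"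
    using powr_abs_add_le[OF assms(1)] by auto
  show "summable (\<lambda>n. 2 powr p * (\<bar>x n\<bar> powr p + \<bar>y n\<bar> powr p))"
    using assms by (auto simp: lp_def intro!: summable_mult summable_add)
qed

lemma lp_diff:
  assumes "p \<ge> 1" "x \<in> lp p" "y \<in> lp p" shows "(\<lambda>n. x n - y n) \<in> lp p"
  using lp_add[OF assms(1,2) lp_scale[OF assms(3), of "-1"]] by simp

lemma lpnorm_minus_commute: "lpnorm p (\<lambda>n. x n - y n) = lpnorm p (\<lambda>n. y n - x n)"
  by (simp add: lpnorm_def abs_minus_commute)

text \<open>Minkowski from convexity of t^p alone: with a, b the two norms, |x n + y n| is at most a
  + b times the convex combination of |x n| / a and |y n| / b with weights a / (a + b) and b / (a +
  b). Summing the p-th powers uses that both normalised sequences have norm 1.\<close>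

lemma lpnorm_triangle:
  assumes p: "p \<ge> 1" and x: "x \<in> lp p" and y: "y \<in> lp p"
  shows "lpnorm p (\<lambda>n. x n + y n) \<le> lpnorm p x + lpnorm p y"
proof (cases "lpnorm p x = 0 \<or> lpnorm p y = 0")
  case True
  then show ?thesis
  proof
    assume "lpnorm p x = 0"
    then have "x = (\<lambda>_. 0)" using lpnorm_eq_0[of p x] p x by auto
    then show ?thesis by (simp add: lpnorm_zero)
  next
    assume "lpnorm p y = 0"
    then have "y = (\<lambda>_. 0)" using lpnorm_eq_0[of p y] p y by auto
    then show ?thesis by (simp add: lpnorm_zero)
  qed
next
  case False
  define a b where "a = lpnorm p x" and "b = lpnorm p y"
  have ab: "a > 0" "b > 0" using False lpnorm_nonneg[of p x] lpnorm_nonneg[of p y] by (auto simp: a_def b_def)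
  define t where "t = b / (a + b)"
  have t: "0 \<le> t" "t \<le> 1" "1 - t = a / (a + b)" using ab by (auto simp: t_def field_simps)
  have sx: "summable (\<lambda>n. \<bar>x n\<bar> powr p)" and sy: "summable (\<lambda>n. \<bar>y n\<bar> powr p)"
    using x y by (auto simp: lp_def)
  have nx: "(\<Sum>n. \<bar>x n\<bar> powr p) = a powr p" and ny: "(\<Sum>n. \<bar>y n\<bar> powr p) = b powr p"
    using lpnorm_powr[of p] p x y by (auto simp: a_def b_def)
  have le: "\<bar>x n + y n\<bar> powr p \<le> (a + b) powr p * ((1 - t) / a powr p * \<bar>x n\<bar> powr p + t / b powr p * \<bar>y n\<bar> powr p)" for n
  proof -
    have "\<bar>x n + y n\<bar> \<le> (a + b) * ((1 - t) * (\<bar>x n\<bar> / a) + t * (\<bar>y n\<bar> / b))"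
      using ab unfolding t(3) by (simp add: t_def distrib_left)
    then have "\<bar>x n + y n\<bar> powr p \<le> ((a + b) * ((1 - t) * (\<bar>x n\<bar> / a) + t * (\<bar>y n\<bar> / b))) powr p"
      using p by (intro powr_mono2) auto
    also have "\<dots> = (a + b) powr p * ((1 - t) * (\<bar>x n\<bar> / a) + t * (\<bar>y n\<bar> / b)) powr p"
      by (rule powr_mult)
    also have "\<dots> \<le> (a + b) powr p * ((1 - t) * (\<bar>x n\<bar> / a) powr p + t * (\<bar>y n\<bar> / b) powr p)"
      using ab t p by (intro mult_left_mono powr_convex_combination) auto
    finally show ?thesis using ab by (simp add: powr_divide)
  qed
  have "(\<Sum>n. \<bar>x n + y n\<bar> powr p) \<le> (\<Sum>n. (a + b) powr p * ((1 - t) / a powr p * \<bar>x n\<bar> powr p + t / b powr p * \<bar>y n\<bar> powr p))"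
    using lp_add[OF p x y] sx sy
    by (intro suminf_le le summable_mult summable_add) (auto simp: lp_def)
  also have "\<dots> = (a + b) powr p * ((1 - t) / a powr p * a powr p + t / b powr p * b powr p)"
    by (subst suminf_mult, intro summable_mult summable_add sx sy, subst suminf_add[symmetric],
      (intro summable_mult sx sy)+) (simp only: suminf_mult[OF sx] suminf_mult[OF sy] nx ny)
  also have "\<dots> = (a + b) powr p" using ab by simp
  finally have "lpnorm p (\<lambda>n. x n + y n) \<le> a + b"
    using lpnorm_le_iff[of p "\<lambda>n. x n + y n" "a + b"] lp_add[OF p x y] p ab by auto
  then show ?thesis by (simp add: a_def b_def)
qed

lemma lpnorm_triangle_diff:
  assumes p: "p \<ge> 1" and x: "x \<in> lp p" and y: "y \<in> lp p"
  shows "lpnorm p x \<le> lpnorm p y + lpnorm p (\<lambda>n. x n - y n)"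
  using lpnorm_triangle[OF p y lp_diff[OF p x y]] by simp

lemma lpnorm_triangle3:
  assumes p: "p \<ge> 1" and x: "x \<in> lp p" and y: "y \<in> lp p" and z: "z \<in> lp p"
  shows "lpnorm p (\<lambda>n. x n - z n) \<le> lpnorm p (\<lambda>n. x n - y n) + lpnorm p (\<lambda>n. y n - z n)"
  using lpnorm_triangle[OF p lp_diff[OF p x y] lp_diff[OF p y z]] by simp

section \<open>Bounded k-linear forms and the growth of entire functions\<close>

lemma mlin_combination:
  assumes "is_mlin p k A" "length xs + length ys + 1 = k" "set xs \<subseteq> lp p" "set ys \<subseteq> lp p"
    "u \<in> lp p" "v \<in> lp p"
  shows "A (xs @ (\<lambda>n. a * u n + b * v n) # ys) = a * A (xs @ u # ys) + b * A (xs @ v # ys)"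
  using assms unfolding is_mlin_def by blast

lemma mlnorm_upper:
  assumes "is_mlin p k A" "length hs = k" "\<forall>h\<in>set hs. h \<in> lp p \<and> lpnorm p h \<le> 1"
  shows "\<bar>A hs\<bar> \<le> mlnorm p k A"
proof -
  obtain M where "\<forall>hs. length hs = k \<and> (\<forall>h\<in>set hs. h \<in> lp p \<and> lpnorm p h \<le> 1) \<longrightarrow> \<bar>A hs\<bar> \<le> M"
    using assms(1) unfolding is_mlin_def by blast
  then have "bdd_above ((\<lambda>hs. \<bar>A hs\<bar>) ` {hs. length hs = k \<and> (\<forall>h\<in>set hs. h \<in> lp p \<and> lpnorm p h \<le> 1)})"
    by (intro bdd_aboveI2[of _ _ M]) auto
  then show ?thesis unfolding mlnorm_def using assms by (intro cSUP_upper) auto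
qed

lemma mlnorm_nonneg:
  assumes "is_mlin p k A" shows "mlnorm p k A \<ge> 0"
  using mlnorm_upper[OF assms, of "replicate k (\<lambda>_. 0)"] lp_zero lpnorm_zero by fastforce

text \<open>The induction normalises the arguments one at a time: the head of \<open>hs\<close> is
  scaled into the unit ball and moved to the end of \<open>xs\<close>, until the supremum defining
  \<open>mlnorm\<close> applies to the whole list.\<close>

lemma mlin_bound_aux:
  assumes A: "is_mlin p k A" and p: "p \<ge> 1"
  shows "length xs + length hs = k \<Longrightarrow> \<forall>h\<in>set xs. h \<in> lp p \<and> lpnorm p h \<le> 1 \<Longrightarrow> set hs \<subseteq> lp p
    \<Longrightarrow> \<bar>A (xs @ hs)\<bar> \<le> mlnorm p k A * prod_list (map (lpnorm p) hs)"
proof (induction hs arbitrary: xs)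
  case Nil
  then show ?case using mlnorm_upper[OF A, of xs] by simp
next
  case (Cons h hs)
  \<comment> \<open>If \<open>h\<close> has norm 0, then 1 / 0 = 0 makes \<open>h'\<close> the zero
    sequence, and \<open>h\<close> is zero as well, so the identity \<open>e\<close> holds in this
    case too. Its summand with coefficient 0 only gives it the shape of a linear
    combination.\<close>
  define h' where "h' = (\<lambda>n. (1 / lpnorm p h) * h n)"
  have h: "h \<in> lp p" using Cons by simp
  have h': "h' \<in> lp p" unfolding h'_def by (rule lp_scale[OF h])
  have n': "lpnorm p h' \<le> 1" unfolding h'_def using p h lpnorm_nonneg[of p h]
    by (subst lpnorm_scale) auto
  have e: "h = (\<lambda>n. lpnorm p h * h' n + 0 * h' n)"
    using lpnorm_eq_0[of p h] h p by (auto simp: h'_def)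
  have "A (xs @ (\<lambda>n. lpnorm p h * h' n + 0 * h' n) # hs) = lpnorm p h * A (xs @ h' # hs) + 0 * A (xs @ h' # hs)"
    using Cons.prems h' by (intro mlin_combination[OF A]) auto
  then have "A (xs @ h # hs) = lpnorm p h * A ((xs @ [h']) @ hs)" using e by simp
  moreover have "\<bar>A ((xs @ [h']) @ hs)\<bar> \<le> mlnorm p k A * prod_list (map (lpnorm p) hs)"
    using Cons h' n' by (intro Cons.IH) auto
  ultimately show ?case using lpnorm_nonneg[of p h]
    by (simp add: abs_mult mult.left_commute mult_left_mono)
qed

lemma mlin_bound:
  assumes "is_mlin p k A" "p \<ge> 1" "length hs = k" "set hs \<subseteq> lp p"
  shows "\<bar>A hs\<bar> \<le> mlnorm p k A * prod_list (map (lpnorm p) hs)"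
  using mlin_bound_aux[of p k A "[]" hs] assms by simp

lemma mlin_bound_replicate:
  assumes "is_mlin p k A" "p \<ge> 1" "x \<in> lp p"
  shows "\<bar>A (replicate k x)\<bar> \<le> mlnorm p k A * lpnorm p x ^ k"
  using mlin_bound[OF assms(1,2), of "replicate k x"] assms(3) by (simp add: set_replicate_conv_if)

text \<open>Telescoping over the slots: \<open>B i\<close> has \<open>y\<close> in the first
  \<open>i\<close> slots and \<open>x\<close> in the others. By linearity in slot \<open>i\<close>,
  consecutive terms differ by the form with x - y in that slot, and each of the other m slots
  contributes at most R.\<close>

lemma mlin_diff_replicate:
  assumes A: "is_mlin p k A" and p: "p \<ge> 1" and x: "x \<in> lp p" and y: "y \<in> lp p"
    and R: "lpnorm p x \<le> R" "lpnorm p y \<le> R" and k: "k = Suc m"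
  shows "\<bar>A (replicate k x) - A (replicate k y)\<bar> \<le> k * mlnorm p k A * lpnorm p (\<lambda>n. x n - y n) * R ^ m"
proof -
  define B where "B i = A (replicate i y @ replicate (k - i) x)" for i
  have R0: "R \<ge> 0" using R lpnorm_nonneg[of p x] by simp
  have step: "\<bar>B i - B (Suc i)\<bar> \<le> mlnorm p k A * lpnorm p (\<lambda>n. x n - y n) * R ^ m" if i: "i < k" for i
  proof -
    let ?d = "\<lambda>n. 1 * x n + (-1) * y n"
    let ?r = "replicate (k - Suc i) x"
    have "A (replicate i y @ ?d # ?r) = 1 * A (replicate i y @ x # ?r) + (-1) * A (replicate i y @ y # ?r)"
      using x y i by (intro mlin_combination[OF A]) (auto simp: set_replicate_conv_if)
    moreover have "B i = A (replicate i y @ x # ?r)"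
      using i by (simp add: B_def flip: replicate_Suc Suc_diff_Suc)
    moreover have "B (Suc i) = A (replicate i y @ y # ?r)"
      by (simp add: B_def replicate_app_Cons_same)
    ultimately have "B i - B (Suc i) = A (replicate i y @ ?d # ?r)" by simp
    also have "\<bar>\<dots>\<bar> \<le> mlnorm p k A * prod_list (map (lpnorm p) (replicate i y @ ?d # ?r))"
      using i lp_diff[OF p x y] x y by (intro mlin_bound[OF A p]) (auto simp: set_replicate_conv_if)
    also have "\<dots> = mlnorm p k A * lpnorm p (\<lambda>n. x n - y n) * (lpnorm p y ^ i * lpnorm p x ^ (k - Suc i))"
      by simp
    also have "lpnorm p y ^ i * lpnorm p x ^ (k - Suc i) \<le> R ^ i * R ^ (k - Suc i)"
      using R R0 lpnorm_nonneg by (intro mult_mono power_mono) auto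
    also have "R ^ i * R ^ (k - Suc i) = R ^ m" using i k by (simp flip: power_add)
    finally show ?thesis using mlnorm_nonneg[OF A] lpnorm_nonneg by (simp add: mult_left_mono)
  qed
  have "A (replicate k x) - A (replicate k y) = (\<Sum>i<k. B i - B (Suc i))"
    by (subst sum_lessThan_telescope') (simp add: B_def)
  also have "\<bar>\<dots>\<bar> \<le> (\<Sum>i<k. mlnorm p k A * lpnorm p (\<lambda>n. x n - y n) * R ^ m)"
    by (intro order_trans[OF sum_abs] sum_mono step) auto
  finally show ?thesis by simp
qed

text \<open>All that the probabilistic part retains of a function in \<open>E_omega\<close>. The
  exponential is the sum of the Taylor bounds K r^k / k!, and the Lipschitz constant may grow at the
  same rate because exp is its own derivative.\<close>

definition exp_lipschitz :: "real \<Rightarrow> ((nat \<Rightarrow> real) \<Rightarrow> real) \<Rightarrow> real \<Rightarrow> bool" where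
  "exp_lipschitz p f K \<longleftrightarrow> K \<ge> 0
     \<and> (\<forall>x\<in>lp p. \<bar>f x\<bar> \<le> K * exp (lpnorm p x))
     \<and> (\<forall>x\<in>lp p. \<forall>y\<in>lp p. \<forall>R. lpnorm p x \<le> R \<longrightarrow> lpnorm p y \<le> R
           \<longrightarrow> \<bar>f x - f y\<bar> \<le> K * lpnorm p (\<lambda>n. x n - y n) * exp R)"

lemma sums_abs_le:
  fixes a b :: "nat \<Rightarrow> real"
  assumes "a sums s" "b sums t" "\<And>n. \<bar>a n\<bar> \<le> b n" shows "\<bar>s\<bar> \<le> t"
proof -
  have "norm (suminf a) \<le> suminf b"
    using assms(3) sums_summable[OF assms(2)] by (intro norm_suminf_le) auto
  then show ?thesis using sums_unique[OF assms(1)] sums_unique[OF assms(2)] by simp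
qed

text \<open>Since \<omega> k > 1, the norms of all derivatives at 0 are bounded by one constant
  \<open>K\<close>, so the Taylor series is dominated by the exponential series. In a difference the
  terms of order 0 cancel, and the factor k from the telescoping turns 1 / k! into 1 / (k - 1)!;
  after an index shift the exponential series reappears.\<close>

lemma E_omega_exp_lipschitz:
  assumes f: "f \<in> E_omega p \<omega>" and p: "p \<ge> 1" and \<omega>: "\<forall>k. \<omega> k > 1"
  obtains K where "exp_lipschitz p f K"
proof -
  obtain D where D: "Cinf_at0 p f D"
    and s: "\<And>x. x \<in> lp p \<Longrightarrow> (\<lambda>k. D k (\<lambda>_. 0) (replicate k x) / fact k) sums f x"
    and b: "bdd_above (range (\<lambda>k. mlnorm p k (D k (\<lambda>_. 0)) * \<omega> k ^ k))"
    using f unfolding E_omega_def by auto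
  define A where "A k = D k (\<lambda>_. 0)" for k
  have A: "is_mlin p k (A k)" for k
  proof -
    obtain r where "r > 0" "\<forall>x\<in>lp p. lpnorm p x < r \<longrightarrow> is_mlin p k (D k x)"
      using D unfolding Cinf_at0_def by metis
    then show ?thesis using lp_zero lpnorm_zero unfolding A_def by auto
  qed
  obtain K where K: "\<And>k. mlnorm p k (A k) * \<omega> k ^ k \<le> K"
    using b unfolding bdd_above_def A_def by auto
  have m: "mlnorm p k (A k) \<le> K" for k
  proof -
    have "mlnorm p k (A k) * 1 \<le> mlnorm p k (A k) * \<omega> k ^ k"
      using mlnorm_nonneg[OF A] \<omega> less_imp_le by (intro mult_left_mono one_le_power) auto
    then show ?thesis using K[of k] by simp
  qed
  have K0: "K \<ge> 0" using m[of 0] mlnorm_nonneg[OF A, of 0] by simp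
  have s': "(\<lambda>k. A k (replicate k x) / fact k) sums f x" if "x \<in> lp p" for x
    using s[OF that] by (simp add: A_def)
  have ex: "(\<lambda>k. c * (r ^ k / fact k)) sums (c * exp r)" for c r :: real
    using exp_converges[of r] by (intro sums_mult) (simp add: divide_inverse mult.commute)
  have 1: "\<bar>f x\<bar> \<le> K * exp (lpnorm p x)" if x: "x \<in> lp p" for x
  proof (rule sums_abs_le[OF s'[OF x] ex])
    fix k
    have "\<bar>A k (replicate k x)\<bar> \<le> K * lpnorm p x ^ k"
      using mlin_bound_replicate[OF A p x, of k] m[of k] lpnorm_nonneg[of p x]
      by (meson mult_right_mono order_trans zero_le_power)
    then show "\<bar>A k (replicate k x) / fact k\<bar> \<le> K * (lpnorm p x ^ k / fact k)"
      by (simp add: divide_right_mono)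
  qed
  have 2: "\<bar>f x - f y\<bar> \<le> K * lpnorm p (\<lambda>n. x n - y n) * exp R"
    if x: "x \<in> lp p" and y: "y \<in> lp p" and R: "lpnorm p x \<le> R" "lpnorm p y \<le> R" for x y R
  proof -
    define d where "d = lpnorm p (\<lambda>n. x n - y n)"
    have d0: "d \<ge> 0" by (simp add: d_def lpnorm_nonneg)
    have R0: "R \<ge> 0" using lpnorm_nonneg[of p x] R by linarith
    define a where "a k = A k (replicate k x) / fact k - A k (replicate k y) / fact k" for k
    have "a sums (f x - f y)" unfolding a_def by (intro sums_diff s' x y)
    moreover have "a 0 = 0" by (simp add: a_def)
    ultimately have "(\<lambda>k. a (Suc k)) sums (f x - f y)" by (subst sums_Suc_iff) simp
    then have "\<bar>f x - f y\<bar> \<le> (K * d) * exp R"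
    proof (rule sums_abs_le[OF _ ex])
      fix k
      have "\<bar>A (Suc k) (replicate (Suc k) x) - A (Suc k) (replicate (Suc k) y)\<bar>
        \<le> real (Suc k) * mlnorm p (Suc k) (A (Suc k)) * d * R ^ k"
        unfolding d_def by (intro mlin_diff_replicate A p x y R refl)
      also have "\<dots> \<le> real (Suc k) * K * d * R ^ k"
        using m[of "Suc k"] d0 R0 by (intro mult_right_mono mult_left_mono) auto
      finally have "\<bar>a (Suc k)\<bar> \<le> real (Suc k) * K * d * R ^ k / fact (Suc k)"
        unfolding a_def by (subst diff_divide_distrib[symmetric]) (simp add: divide_right_mono del: fact_Suc)
      also have "\<dots> = (K * d) * (R ^ k / fact k)" by (simp add: fact_Suc divide_simps del: of_nat_Suc)
      finally show "\<bar>a (Suc k)\<bar> \<le> (K * d) * (R ^ k / fact k)" .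
    qed
    then show ?thesis by (simp add: d_def)
  qed
  show thesis by (rule that[of K]) (auto simp: exp_lipschitz_def K0 1 2)
qed

section \<open>Square-integrable functions and product measures\<close>

definition sq_int :: "'a measure \<Rightarrow> ('a \<Rightarrow> real) \<Rightarrow> bool" where
  "sq_int M f \<longleftrightarrow> f \<in> borel_measurable M \<and> integrable M (\<lambda>x. (f x)\<^sup>2)"

definition l2norm :: "'a measure \<Rightarrow> ('a \<Rightarrow> real) \<Rightarrow> real" where
  "l2norm M f = sqrt (\<integral>x. (f x)\<^sup>2 \<partial>M)"

lemma sq_int_measurable: "sq_int M f \<Longrightarrow> f \<in> borel_measurable M"
  by (simp add: sq_int_def)

lemma l2norm_nonneg [simp]: "l2norm M f \<ge> 0"
  by (simp add: l2norm_def)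

lemma l2norm_power2: "(l2norm M f)\<^sup>2 = (\<integral>x. (f x)\<^sup>2 \<partial>M)"
  by (simp add: l2norm_def)

lemma sq_int_times_integrable:
  assumes "sq_int M f" "sq_int M g" shows "integrable M (\<lambda>x. f x * g x)"
proof (rule Bochner_Integration.integrable_bound)
  show "integrable M (\<lambda>x. (f x)\<^sup>2 + (g x)\<^sup>2)" using assms by (auto simp: sq_int_def)
  show "(\<lambda>x. f x * g x) \<in> borel_measurable M"
    using assms by (auto simp: sq_int_def intro!: borel_measurable_times)
  have "\<bar>a * b\<bar> \<le> a\<^sup>2 + b\<^sup>2" for a b :: real
    using sum_squares_bound[of "\<bar>a\<bar>" "\<bar>b\<bar>"] zero_le_power2[of a] zero_le_power2[of b]
    unfolding abs_mult power2_abs by linarith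
  then show "AE x in M. norm (f x * g x) \<le> norm ((f x)\<^sup>2 + (g x)\<^sup>2)" by auto
qed

lemma sq_int_scale [intro]: "sq_int M f \<Longrightarrow> sq_int M (\<lambda>x. c * f x)"
  by (auto simp: sq_int_def power_mult_distrib)

lemma sq_int_add [intro]:
  assumes "sq_int M f" "sq_int M g" shows "sq_int M (\<lambda>x. f x + g x)"
proof -
  have "integrable M (\<lambda>x. (f x)\<^sup>2 + (g x)\<^sup>2 + 2 * (f x * g x))"
    using assms sq_int_times_integrable[OF assms] by (auto simp: sq_int_def)
  then show ?thesis using assms by (auto simp: sq_int_def power2_sum mult.assoc)
qed

lemma sq_int_diff [intro]:
  assumes "sq_int M f" "sq_int M g" shows "sq_int M (\<lambda>x. f x - g x)"
  using sq_int_add[OF assms(1) sq_int_scale[OF assms(2), of "-1"]] by simp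

lemma sq_int_zero [intro]: "sq_int M (\<lambda>_. 0)"
  by (simp add: sq_int_def)

lemma sq_int_sum [intro]:
  assumes "\<And>i. i \<in> I \<Longrightarrow> sq_int M (f i)" shows "sq_int M (\<lambda>x. \<Sum>i\<in>I. f i x)"
  using assms by (induction I rule: infinite_finite_induct) auto

lemma l2norm_Cauchy_Schwarz:
  assumes f: "sq_int M f" and g: "sq_int M g"
  shows "\<bar>\<integral>x. f x * g x \<partial>M\<bar> \<le> l2norm M f * l2norm M g"
proof -
  define A B C where "A = (\<integral>x. (f x)\<^sup>2 \<partial>M)" and "B = (\<integral>x. (g x)\<^sup>2 \<partial>M)" and "C = (\<integral>x. f x * g x \<partial>M)"
  note i = f[unfolded sq_int_def, THEN conjunct2] g[unfolded sq_int_def, THEN conjunct2] sq_int_times_integrable[OF f g]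
  have AB: "A \<ge> 0" "B \<ge> 0" by (auto simp: A_def B_def)
  have "C\<^sup>2 \<le> A * B"
  proof (cases "B = 0")
    case True
    then have "AE x in M. (g x)\<^sup>2 = 0"
      using integral_nonneg_eq_0_iff_AE[OF i(2)] by (auto simp: B_def)
    then have "C = (\<integral>x. 0 \<partial>M)" unfolding C_def
      using f g by (intro integral_cong_AE) (auto simp: sq_int_def intro!: borel_measurable_times)
    then show ?thesis using AB by simp
  next
    case False
    \<comment> \<open>B f - C g is B times the component of f orthogonal to g; expanding its squared
      norm gives B (A B - C^2).\<close>
    have "0 \<le> (\<integral>x. (B * f x - C * g x)\<^sup>2 \<partial>M)" by simp
    also have "\<dots> = (\<integral>x. B\<^sup>2 * (f x)\<^sup>2 + C\<^sup>2 * (g x)\<^sup>2 - 2 * B * C * (f x * g x) \<partial>M)"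
      by (intro Bochner_Integration.integral_cong) (auto simp: power2_diff power_mult_distrib)
    also have "\<dots> = B\<^sup>2 * A + C\<^sup>2 * B - 2 * B * C * C"
      using i by (simp add: A_def B_def C_def)
    also have "\<dots> = B * (A * B - C\<^sup>2)" by (simp add: power2_eq_square algebra_simps)
    finally show ?thesis using False AB by (simp add: zero_le_mult_iff)
  qed
  then have "\<bar>C\<bar> \<le> sqrt (A * B)" by (simp add: real_le_rsqrt real_sqrt_abs[symmetric] del: real_sqrt_abs)
  then show ?thesis by (simp add: A_def B_def C_def l2norm_def real_sqrt_mult)
qed

lemma l2norm_triangle:
  assumes f: "sq_int M f" and g: "sq_int M g"
  shows "l2norm M (\<lambda>x. f x + g x) \<le> l2norm M f + l2norm M g"
proof -
  note i = f[unfolded sq_int_def, THEN conjunct2] g[unfolded sq_int_def, THEN conjunct2] sq_int_times_integrable[OF f g]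
  have "(l2norm M (\<lambda>x. f x + g x))\<^sup>2 = (\<integral>x. (f x)\<^sup>2 + (g x)\<^sup>2 + 2 * (f x * g x) \<partial>M)"
    unfolding l2norm_power2 by (intro Bochner_Integration.integral_cong) (auto simp: power2_sum)
  also have "\<dots> = (l2norm M f)\<^sup>2 + (l2norm M g)\<^sup>2 + 2 * (\<integral>x. f x * g x \<partial>M)"
    using i by (simp add: l2norm_power2)
  also have "\<dots> \<le> (l2norm M f + l2norm M g)\<^sup>2"
    using l2norm_Cauchy_Schwarz[OF f g] by (simp add: power2_sum)
  finally show ?thesis by (rule power2_le_imp_le) simp
qed

lemma l2norm_scale: "l2norm M (\<lambda>x. c * f x) = \<bar>c\<bar> * l2norm M f"
  by (simp add: l2norm_def power_mult_distrib real_sqrt_mult)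

lemma l2norm_diff_le:
  assumes "sq_int M f" "sq_int M g" shows "l2norm M (\<lambda>x. f x - g x) \<le> l2norm M f + l2norm M g"
  using l2norm_triangle[OF assms(1) sq_int_scale[OF assms(2), of "-1"]] l2norm_scale[of M "-1" g] by simp

lemma l2norm_zero [simp]: "l2norm M (\<lambda>_. 0) = 0"
  by (simp add: l2norm_def)

lemma l2norm_sum_le:
  assumes "\<And>i. i \<in> I \<Longrightarrow> sq_int M (f i)" shows "l2norm M (\<lambda>x. \<Sum>i\<in>I. f i x) \<le> (\<Sum>i\<in>I. l2norm M (f i))"
  using assms
proof (induction I rule: infinite_finite_induct)
  case (insert i I)
  have "l2norm M (\<lambda>x. f i x + (\<Sum>i\<in>I. f i x)) \<le> l2norm M (f i) + l2norm M (\<lambda>x. \<Sum>i\<in>I. f i x)"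
    using insert by (intro l2norm_triangle) auto
  then show ?case using insert by force
qed auto

context prob_space
begin

lemma sq_int_const [intro]: "sq_int M (\<lambda>_. c)"
  by (simp add: sq_int_def)

lemma sq_int_integrable: "sq_int M f \<Longrightarrow> integrable M f"
  unfolding sq_int_def by (elim conjE) (rule square_integrable_imp_integrable)

lemma abs_expectation_le_l2norm:
  assumes "sq_int M f" shows "\<bar>expectation f\<bar> \<le> l2norm M f"
  using l2norm_Cauchy_Schwarz[OF assms sq_int_const[of 1]] by (simp add: l2norm_def prob_space)

lemma expectation_abs_le_l2norm:
  assumes "sq_int M f" shows "expectation (\<lambda>x. \<bar>f x\<bar>) \<le> l2norm M f"
proof -
  have "sq_int M (\<lambda>x. \<bar>f x\<bar>)" using assms by (auto simp: sq_int_def)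
  from abs_expectation_le_l2norm[OF this] have "expectation (\<lambda>x. \<bar>f x\<bar>) \<le> l2norm M (\<lambda>x. \<bar>f x\<bar>)" by linarith
  then show ?thesis by (simp add: l2norm_def)
qed

lemma Cov_self:
  assumes "sq_int M f" shows "Cov M f f = (l2norm M (\<lambda>x. f x - expectation f))\<^sup>2"
proof -
  have "variance f = expectation (\<lambda>x. (f x)\<^sup>2) - (expectation f)\<^sup>2"
    using assms sq_int_integrable[OF assms] by (intro variance_eq) (auto simp: sq_int_def)
  then show ?thesis unfolding l2norm_power2 by (simp add: Cov_def power2_eq_square)
qed

end

section \<open>Measure-preserving maps and infinite products of one law\<close>

definition meas_pres :: "'a measure \<Rightarrow> 'b measure \<Rightarrow> ('a \<Rightarrow> 'b) \<Rightarrow> bool" where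
  "meas_pres M N \<phi> \<longleftrightarrow> \<phi> \<in> measurable M N \<and> distr M N \<phi> = N"

lemma meas_pres_measurable: "meas_pres M N \<phi> \<Longrightarrow> \<phi> \<in> measurable M N"
  by (simp add: meas_pres_def)

lemma meas_pres_integral:
  fixes f :: "_ \<Rightarrow> 'c::{banach, second_countable_topology}"
  assumes "meas_pres M N \<phi>" "f \<in> borel_measurable N"
  shows "(\<integral>x. f (\<phi> x) \<partial>M) = (\<integral>x. f x \<partial>N)"
  using assms integral_distr[of \<phi> M N f] by (simp add: meas_pres_def)

lemma meas_pres_integrable:
  fixes f :: "_ \<Rightarrow> 'c::{banach, second_countable_topology}"
  assumes "meas_pres M N \<phi>" "integrable N f"
  shows "integrable M (\<lambda>x. f (\<phi> x))"
  using assms integrable_distr[of \<phi> M N f] by (simp add: meas_pres_def)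

lemma meas_pres_AE:
  assumes "meas_pres M N \<phi>" "AE x in N. P x" shows "AE x in M. P (\<phi> x)"
proof (rule AE_distrD[where f = \<phi> and M' = N and P = P])
  show "\<phi> \<in> measurable M N" using assms(1) by (rule meas_pres_measurable)
  have "distr M N \<phi> = N" using assms(1) unfolding meas_pres_def by (rule conjunct2)
  then show "AE x in distr M N \<phi>. P x" by (rule ssubst) (rule assms(2))
qed

lemma meas_pres_sq_int: "meas_pres M N \<phi> \<Longrightarrow> sq_int N f \<Longrightarrow> sq_int M (\<lambda>x. f (\<phi> x))"
  unfolding sq_int_def by (auto intro: meas_pres_integrable measurable_compose[OF meas_pres_measurable])

lemma meas_pres_l2norm: "meas_pres M N \<phi> \<Longrightarrow> sq_int N f \<Longrightarrow> l2norm M (\<lambda>x. f (\<phi> x)) = l2norm N f"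
  unfolding l2norm_def sq_int_def by (subst meas_pres_integral) auto

definition seq_shift :: "nat \<Rightarrow> (nat \<Rightarrow> real) \<Rightarrow> nat \<Rightarrow> real" where
  "seq_shift n \<omega> = (\<lambda>k. \<omega> (k + n))"

definition seq_trunc :: "nat \<Rightarrow> (nat \<Rightarrow> real) \<Rightarrow> nat \<Rightarrow> real" where
  "seq_trunc N \<omega> = (\<lambda>k. if k < N then \<omega> k else 0)"

locale iid_real = prob_space \<nu> for \<nu> :: "real measure" +
  assumes sets_nu [simp, measurable_cong]: "sets \<nu> = sets borel"
begin

abbreviation prodm :: "('i \<Rightarrow> real) measure" where
  "prodm \<equiv> \<Pi>\<^sub>M i\<in>UNIV. \<nu>"

abbreviation S :: "(nat \<Rightarrow> real) measure" where "S \<equiv> prodm"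
abbreviation RR :: "(nat \<times> bool \<Rightarrow> real) measure" where "RR \<equiv> prodm"

lemma space_nu [simp]: "space \<nu> = UNIV"
  using sets_eq_imp_space_eq[OF sets_nu] by simp

lemma space_prodm [simp]: "space (prodm :: ('i \<Rightarrow> real) measure) = UNIV"
  by (simp add: space_PiM)

lemma prob_space_nu: "prob_space \<nu>" by unfold_locales

sublocale PS: prob_space S by (intro prob_space_PiM prob_space_nu)
sublocale PR: prob_space RR by (intro prob_space_PiM prob_space_nu)

lemma prob_space_prodm: "prob_space (prodm :: ('i \<Rightarrow> real) measure)"
  by (intro prob_space_PiM prob_space_nu)

lemma measure_prodm_UNIV [simp]: "measure (prodm :: ('i \<Rightarrow> real) measure) UNIV = 1"
  using prob_space.prob_space[OF prob_space_prodm] by simp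

lemma measurable_into_prodm:
  assumes "\<And>i. (\<lambda>z. f z i) \<in> borel_measurable M"
  shows "f \<in> measurable M (prodm :: ('i \<Rightarrow> real) measure)"
proof -
  have "(\<lambda>z. \<lambda>i\<in>UNIV. f z i) \<in> measurable M (prodm :: ('i \<Rightarrow> real) measure)"
    using assms by (intro measurable_restrict) (simp add: measurable_cong_sets[OF refl sets_nu])
  then show ?thesis by (simp add: restrict_def)
qed

lemma measurable_coord [measurable]: "(\<lambda>z. z i) \<in> borel_measurable (prodm :: ('i \<Rightarrow> real) measure)"
  using measurable_component_singleton[of i UNIV "\<lambda>_. \<nu>"] by (simp add: measurable_cong_sets[OF refl sets_nu])

text \<open>The single source of measure preservation below. The shift, the hybrids of two copies
  and the swaps are all precompositions with an injective map of indices, and such maps preserve a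
  product of identical laws.\<close>

lemma meas_pres_reindex:
  fixes t :: "'i \<Rightarrow> 'j"
  assumes "inj t" shows "meas_pres prodm prodm (\<lambda>z i. z (t i))"
  using distr_PiM_reindex[of UNIV "\<lambda>_. \<nu>" t UNIV] assms prob_space_nu
  by (auto simp: meas_pres_def restrict_def intro!: measurable_into_prodm)

lemma meas_pres_coord: "meas_pres (prodm :: ('i \<Rightarrow> real) measure) \<nu> (\<lambda>z. z i)"
  using distr_PiM_component[of UNIV "\<lambda>_. \<nu>" i] prob_space_nu
  by (simp add: meas_pres_def measurable_cong_sets[OF refl sets_nu])

lemma indep_coords:
  "prob_space.indep_vars (prodm :: ('i \<Rightarrow> real) measure) (\<lambda>_. \<nu>) (\<lambda>i z. z i) UNIV"
proof -
  interpret P: prob_space "prodm :: ('i \<Rightarrow> real) measure" by (rule prob_space_prodm)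
  show ?thesis
    using meas_pres_coord[where ?'i = 'i]
    by (subst P.indep_vars_iff_distr_eq_PiM) (auto simp: meas_pres_def restrict_def distr_id[unfolded id_def])
qed

lemma measurable_extend:
  "(\<lambda>x i. if i \<in> A then x i else (0::real)) \<in> measurable (\<Pi>\<^sub>M i\<in>A. \<nu>) (prodm :: ('i \<Rightarrow> real) measure)"
proof (rule measurable_into_prodm)
  fix i show "(\<lambda>z. if i \<in> A then z i else (0::real)) \<in> borel_measurable (\<Pi>\<^sub>M i\<in>A. \<nu>)"
    using measurable_component_singleton[of i A "\<lambda>_. \<nu>"]
    by (cases "i \<in> A") (auto simp: measurable_cong_sets[OF refl sets_nu])
qed

text \<open>Dependence on the coordinates in \<open>A b\<close> is expressed as invariance under
  changes elsewhere. Hence \<open>F b\<close> factors through the restriction to \<open>A b\<close>,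
  followed by extension with zeros, and restrictions to disjoint index sets are independent.\<close>

lemma indep_vars_blocks:
  fixes F :: "'k \<Rightarrow> ('i \<Rightarrow> real) \<Rightarrow> 'c::topological_space"
  assumes F: "\<And>b. F b \<in> borel_measurable prodm"
    and dep: "\<And>b z z'. (\<And>i. i \<in> A b \<Longrightarrow> z i = z' i) \<Longrightarrow> F b z = F b z'"
    and disj: "disjoint_family A"
  shows "prob_space.indep_vars prodm (\<lambda>_. borel) F UNIV"
proof -
  interpret P: prob_space "prodm :: ('i \<Rightarrow> real) measure" by (rule prob_space_prodm)
  have "P.indep_vars (\<lambda>b. \<Pi>\<^sub>M i\<in>A b. \<nu>) (\<lambda>b z. restrict (\<lambda>i. z i) (A b)) UNIV"
    using disj by (intro P.indep_vars_restrict[OF indep_coords]) auto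
  then have "P.indep_vars (\<lambda>_. borel)
      (\<lambda>b z. F b ((\<lambda>x i. if i \<in> A b then x i else 0) (restrict (\<lambda>i. z i) (A b)))) UNIV"
    by (rule P.indep_vars_compose2) (intro measurable_compose[OF measurable_extend F])
  also have "(\<lambda>b z. F b ((\<lambda>x i. if i \<in> A b then x i else 0) (restrict (\<lambda>i. z i) (A b)))) = F"
    by (intro ext dep) auto
  finally show ?thesis .
qed

lemma indep_integral:
  fixes F G :: "('i \<Rightarrow> real) \<Rightarrow> real"
  assumes F: "integrable prodm F" and G: "integrable prodm G"
    and dF: "\<And>z z'. (\<And>i. i \<in> A \<Longrightarrow> z i = z' i) \<Longrightarrow> F z = F z'"
    and dG: "\<And>z z'. (\<And>i. i \<in> B \<Longrightarrow> z i = z' i) \<Longrightarrow> G z = G z'"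
    and AB: "A \<inter> B = {}"
  shows "(\<integral>z. F z * G z \<partial>prodm) = (\<integral>z. F z \<partial>prodm) * (\<integral>z. G z \<partial>prodm)"
proof -
  interpret P: prob_space "prodm :: ('i \<Rightarrow> real) measure" by (rule prob_space_prodm)
  have "P.indep_vars (\<lambda>_. borel) (case_bool F G) UNIV"
  proof (rule indep_vars_blocks[of _ "case_bool A B"])
    show "case_bool F G b \<in> borel_measurable prodm" for b
      using F G by (cases b) auto
    show "case_bool F G b z = case_bool F G b z'" if "\<And>i. i \<in> case_bool A B b \<Longrightarrow> z i = z' i" for b z z'
      using that dF[of z z'] dG[of z z'] by (cases b) auto
    show "disjoint_family (case_bool A B)"
      using AB by (auto simp: disjoint_family_on_def split: bool.splits)
  qed
  moreover have "case_bool borel borel = (\<lambda>_. borel :: real measure)" by (auto split: bool.splits)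
  ultimately have "P.indep_var borel F borel G" by (simp add: P.indep_var_def)
  then show ?thesis using F G by (rule P.indep_var_lebesgue_integral)
qed

section \<open>Resampling coordinates with two independent copies\<close>

text \<open>A point of \<open>RR\<close> consists of two independent copies of the sequence, indexed by \<open>bool\<close>;
  \<open>hybrid A\<close> reads the second copy on \<open>A\<close> and the first one elsewhere.\<close>

definition hybrid :: "nat set \<Rightarrow> (nat \<times> bool \<Rightarrow> real) \<Rightarrow> nat \<Rightarrow> real" where
  "hybrid A z = (\<lambda>k. z (k, k \<in> A))"

definition swap_at :: "nat set \<Rightarrow> (nat \<times> bool \<Rightarrow> real) \<Rightarrow> nat \<times> bool \<Rightarrow> real" where
  "swap_at B z = (\<lambda>i. z (fst i, snd i \<noteq> (fst i \<in> B)))"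

lemma meas_pres_shift: "meas_pres S S (seq_shift n)"
  unfolding seq_shift_def[abs_def] by (rule meas_pres_reindex) (auto simp: inj_on_def)

lemma meas_pres_hybrid: "meas_pres RR S (hybrid A)"
  unfolding hybrid_def[abs_def] by (rule meas_pres_reindex) (auto simp: inj_on_def)

lemma meas_pres_swap_at: "meas_pres RR RR (swap_at B)"
  unfolding swap_at_def[abs_def] by (rule meas_pres_reindex) (auto simp: inj_on_def)

lemma seq_trunc_measurable [measurable]: "seq_trunc N \<in> measurable S S"
  unfolding seq_trunc_def[abs_def] by (rule measurable_into_prodm) simp

lemma seq_shift_measurable [measurable]: "seq_shift n \<in> measurable S S"
  using meas_pres_shift by (rule meas_pres_measurable)

lemma hybrid_measurable [measurable]: "hybrid A \<in> measurable RR S"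
  using meas_pres_hybrid by (rule meas_pres_measurable)

text \<open>Swaps act on hybrids through symmetric difference of index sets, so a measure-preserving
  change of variables can carry one pair of hybrids to another.\<close>

lemma hybrid_swap_at: "hybrid A (swap_at B z) = hybrid (sym_diff A B) z"
proof -
  have "((k \<in> A) \<noteq> (k \<in> B)) = (k \<in> sym_diff A B)" for k by auto
  then show ?thesis unfolding hybrid_def swap_at_def by simp
qed

text \<open>The square of this quantity is twice the expected conditional variance of
  \<open>F\<close> given all coordinates other than \<open>k\<close>, the usual Efron-Stein
  term.\<close>

definition influence :: "nat \<Rightarrow> ((nat \<Rightarrow> real) \<Rightarrow> real) \<Rightarrow> real" where
  "influence k F = l2norm RR (\<lambda>z. F (hybrid {} z) - F (hybrid {k} z))"

lemma influence_nonneg [simp]: "influence k F \<ge> 0"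
  by (simp add: influence_def)

lemma sq_int_hybrid [intro]: "sq_int S F \<Longrightarrow> sq_int RR (\<lambda>z. F (hybrid A z))"
  by (rule meas_pres_sq_int[OF meas_pres_hybrid])

lemma sq_int_shift [intro]: "sq_int S F \<Longrightarrow> sq_int S (\<lambda>z. F (seq_shift n z))"
  by (rule meas_pres_sq_int[OF meas_pres_shift])

lemma l2norm_shift: "sq_int S F \<Longrightarrow> l2norm S (\<lambda>z. F (seq_shift n z)) = l2norm S F"
  by (rule meas_pres_l2norm[OF meas_pres_shift])

lemma l2norm_hybrid: "sq_int S F \<Longrightarrow> l2norm RR (\<lambda>z. F (hybrid A z)) = l2norm S F"
  by (rule meas_pres_l2norm[OF meas_pres_hybrid])

lemma influence_le_l2norm:
  assumes "sq_int S F" shows "influence k F \<le> 2 * l2norm S F"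
  using l2norm_diff_le[OF sq_int_hybrid[OF assms, of "{}"] sq_int_hybrid[OF assms, of "{k}"]] l2norm_hybrid[OF assms]
  by (simp add: influence_def)

lemma influence_sum_le:
  assumes "\<And>i. i \<in> I \<Longrightarrow> sq_int S (F i)"
  shows "influence k (\<lambda>\<omega>. \<Sum>i\<in>I. F i \<omega>) \<le> (\<Sum>i\<in>I. influence k (F i))"
  unfolding influence_def sum_subtractf[symmetric] using assms by (intro l2norm_sum_le sq_int_diff sq_int_hybrid)

lemma influence_diff_le:
  assumes "sq_int S F" "sq_int S G"
  shows "influence k (\<lambda>\<omega>. F \<omega> - G \<omega>) \<le> influence k F + influence k G"
proof -
  have "l2norm RR (\<lambda>z. (F (hybrid {} z) - F (hybrid {k} z)) - (G (hybrid {} z) - G (hybrid {k} z)))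
      \<le> influence k F + influence k G"
    unfolding influence_def using assms by (intro l2norm_diff_le) auto
  then show ?thesis by (simp add: influence_def algebra_simps)
qed

lemma influence_shift:
  assumes F: "sq_int S F"
  shows "influence k (\<lambda>\<omega>. F (seq_shift n \<omega>)) = (if n \<le> k then influence (k - n) F else 0)"
proof -
  \<comment> \<open>\<open>\<tau>\<close> shifts both copies together. Resampling at
    \<open>k\<close> before the shift is resampling at k - n after it, and has no effect when k < n
    because that coordinate is dropped.\<close>
  define \<tau> :: "(nat \<times> bool \<Rightarrow> real) \<Rightarrow> nat \<times> bool \<Rightarrow> real"
    where "\<tau> z = (\<lambda>i. z (fst i + n, snd i))" for z
  have \<tau>: "meas_pres RR RR \<tau>"
    unfolding \<tau>_def[abs_def] by (rule meas_pres_reindex) (auto simp: inj_on_def)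
  have 0: "seq_shift n (hybrid {} z) = hybrid {} (\<tau> z)" for z
    by (simp add: seq_shift_def hybrid_def \<tau>_def)
  have 1: "seq_shift n (hybrid {k} z) = hybrid (if n \<le> k then {k - n} else {}) (\<tau> z)" for z
  proof
    fix j
    have "(j + n = k) \<longleftrightarrow> (j \<in> (if n \<le> k then {k - n} else {}))" by auto
    then show "seq_shift n (hybrid {k} z) j = hybrid (if n \<le> k then {k - n} else {}) (\<tau> z) j"
      by (simp only: seq_shift_def hybrid_def \<tau>_def fst_conv snd_conv singleton_iff)
  qed
  have "influence k (\<lambda>\<omega>. F (seq_shift n \<omega>)) = l2norm RR (\<lambda>z. F (hybrid {} z) - F (hybrid (if n \<le> k then {k - n} else {}) z))"
    unfolding influence_def 0 1 by (rule meas_pres_l2norm[OF \<tau>]) (use F in auto)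
  then show ?thesis by (simp add: influence_def)
qed

text \<open>Substitute for martingale approximation: \<open>F\<close> composed with
  \<open>seq_trunc N\<close> reads finitely many coordinates, hence is independent of whatever is
  built from the others.\<close>

definition approximable :: "((nat \<Rightarrow> real) \<Rightarrow> real) \<Rightarrow> bool" where
  "approximable F \<longleftrightarrow> sq_int S F \<and> (\<forall>N. sq_int S (\<lambda>\<omega>. F (seq_trunc N \<omega>)))
     \<and> (\<lambda>N. l2norm S (\<lambda>\<omega>. F \<omega> - F (seq_trunc N \<omega>))) \<longlonglongrightarrow> 0"

text \<open>Exchanging the two copies at \<open>k\<close> changes the sign of the increment of \<open>G\<close>, so \<open>F\<close> can be replaced
  by half of its own increment at \<open>k\<close>.\<close>

lemma Efron_Stein_step:
  assumes F: "sq_int S F" and G: "sq_int S G"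
  shows "\<bar>\<integral>z. F (hybrid {} z) * (G (hybrid {..<k} z) - G (hybrid {..<Suc k} z)) \<partial>RR\<bar> \<le> influence k F * influence k G / 2"
proof -
  define D where "D z = G (hybrid {..<k} z) - G (hybrid {..<Suc k} z)" for z
  have D: "sq_int RR D" unfolding D_def[abs_def] using G by auto
  have s1: "sym_diff {..<k} {k} = {..<Suc k}" "sym_diff {..<Suc k} {k} = {..<k}" "sym_diff {} {k} = {k}"
    "sym_diff {} {..<k} = {..<k}" "sym_diff {k} {..<k} = {..<Suc k}" by auto
  have "(\<integral>z. F (hybrid {} z) * D z \<partial>RR) = (\<integral>z. F (hybrid {} (swap_at {k} z)) * D (swap_at {k} z) \<partial>RR)"
    using F D by (intro meas_pres_integral[OF meas_pres_swap_at, symmetric] borel_measurable_times) (auto simp: sq_int_def)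
  also have "\<dots> = (\<integral>z. - (F (hybrid {k} z) * D z) \<partial>RR)"
    unfolding D_def hybrid_swap_at s1 by (simp add: algebra_simps)
  finally have "2 * (\<integral>z. F (hybrid {} z) * D z \<partial>RR) = (\<integral>z. F (hybrid {} z) * D z \<partial>RR) - (\<integral>z. F (hybrid {k} z) * D z \<partial>RR)"
    by simp
  also have "\<dots> = (\<integral>z. (F (hybrid {} z) - F (hybrid {k} z)) * D z \<partial>RR)"
    using sq_int_times_integrable[OF sq_int_hybrid[OF F, of "{}"] D] sq_int_times_integrable[OF sq_int_hybrid[OF F, of "{k}"] D]
    by (simp add: left_diff_distrib)
  also have "\<bar>\<dots>\<bar> \<le> influence k F * l2norm RR D"
    unfolding influence_def using F D by (intro l2norm_Cauchy_Schwarz) auto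
  \<comment> \<open>Exchanging the copies on \<open>{..<k}\<close> takes the hybrids over
    \<open>{}\<close> and \<open>{k}\<close> to those over \<open>{..<k}\<close> and
    \<open>{..<Suc k}\<close>, so the increments have the same law.\<close>
  also have "l2norm RR D = influence k G"
  proof -
    have "influence k G = l2norm RR (\<lambda>z. G (hybrid {} (swap_at {..<k} z)) - G (hybrid {k} (swap_at {..<k} z)))"
      unfolding influence_def using G by (intro meas_pres_l2norm[OF meas_pres_swap_at, symmetric]) auto
    then show ?thesis unfolding hybrid_swap_at s1 D_def[abs_def] by simp
  qed
  finally show ?thesis by (simp add: D_def abs_mult)
qed

text \<open>Replacing the coordinates in the argument of \<open>G\<close> one by one with
  independent copies interpolates between the integral of F G and, once all are replaced, the
  product of the two integrals. Each replacement costs half a product of influences.\<close>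

theorem Efron_Stein:
  assumes F: "approximable F" and G: "sq_int S G" and sm: "summable (\<lambda>k. influence k F * influence k G)"
  shows "\<bar>Cov S F G\<bar> \<le> (\<Sum>k. influence k F * influence k G) / 2"
proof -
  have F2: "sq_int S F" and FN2: "\<And>N. sq_int S (\<lambda>\<omega>. F (seq_trunc N \<omega>))"
    and lim: "(\<lambda>N. l2norm S (\<lambda>\<omega>. F \<omega> - F (seq_trunc N \<omega>))) \<longlonglongrightarrow> 0"
    using F by (auto simp: approximable_def)
  define e where "e N = l2norm S (\<lambda>\<omega>. F \<omega> - F (seq_trunc N \<omega>))" for N
  \<comment> \<open>The truncation error enters twice: when \<open>F\<close> is made independent of
    the hybrid, and when the mean of the truncated \<open>F\<close> is exchanged for that of
    \<open>F\<close>.\<close>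
  have le: "\<bar>Cov S F G\<bar> \<le> (\<Sum>k. influence k F * influence k G) / 2 + 2 * e N * l2norm S G" for N
  proof -
    define c where "c A = (\<integral>z. F (hybrid {} z) * G (hybrid A z) \<partial>RR)" for A
    have c0: "c {} = (\<integral>\<omega>. F \<omega> * G \<omega> \<partial>S)"
      unfolding c_def using F2 G
      by (intro meas_pres_integral[OF meas_pres_hybrid]) (auto simp: sq_int_def intro!: borel_measurable_times)
    have "c {} - c {..<N} = (\<Sum>k<N. c {..<k} - c {..<Suc k})"
      by (subst sum_lessThan_telescope') simp
    also have "\<dots> = (\<Sum>k<N. \<integral>z. F (hybrid {} z) * (G (hybrid {..<k} z) - G (hybrid {..<Suc k} z)) \<partial>RR)"
    proof (rule sum.cong[OF refl])
      fix k
      show "c {..<k} - c {..<Suc k} = (\<integral>z. F (hybrid {} z) * (G (hybrid {..<k} z) - G (hybrid {..<Suc k} z)) \<partial>RR)"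
        unfolding c_def right_diff_distrib
        by (intro Bochner_Integration.integral_diff[symmetric] sq_int_times_integrable sq_int_hybrid F2 G)
    qed
    also have "\<bar>\<dots>\<bar> \<le> (\<Sum>k<N. influence k F * influence k G / 2)"
      by (intro order_trans[OF sum_abs] sum_mono Efron_Stein_step F2 G)
    also have "\<dots> \<le> (\<Sum>k. influence k F * influence k G / 2)"
      using sm by (intro sum_le_suminf summable_divide) auto
    also have "\<dots> = (\<Sum>k. influence k F * influence k G) / 2"
      using sm by (rule suminf_divide)
    finally have 1: "\<bar>c {} - c {..<N}\<bar> \<le> (\<Sum>k. influence k F * influence k G) / 2" .
    \<comment> \<open>The truncated \<open>F\<close> reads the first copy below \<open>N\<close>
      only. The hybrid reads the second copy there and the first copy from \<open>N\<close> on, so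
      the two sets of indices are disjoint.\<close>
    have "(\<integral>z. F (seq_trunc N (hybrid {} z)) * G (hybrid {..<N} z) \<partial>RR)
        = (\<integral>z. F (seq_trunc N (hybrid {} z)) \<partial>RR) * (\<integral>z. G (hybrid {..<N} z) \<partial>RR)"
    proof (rule indep_integral[where A = "{..<N} \<times> {False}" and B = "- ({..<N} \<times> {False})"])
      show "integrable RR (\<lambda>z. F (seq_trunc N (hybrid {} z)))"
        using meas_pres_integrable[OF meas_pres_hybrid PS.sq_int_integrable[OF FN2]] .
      show "integrable RR (\<lambda>z. G (hybrid {..<N} z))"
        using meas_pres_integrable[OF meas_pres_hybrid PS.sq_int_integrable[OF G]] .
    next
      fix z z' :: "nat \<times> bool \<Rightarrow> real" assume "\<And>i. i \<in> {..<N} \<times> {False} \<Longrightarrow> z i = z' i"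
      then have "seq_trunc N (hybrid {} z) = seq_trunc N (hybrid {} z')" by (intro ext) (simp add: seq_trunc_def hybrid_def)
      then show "F (seq_trunc N (hybrid {} z)) = F (seq_trunc N (hybrid {} z'))" by simp
    next
      fix z z' :: "nat \<times> bool \<Rightarrow> real" assume "\<And>i. i \<in> - ({..<N} \<times> {False}) \<Longrightarrow> z i = z' i"
      then have "hybrid {..<N} z = hybrid {..<N} z'" by (auto simp: hybrid_def)
      then show "G (hybrid {..<N} z) = G (hybrid {..<N} z')" by simp
    qed auto
    also have "(\<integral>z. F (seq_trunc N (hybrid {} z)) \<partial>RR) = (\<integral>\<omega>. F (seq_trunc N \<omega>) \<partial>S)"
      by (rule meas_pres_integral[OF meas_pres_hybrid sq_int_measurable[OF FN2]])
    also have "(\<integral>z. G (hybrid {..<N} z) \<partial>RR) = (\<integral>\<omega>. G \<omega> \<partial>S)"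
      by (rule meas_pres_integral[OF meas_pres_hybrid sq_int_measurable[OF G]])
    finally have 2: "(\<integral>z. F (seq_trunc N (hybrid {} z)) * G (hybrid {..<N} z) \<partial>RR) = (\<integral>\<omega>. F (seq_trunc N \<omega>) \<partial>S) * (\<integral>\<omega>. G \<omega> \<partial>S)" .
    have d2: "sq_int S (\<lambda>\<omega>. F \<omega> - F (seq_trunc N \<omega>))" using F2 FN2 by auto
    have "c {..<N} - (\<integral>z. F (seq_trunc N (hybrid {} z)) * G (hybrid {..<N} z) \<partial>RR)
        = (\<integral>z. (F (hybrid {} z) - F (seq_trunc N (hybrid {} z))) * G (hybrid {..<N} z) \<partial>RR)"
      unfolding c_def left_diff_distrib
      by (intro Bochner_Integration.integral_diff[symmetric] sq_int_times_integrable sq_int_hybrid F2 G meas_pres_sq_int[OF meas_pres_hybrid FN2])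
    also have "\<bar>\<dots>\<bar> \<le> l2norm RR (\<lambda>z. F (hybrid {} z) - F (seq_trunc N (hybrid {} z))) * l2norm RR (\<lambda>z. G (hybrid {..<N} z))"
      by (intro l2norm_Cauchy_Schwarz sq_int_hybrid G meas_pres_sq_int[OF meas_pres_hybrid d2])
    also have "\<dots> = e N * l2norm S G"
      unfolding e_def l2norm_hybrid[OF G] using meas_pres_l2norm[OF meas_pres_hybrid d2] by simp
    finally have 3: "\<bar>c {..<N} - (\<integral>\<omega>. F (seq_trunc N \<omega>) \<partial>S) * (\<integral>\<omega>. G \<omega> \<partial>S)\<bar> \<le> e N * l2norm S G"
      unfolding 2 .
    have "(\<integral>\<omega>. F \<omega> \<partial>S) - (\<integral>\<omega>. F (seq_trunc N \<omega>) \<partial>S) = (\<integral>\<omega>. F \<omega> - F (seq_trunc N \<omega>) \<partial>S)"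
      using PS.sq_int_integrable[OF F2] PS.sq_int_integrable[OF FN2] by simp
    then have "\<bar>(\<integral>\<omega>. F \<omega> \<partial>S) - (\<integral>\<omega>. F (seq_trunc N \<omega>) \<partial>S)\<bar> \<le> e N"
      using PS.abs_expectation_le_l2norm[OF d2] by (simp add: e_def)
    then have "\<bar>((\<integral>\<omega>. F \<omega> \<partial>S) - (\<integral>\<omega>. F (seq_trunc N \<omega>) \<partial>S)) * (\<integral>\<omega>. G \<omega> \<partial>S)\<bar> \<le> e N * l2norm S G"
      unfolding abs_mult by (intro mult_mono PS.abs_expectation_le_l2norm G) (auto simp: e_def)
    then have 4: "\<bar>(\<integral>\<omega>. F \<omega> \<partial>S) * (\<integral>\<omega>. G \<omega> \<partial>S) - (\<integral>\<omega>. F (seq_trunc N \<omega>) \<partial>S) * (\<integral>\<omega>. G \<omega> \<partial>S)\<bar> \<le> e N * l2norm S G"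
      by (simp add: left_diff_distrib)
    show ?thesis unfolding Cov_def c0[symmetric] using 1 3 4 by linarith
  qed
  have "(\<lambda>N. (\<Sum>k. influence k F * influence k G) / 2 + 2 * e N * l2norm S G) \<longlonglongrightarrow> (\<Sum>k. influence k F * influence k G) / 2 + 2 * 0 * l2norm S G"
    using lim unfolding e_def by (intro tendsto_intros)
  then have "\<bar>Cov S F G\<bar> \<le> (\<Sum>k. influence k F * influence k G) / 2 + 2 * 0 * l2norm S G"
    by (rule LIMSEQ_le_const) (use le in auto)
  then show ?thesis by simp
qed

end

section \<open>Variance of sums of shifted functionals\<close>

lemma sums_delayed:
  fixes a :: "nat \<Rightarrow> real"
  assumes "a sums t" shows "(\<lambda>k. if n \<le> k then a (k - n) else 0) sums t"
  using assms by (subst sums_zero_iff_shift[of n, symmetric]) auto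

text \<open>For fixed \<open>k\<close> the indices k - i are distinct, so at most the whole series
  is collected. This makes the influence of one coordinate on a sum of shifts bounded independently
  of the number of shifts.\<close>

lemma sum_delayed_le_suminf:
  fixes a :: "nat \<Rightarrow> real"
  assumes a: "summable a" and pos: "\<And>k. a k \<ge> 0"
  shows "(\<Sum>i<n. if i \<le> k then a (k - i) else 0) \<le> suminf a"
proof -
  have "(\<Sum>i<n. if i \<le> k then a (k - i) else 0) = (\<Sum>i\<in>{i. i < n \<and> i \<le> k}. a (k - i))"
    by (simp add: sum.If_cases lessThan_def Int_def)
  also have "\<dots> = (\<Sum>j\<in>(\<lambda>i. k - i) ` {i. i < n \<and> i \<le> k}. a j)"
    by (subst sum.reindex) (auto simp: inj_on_def)
  also have "\<dots> \<le> suminf a"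
    using pos by (intro sum_le_suminf[OF a]) auto
  finally show ?thesis .
qed

lemma Cesaro_null:
  fixes a :: "nat \<Rightarrow> real"
  assumes "a \<longlonglongrightarrow> 0"
  shows "(\<lambda>n. (\<Sum>i<n. a (Suc i)) / real n) \<longlonglongrightarrow> 0"
proof (rule LIMSEQ_I)
  fix e :: real assume e: "e > 0"
  obtain N where N: "\<And>n. n \<ge> N \<Longrightarrow> \<bar>a n\<bar> < e / 2"
    using LIMSEQ_D[OF assms, of "e / 2"] e by auto
  define C where "C = (\<Sum>i<N. \<bar>a (Suc i)\<bar>)"
  have C: "C \<ge> 0" by (simp add: C_def sum_nonneg)
  obtain M :: nat where M: "2 * C / e < real M" using reals_Archimedean2 by blast
  have "norm ((\<Sum>i<n. a (Suc i)) / real n - 0) < e" if n: "n \<ge> max (Suc M) (Suc N)" for n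
  proof -
    have "\<bar>\<Sum>i<n. a (Suc i)\<bar> \<le> (\<Sum>i<n. \<bar>a (Suc i)\<bar>)" by (rule sum_abs)
    also have "\<dots> = C + (\<Sum>i=N..<n. \<bar>a (Suc i)\<bar>)"
      unfolding C_def using n sum.atLeastLessThan_concat[of 0 N n "\<lambda>i. \<bar>a (Suc i)\<bar>"]
      by (simp add: lessThan_atLeast0)
    also have "(\<Sum>i=N..<n. \<bar>a (Suc i)\<bar>) \<le> (\<Sum>i=N..<n. e / 2)"
      using N by (intro sum_mono less_imp_le) auto
    also have "\<dots> \<le> n * (e / 2)" using e by (simp add: mult_right_mono)
    also have "C < n * (e / 2)"
    proof -
      have "2 * C / e < n" using M n by linarith
      then show ?thesis using e by (simp add: field_simps)
    qed
    finally show ?thesis using n by (simp add: field_simps)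
  qed
  then show "\<exists>no. \<forall>n\<ge>no. norm ((\<Sum>i<n. a (Suc i)) / real n - 0) < e" by blast
qed

section \<open>Characteristic functions\<close>

lemma norm_iexp_diff_le: "cmod (iexp a - iexp b) \<le> \<bar>a - b\<bar>"
proof -
  have "iexp a - iexp b = iexp b * (iexp (a - b) - 1)"
    by (simp add: right_diff_distrib flip: exp_add)
  then have "cmod (iexp a - iexp b) = cmod (iexp (a - b) - 1)"
    by (simp add: norm_mult)
  also have "\<dots> \<le> \<bar>a - b\<bar>" using iexp_approx1[of "a - b" 0] by simp
  finally show ?thesis .
qed

context prob_space
begin

lemma integrable_iexp [simp]: "f \<in> borel_measurable M \<Longrightarrow> integrable M (\<lambda>x. iexp (f x))"
  by (intro integrable_const_bound[of _ 1]) auto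

text \<open>Since \<open>iexp\<close> is 1-Lipschitz, approximation in L^2 passes to characteristic
  functions.\<close>

lemma norm_expectation_iexp_diff_le:
  assumes f: "sq_int M f" and g: "sq_int M g"
  shows "cmod ((CLINT x|M. iexp (f x)) - (CLINT x|M. iexp (g x))) \<le> l2norm M (\<lambda>x. f x - g x)"
proof -
  note [measurable] = f[THEN sq_int_measurable] g[THEN sq_int_measurable]
  have d: "sq_int M (\<lambda>x. f x - g x)" using f g by auto
  have "(CLINT x|M. iexp (f x)) - (CLINT x|M. iexp (g x)) = (CLINT x|M. iexp (f x) - iexp (g x))"
    by (intro Bochner_Integration.integral_diff[symmetric]) auto
  also have "cmod \<dots> \<le> (\<integral>x. cmod (iexp (f x) - iexp (g x)) \<partial>M)"
    by (rule integral_norm_bound)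
  also have "\<dots> \<le> (\<integral>x. \<bar>f x - g x\<bar> \<partial>M)"
    using sq_int_integrable[OF d]
    by (intro integral_mono norm_iexp_diff_le) auto
  also have "\<dots> \<le> l2norm M (\<lambda>x. f x - g x)" by (rule expectation_abs_le_l2norm[OF d])
  finally show ?thesis .
qed

lemma char_distr: "f \<in> borel_measurable M \<Longrightarrow> char (distr M borel f) t = (CLINT x|M. iexp (t * f x))"
  unfolding char_def by (subst integral_distr) auto

end

lemma real_distribution_gaussian0: "s \<ge> 0 \<Longrightarrow> real_distribution (gaussian0 s)"
  by (auto simp: gaussian0_def real_distribution_def real_distribution_axioms_def
      intro!: prob_space_return prob_space_normal_density)

lemma char_gaussian0:
  assumes "s \<ge> 0" shows "char (gaussian0 s) t = exp (- (t\<^sup>2 * s\<^sup>2) / 2)"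
proof (cases "s = 0")
  case True
  then show ?thesis by (simp add: gaussian0_def char_def integral_return)
next
  case False
  with assms have s: "s > 0" by simp
  interpret N: prob_space "density lborel (normal_density 0 s)" by (rule prob_space_normal_density[OF s])
  have "distributed (density lborel (normal_density 0 s)) lborel (\<lambda>x. x) (normal_density 0 s)"
    by (simp add: distributed_def distr_id2)
  then have d: "distributed (density lborel (normal_density 0 s)) lborel (\<lambda>x. (x - 0) / s) std_normal_density"
    using N.normal_standard_normal_convert[OF s, of "\<lambda>x. x" 0] by simp
  have "char (gaussian0 s) t = (CLINT x|density lborel (normal_density 0 s). iexp ((t * s) * ((x - 0) / s)))"
    using s by (simp add: gaussian0_def char_def)
  also have "\<dots> = (CLINT y|distr (density lborel (normal_density 0 s)) lborel (\<lambda>x. (x - 0) / s). iexp ((t * s) * y))"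
    by (subst integral_distr) auto
  also have "distr (density lborel (normal_density 0 s)) lborel (\<lambda>x. (x - 0) / s) = std_normal_distribution"
    using d unfolding distributed_def by simp
  finally show ?thesis
    using fun_cong[OF char_std_normal_distribution, of "t * s"] by (simp add: char_def power_mult_distrib)
qed

context iid_real
begin

section \<open>Closure properties of approximable functionals\<close>

lemma approximable_sq_int: "approximable F \<Longrightarrow> sq_int S F"
  by (simp add: approximable_def)

lemma approximable_trunc_sq_int: "approximable F \<Longrightarrow> sq_int S (\<lambda>\<omega>. F (seq_trunc N \<omega>))"
  by (simp add: approximable_def)

lemma shift_trunc: "seq_shift n (seq_trunc N \<omega>) = seq_trunc (N - n) (seq_shift n \<omega>)"
  by (auto simp: seq_shift_def seq_trunc_def less_diff_conv)

lemma trunc_trunc: "seq_trunc n (seq_trunc N \<omega>) = seq_trunc (min n N) \<omega>"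
  by (auto simp: seq_trunc_def)

lemma shift_shift: "seq_shift n (seq_shift m \<omega>) = seq_shift (n + m) \<omega>"
  by (simp add: seq_shift_def add.assoc)

lemma approximable_shift:
  assumes F: "approximable F" shows "approximable (\<lambda>\<omega>. F (seq_shift n \<omega>))"
  unfolding approximable_def shift_trunc
proof (intro conjI allI)
  show "sq_int S (\<lambda>\<omega>. F (seq_shift n \<omega>))" using F by (auto simp: approximable_def)
  show "sq_int S (\<lambda>\<omega>. F (seq_trunc (N - n) (seq_shift n \<omega>)))" for N
    by (rule sq_int_shift[OF approximable_trunc_sq_int[OF F]])
  have "(\<lambda>N. l2norm S (\<lambda>\<omega>. F \<omega> - F (seq_trunc (N - n) \<omega>))) \<longlonglongrightarrow> 0"
    using F unfolding approximable_def
    by (intro filterlim_compose[OF _ filterlim_minus_const_nat_at_top]) auto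
  moreover have "l2norm S (\<lambda>\<omega>. F (seq_shift n \<omega>) - F (seq_trunc (N - n) (seq_shift n \<omega>))) = l2norm S (\<lambda>\<omega>. F \<omega> - F (seq_trunc (N - n) \<omega>))" for N
    using F by (intro meas_pres_l2norm[OF meas_pres_shift] sq_int_diff) (auto simp: approximable_def)
  ultimately show "(\<lambda>N. l2norm S (\<lambda>\<omega>. F (seq_shift n \<omega>) - F (seq_trunc (N - n) (seq_shift n \<omega>)))) \<longlonglongrightarrow> 0" by simp
qed

lemma approximable_trunc:
  assumes F: "approximable F" shows "approximable (\<lambda>\<omega>. F (seq_trunc r \<omega>))"
  unfolding approximable_def trunc_trunc
proof (intro conjI allI approximable_trunc_sq_int[OF F])
  show "(\<lambda>N. l2norm S (\<lambda>\<omega>. F (seq_trunc r \<omega>) - F (seq_trunc (min r N) \<omega>))) \<longlonglongrightarrow> 0"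
    by (rule tendsto_eventually, rule eventually_sequentiallyI[of r]) (simp add: min_absorb1)
qed

lemma approximable_sum:
  assumes F: "\<And>i. i \<in> I \<Longrightarrow> approximable (F i)" shows "approximable (\<lambda>\<omega>. \<Sum>i\<in>I. F i \<omega>)"
  unfolding approximable_def
proof (intro conjI allI)
  show "sq_int S (\<lambda>\<omega>. \<Sum>i\<in>I. F i \<omega>)" "sq_int S (\<lambda>\<omega>. \<Sum>i\<in>I. F i (seq_trunc N \<omega>))" for N
    using F by (auto simp: approximable_def)
  have lim: "(\<lambda>N. \<Sum>i\<in>I. l2norm S (\<lambda>\<omega>. F i \<omega> - F i (seq_trunc N \<omega>))) \<longlonglongrightarrow> 0"
    using F by (intro tendsto_null_sum) (auto simp: approximable_def)
  show "(\<lambda>N. l2norm S (\<lambda>\<omega>. (\<Sum>i\<in>I. F i \<omega>) - (\<Sum>i\<in>I. F i (seq_trunc N \<omega>)))) \<longlonglongrightarrow> 0"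
  proof (rule tendsto_sandwich[OF _ _ tendsto_const lim])
    show "\<forall>\<^sub>F N in sequentially. l2norm S (\<lambda>\<omega>. (\<Sum>i\<in>I. F i \<omega>) - (\<Sum>i\<in>I. F i (seq_trunc N \<omega>)))
        \<le> (\<Sum>i\<in>I. l2norm S (\<lambda>\<omega>. F i \<omega> - F i (seq_trunc N \<omega>)))"
      unfolding sum_subtractf[symmetric]
      using F by (intro always_eventually allI l2norm_sum_le sq_int_diff) (auto simp: approximable_def)
  qed simp
qed

lemma approximable_diff:
  assumes F: "approximable F" and G: "approximable G" shows "approximable (\<lambda>\<omega>. F \<omega> - G \<omega>)"
  unfolding approximable_def
proof (intro conjI allI)
  show "sq_int S (\<lambda>\<omega>. F \<omega> - G \<omega>)" "sq_int S (\<lambda>\<omega>. F (seq_trunc N \<omega>) - G (seq_trunc N \<omega>))" for N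
    using F G by (auto simp: approximable_def)
  have lim: "(\<lambda>N. l2norm S (\<lambda>\<omega>. F \<omega> - F (seq_trunc N \<omega>)) + l2norm S (\<lambda>\<omega>. G \<omega> - G (seq_trunc N \<omega>))) \<longlonglongrightarrow> 0"
    using F G by (intro tendsto_add_zero) (auto simp: approximable_def)
  show "(\<lambda>N. l2norm S (\<lambda>\<omega>. F \<omega> - G \<omega> - (F (seq_trunc N \<omega>) - G (seq_trunc N \<omega>)))) \<longlonglongrightarrow> 0"
  proof (rule tendsto_sandwich[OF _ _ tendsto_const lim])
    have "l2norm S (\<lambda>\<omega>. F \<omega> - G \<omega> - (F (seq_trunc N \<omega>) - G (seq_trunc N \<omega>)))
        \<le> l2norm S (\<lambda>\<omega>. F \<omega> - F (seq_trunc N \<omega>)) + l2norm S (\<lambda>\<omega>. G \<omega> - G (seq_trunc N \<omega>))" for N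
      using l2norm_diff_le[of S "\<lambda>\<omega>. F \<omega> - F (seq_trunc N \<omega>)" "\<lambda>\<omega>. G \<omega> - G (seq_trunc N \<omega>)"] F G
      by (simp add: approximable_def sq_int_diff algebra_simps)
    then show "\<forall>\<^sub>F N in sequentially. l2norm S (\<lambda>\<omega>. F \<omega> - G \<omega> - (F (seq_trunc N \<omega>) - G (seq_trunc N \<omega>)))
        \<le> l2norm S (\<lambda>\<omega>. F \<omega> - F (seq_trunc N \<omega>)) + l2norm S (\<lambda>\<omega>. G \<omega> - G (seq_trunc N \<omega>))" by simp
  qed simp
qed

lemma expectation_shift_sum:
  assumes "\<And>i. i < n \<Longrightarrow> sq_int S (G i)"
  shows "(\<integral>\<omega>. (\<Sum>i<n. G i (seq_shift (t i) \<omega>)) \<partial>S) = (\<Sum>i<n. \<integral>\<omega>. G i \<omega> \<partial>S)"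
proof -
  have "(\<integral>\<omega>. (\<Sum>i<n. G i (seq_shift (t i) \<omega>)) \<partial>S) = (\<Sum>i<n. \<integral>\<omega>. G i (seq_shift (t i) \<omega>) \<partial>S)"
    using assms by (intro Bochner_Integration.integral_sum PS.sq_int_integrable sq_int_shift) auto
  also have "\<dots> = (\<Sum>i<n. \<integral>\<omega>. G i \<omega> \<partial>S)"
    using assms by (intro sum.cong refl meas_pres_integral[OF meas_pres_shift] sq_int_measurable) auto
  finally show ?thesis .
qed

text \<open>The sum of squared influences of \<open>Q\<close> is at most their supremum times their
  sum. The supremum is controlled by the common majorant \<open>a\<close>, while the sum keeps the
  actual influences of the \<open>G i\<close>. The variance is therefore small whenever these total
  influences are small, even if \<open>a\<close> is not. The functional may vary with
  \<open>i\<close> so that truncation levels can depend on the position in a block.\<close>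

lemma variance_shift_sum_le:
  fixes G :: "nat \<Rightarrow> (nat \<Rightarrow> real) \<Rightarrow> real"
  assumes G: "\<And>i. i < n \<Longrightarrow> approximable (G i)"
    and b: "\<And>i j. i < n \<Longrightarrow> influence j (G i) \<le> a j" and a: "summable a"
  defines "Q \<equiv> \<lambda>\<omega>. \<Sum>i<n. G i (seq_shift i \<omega>)"
  shows "approximable Q"
    and "(l2norm S (\<lambda>\<omega>. Q \<omega> - (\<integral>\<omega>. Q \<omega> \<partial>S)))\<^sup>2 \<le> suminf a * (\<Sum>i<n. \<Sum>j. influence j (G i)) / 2"
proof -
  show Q: "approximable Q"
    unfolding Q_def by (intro approximable_sum approximable_shift G) auto
  have sm: "summable (\<lambda>j. influence j (G i))" if "i < n" for i
    using b[OF that] by (intro summable_comparison_test'[OF a]) auto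
  define c where "c i k = (if i \<le> k then influence (k - i) (G i) else 0)" for i k
  have c: "(c i) sums (\<Sum>j. influence j (G i))" if "i < n" for i
    unfolding c_def using sums_delayed[OF summable_sums[OF sm[OF that]]] .
  have c0: "c i k \<ge> 0" for i k by (simp add: c_def)
  have dQ: "influence k Q \<le> (\<Sum>i<n. c i k)" for k
  proof -
    have "influence k Q \<le> (\<Sum>i<n. influence k (\<lambda>\<omega>. G i (seq_shift i \<omega>)))"
      unfolding Q_def using G by (intro influence_sum_le sq_int_shift approximable_sq_int) auto
    also have "\<dots> = (\<Sum>i<n. c i k)"
      unfolding c_def using G by (intro sum.cong refl influence_shift approximable_sq_int) auto
    finally show ?thesis .
  qed
  show "(l2norm S (\<lambda>\<omega>. Q \<omega> - (\<integral>\<omega>. Q \<omega> \<partial>S)))\<^sup>2 \<le> suminf a * (\<Sum>i<n. \<Sum>j. influence j (G i)) / 2"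
  proof (cases "n = 0")
    case True
    then show ?thesis by (simp add: Q_def)
  next
    case False
    then have a0: "a j \<ge> 0" for j using b[of 0 j] influence_nonneg order_trans by blast
    have cs: "(\<lambda>k. \<Sum>i<n. c i k) sums (\<Sum>i<n. \<Sum>j. influence j (G i))"
      using c by (intro sums_sum) auto
    have le: "influence k Q \<le> suminf a" for k
    proof -
      have "(\<Sum>i<n. c i k) \<le> (\<Sum>i<n. if i \<le> k then a (k - i) else 0)"
        unfolding c_def using b by (intro sum_mono) auto
      also have "\<dots> \<le> suminf a" by (rule sum_delayed_le_suminf[OF a a0])
      finally show ?thesis using dQ[of k] by linarith
    qed
    \<comment> \<open>One factor is estimated by the supremum bound and the other is kept for
      summation over \<open>k\<close>.\<close>
    have prod: "influence k Q * influence k Q \<le> suminf a * (\<Sum>i<n. c i k)" for k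
      using le dQ by (intro mult_mono) (auto simp: suminf_nonneg[OF a a0])
    have smQ: "summable (\<lambda>k. influence k Q * influence k Q)"
      using prod by (intro summable_comparison_test'[OF sums_summable[OF sums_mult[OF cs]]]) auto
    have "(l2norm S (\<lambda>\<omega>. Q \<omega> - (\<integral>\<omega>. Q \<omega> \<partial>S)))\<^sup>2 = Cov S Q Q"
      by (rule PS.Cov_self[OF approximable_sq_int[OF Q], symmetric])
    also have "\<dots> \<le> (\<Sum>k. influence k Q * influence k Q) / 2"
      using Efron_Stein[OF Q approximable_sq_int[OF Q] smQ] by linarith
    also have "\<dots> \<le> (\<Sum>k. suminf a * (\<Sum>i<n. c i k)) / 2"
      using suminf_le[OF prod smQ sums_summable[OF sums_mult[OF cs]]] by simp
    also have "(\<Sum>k. suminf a * (\<Sum>i<n. c i k)) = suminf a * (\<Sum>i<n. \<Sum>j. influence j (G i))"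
      using sums_unique[OF sums_mult[OF cs]] by simp
    finally show ?thesis .
  qed
qed

end

section \<open>Central limit theorem\<close>

text \<open>Independent blocks are made from truncations of \<open>F\<close>, so the majorant
  \<open>D\<close> has to control every truncation as well as \<open>F\<close>; it also serves as
  the dominating series when the truncation level grows.\<close>

locale summable_influence = iid_real +
  fixes F :: "(nat \<Rightarrow> real) \<Rightarrow> real" and D :: "nat \<Rightarrow> real"
  assumes F: "approximable F" and F_mean: "(\<integral>\<omega>. F \<omega> \<partial>S) = 0"
    and influence_F: "\<And>k. influence k F \<le> D k" and influence_trunc_F: "\<And>k r. influence k (\<lambda>\<omega>. F (seq_trunc r \<omega>)) \<le> D k"
    and D: "summable D"
begin

definition psum :: "nat \<Rightarrow> (nat \<Rightarrow> real) \<Rightarrow> real" where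
  "psum n \<omega> = (\<Sum>i<n. F (seq_shift i \<omega>))"

text \<open>Truncation before summation confines a block to its own \<open>L\<close> coordinates,
  which makes consecutive blocks independent. It can move the mean away from 0, hence the
  centring.\<close>

definition block :: "nat \<Rightarrow> (nat \<Rightarrow> real) \<Rightarrow> real" where
  "block L \<omega> = psum L (seq_trunc L \<omega>) - (\<integral>\<omega>. psum L (seq_trunc L \<omega>) \<partial>S)"

definition bsum :: "nat \<Rightarrow> nat \<Rightarrow> (nat \<Rightarrow> real) \<Rightarrow> real" where
  "bsum L N \<omega> = (\<Sum>b<N. block L (seq_shift (b * L) \<omega>))"

definition bvar :: "nat \<Rightarrow> real" where
  "bvar L = (l2norm S (block L))\<^sup>2"

definition tail_influence :: "nat \<Rightarrow> real" where
  "tail_influence r = (\<Sum>j. influence j (\<lambda>\<omega>. F \<omega> - F (seq_trunc r \<omega>)))"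

lemma D_nonneg: "D k \<ge> 0"
  using influence_F[of k] influence_nonneg[of k F] by linarith

lemma suminf_D_nonneg: "suminf D \<ge> 0"
  using D D_nonneg by (rule suminf_nonneg)

lemma influence_tail: "influence j (\<lambda>\<omega>. F \<omega> - F (seq_trunc r \<omega>)) \<le> 2 * D j"
  using influence_diff_le[OF approximable_sq_int[OF F] approximable_trunc_sq_int[OF F], of j r] influence_F[of j] influence_trunc_F[of j r]
  by linarith

text \<open>Dominated convergence for series: each influence is at most twice the L^2 truncation
  error, which tends to 0, and 2 D dominates all of them.\<close>

lemma tail_influence_tendsto_0: "tail_influence \<longlonglongrightarrow> 0"
proof -
  have "((\<lambda>r. \<Sum>j. influence j (\<lambda>\<omega>. F \<omega> - F (seq_trunc r \<omega>))) \<longlongrightarrow> (\<Sum>j. 0::real)) sequentially"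
  proof (rule tannerys_theorem[THEN conjunct2, THEN conjunct2])
    fix j
    have lim: "(\<lambda>r. 2 * l2norm S (\<lambda>\<omega>. F \<omega> - F (seq_trunc r \<omega>))) \<longlonglongrightarrow> 0"
      using F by (auto simp: approximable_def intro!: tendsto_mult_right_zero)
    show "(\<lambda>r. influence j (\<lambda>\<omega>. F \<omega> - F (seq_trunc r \<omega>))) \<longlonglongrightarrow> 0"
      by (rule tendsto_sandwich[OF _ _ tendsto_const lim])
         (auto intro!: always_eventually influence_le_l2norm sq_int_diff approximable_sq_int[OF F] approximable_trunc_sq_int[OF F])
    show "\<forall>\<^sub>F (k, n) in sequentially \<times>\<^sub>F sequentially. norm (influence k (\<lambda>\<omega>. F \<omega> - F (seq_trunc n \<omega>))) \<le> 2 * D k"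
      using influence_tail by (intro always_eventually) auto
    show "summable (\<lambda>k. 2 * D k)" using D by (rule summable_mult)
  qed simp
  then show ?thesis by (simp add: tail_influence_def[abs_def])
qed

lemma psum_approximable: "approximable (psum n)"
  unfolding psum_def[abs_def] by (intro approximable_sum approximable_shift F)

lemma psum_sq_int: "sq_int S (psum n)"
  by (rule approximable_sq_int[OF psum_approximable])

lemma psum_mean: "(\<integral>\<omega>. psum n \<omega> \<partial>S) = 0"
  unfolding psum_def using expectation_shift_sum[of n "\<lambda>_. F" "\<lambda>i. i"] approximable_sq_int[OF F] F_mean by simp

lemma block_approximable: "approximable (\<lambda>\<omega>. psum L (seq_trunc L \<omega>))"
  by (rule approximable_trunc[OF psum_approximable])

lemma block_sq_int: "sq_int S (block L)"
  unfolding block_def[abs_def] using approximable_sq_int[OF block_approximable] by auto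

lemma block_mean: "(\<integral>\<omega>. block L \<omega> \<partial>S) = 0"
  unfolding block_def using PS.sq_int_integrable[OF approximable_sq_int[OF block_approximable]] by simp

lemma bsum_sq_int: "sq_int S (bsum L N)"
  unfolding bsum_def[abs_def] by (intro sq_int_sum sq_int_shift block_sq_int)

lemma l2norm_psum_le: "l2norm S (psum n) \<le> suminf D * sqrt (real n)"
proof -
  have "(l2norm S (psum n))\<^sup>2 \<le> suminf D * (\<Sum>i<n. \<Sum>j. influence j F) / 2"
    using variance_shift_sum_le(2)[of n "\<lambda>_. F" D] F influence_F D
    unfolding psum_def[symmetric] psum_mean by simp
  also have "(\<Sum>i<n. \<Sum>j. influence j F) \<le> (\<Sum>i<n. suminf D)"
    by (intro sum_mono suminf_le influence_F D summable_comparison_test'[OF D, of 0]) (use influence_F in auto)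
  finally have "(l2norm S (psum n))\<^sup>2 \<le> suminf D * (n * suminf D) / 2"
    using suminf_D_nonneg by (simp add: mult_left_mono divide_right_mono)
  also have "\<dots> \<le> (suminf D * sqrt (real n))\<^sup>2"
    using suminf_D_nonneg by (simp add: power_mult_distrib power2_eq_square mult.assoc mult.left_commute)
  finally show ?thesis by (rule power2_le_imp_le) (simp add: suminf_D_nonneg)
qed

text \<open>The summand at position \<open>s\<close> still sees L - s coordinates. Only summands
  near the end of a block are truncated severely, so the error per summand is a Cesaro mean.\<close>

lemma psum_trunc: "psum L (seq_trunc L \<omega>) = (\<Sum>s<L. F (seq_trunc (L - s) (seq_shift s \<omega>)))"
  by (simp add: psum_def shift_trunc)

text \<open>For compactness: \<open>bvar L / L\<close> stays bounded and therefore has cluster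
  points.\<close>

lemma bvar_le: "bvar L \<le> (suminf D)\<^sup>2 * L"
proof -
  have "bvar L \<le> suminf D * (\<Sum>s<L. \<Sum>j. influence j (\<lambda>\<omega>. F (seq_trunc (L - s) \<omega>))) / 2"
    using variance_shift_sum_le(2)[of L "\<lambda>s \<omega>. F (seq_trunc (L - s) \<omega>)" D] approximable_trunc[OF F] influence_trunc_F D
    unfolding psum_trunc[symmetric] bvar_def block_def by simp
  also have "(\<Sum>s<L. \<Sum>j. influence j (\<lambda>\<omega>. F (seq_trunc (L - s) \<omega>))) \<le> (\<Sum>s<L. suminf D)"
    by (intro sum_mono suminf_le influence_trunc_F D summable_comparison_test'[OF D, of 0]) (use influence_trunc_F in auto)
  finally have "bvar L \<le> suminf D * (L * suminf D) / 2"
    using suminf_D_nonneg by (simp add: mult_left_mono divide_right_mono)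
  also have "\<dots> \<le> (suminf D)\<^sup>2 * L"
    using suminf_D_nonneg by (simp add: power2_eq_square mult.assoc mult.left_commute)
  finally show ?thesis .
qed

lemma sum_blocks:
  fixes f :: "nat \<Rightarrow> 'c::comm_monoid_add"
  shows "(\<Sum>i<N * L. f i) = (\<Sum>b<N. \<Sum>s<L. f (s + b * L))"
proof -
  have "(\<Sum>i<N * L. f i) = (\<Sum>b<N. sum f {b * L..<b * L + L})" by (rule sum.nat_group[symmetric])
  also have "(\<Sum>b<N. sum f {b * L..<b * L + L}) = (\<Sum>b<N. \<Sum>s<L. f (s + b * L))"
  proof (rule sum.cong[OF refl])
    fix b show "sum f {b * L..<b * L + L} = (\<Sum>s<L. f (s + b * L))"
      using sum.shift_bounds_nat_ivl[of f 0 "b * L" L] by (simp add: lessThan_atLeast0 add.commute)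
  qed
  finally show ?thesis .
qed

text \<open>The difference is a sum of shifted truncation errors of \<open>F\<close>. The supremum
  factor of \<open>variance_shift_sum_le\<close> is at most 2 times the sum of \<open>D\<close>, and
  within each block the truncation levels run through 1, ..., L, which gives the sum of the
  \<open>tail_influence (Suc s)\<close>.\<close>

lemma l2norm_psum_bsum:
  "(l2norm S (\<lambda>\<omega>. psum (N * L) \<omega> - bsum L N \<omega>))\<^sup>2 \<le> suminf D * (N * (\<Sum>s<L. tail_influence (Suc s)))"
proof -
  \<comment> \<open>\<open>i mod L\<close> is the position inside the block, so L - i mod L
    coordinates remain before the block ends.\<close>
  define G where "G i \<omega> = F \<omega> - F (seq_trunc (L - i mod L) \<omega>)" for i \<omega>
  define Q where "Q \<omega> = (\<Sum>i<N * L. G i (seq_shift i \<omega>))" for \<omega>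
  have G: "approximable (G i)" for i
    unfolding G_def[abs_def] by (intro approximable_diff approximable_trunc F)
  have Q: "Q \<omega> = psum (N * L) \<omega> - (\<Sum>b<N. psum L (seq_trunc L (seq_shift (b * L) \<omega>)))" for \<omega>
  proof -
    have "Q \<omega> = psum (N * L) \<omega> - (\<Sum>i<N * L. F (seq_trunc (L - i mod L) (seq_shift i \<omega>)))"
      by (simp add: Q_def G_def psum_def sum_subtractf)
    also have "(\<Sum>i<N * L. F (seq_trunc (L - i mod L) (seq_shift i \<omega>))) = (\<Sum>b<N. psum L (seq_trunc L (seq_shift (b * L) \<omega>)))"
      unfolding sum_blocks psum_trunc shift_shift by (intro sum.cong refl) auto
    finally show ?thesis .
  qed
  have "(\<integral>\<omega>. Q \<omega> \<partial>S) = - (\<Sum>b<N. \<integral>\<omega>. psum L (seq_trunc L \<omega>) \<partial>S)"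
  proof -
    have A: "sq_int S (\<lambda>\<omega>. psum L (seq_trunc L \<omega>))" by (rule approximable_sq_int[OF block_approximable])
    have "(\<integral>\<omega>. Q \<omega> \<partial>S) = (\<integral>\<omega>. psum (N * L) \<omega> \<partial>S) - (\<integral>\<omega>. (\<Sum>b<N. psum L (seq_trunc L (seq_shift (b * L) \<omega>))) \<partial>S)"
      unfolding Q using A
      by (intro Bochner_Integration.integral_diff PS.sq_int_integrable psum_sq_int sq_int_sum)
         (rule sq_int_shift[where F = "\<lambda>\<omega>. psum L (seq_trunc L \<omega>)"])
    then show ?thesis
      using expectation_shift_sum[of N "\<lambda>_ \<omega>. psum L (seq_trunc L \<omega>)" "\<lambda>b. b * L"] A psum_mean by simp
  qed
  \<comment> \<open>\<open>psum\<close> has mean 0, so centring \<open>Q\<close> amounts to centring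
    the truncated blocks.\<close>
  then have e: "Q \<omega> - (\<integral>\<omega>. Q \<omega> \<partial>S) = psum (N * L) \<omega> - bsum L N \<omega>" for \<omega>
    unfolding Q bsum_def block_def by (simp add: sum_subtractf)
  have "(l2norm S (\<lambda>\<omega>. psum (N * L) \<omega> - bsum L N \<omega>))\<^sup>2
      \<le> (\<Sum>j. 2 * D j) * (\<Sum>i<N * L. \<Sum>j. influence j (G i)) / 2"
    using variance_shift_sum_le(2)[of "N * L" G "\<lambda>j. 2 * D j"] G influence_tail summable_mult[OF D, of 2]
    unfolding Q_def[symmetric] e by (simp add: G_def[abs_def])
  also have "(\<Sum>j. 2 * D j) = 2 * suminf D" by (rule suminf_mult[OF D])
  also have "(\<Sum>i<N * L. \<Sum>j. influence j (G i)) = (\<Sum>i<N * L. tail_influence (L - i mod L))"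
    by (simp add: tail_influence_def G_def[abs_def])
  also have "\<dots> = N * (\<Sum>s<L. tail_influence (L - s))"
    unfolding sum_blocks by simp
  also have "(\<Sum>s<L. tail_influence (L - s)) = (\<Sum>s<L. tail_influence (Suc s))"
    by (rule sum.reindex_bij_witness[of _ "\<lambda>s. L - Suc s" "\<lambda>s. L - Suc s"]) (auto simp: Suc_diff_Suc)
  finally show ?thesis by simp
qed

lemma l2norm_psum_diff:
  assumes "m \<le> n" shows "l2norm S (\<lambda>\<omega>. psum n \<omega> - psum m \<omega>) \<le> real (n - m) * l2norm S F"
proof -
  have "psum n \<omega> - psum m \<omega> = (\<Sum>i=m..<n. F (seq_shift i \<omega>))" for \<omega>
    using assms sum.atLeastLessThan_concat[of 0 m n "\<lambda>i. F (seq_shift i \<omega>)"]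
    by (simp add: psum_def lessThan_atLeast0)
  then have "l2norm S (\<lambda>\<omega>. psum n \<omega> - psum m \<omega>) \<le> (\<Sum>i=m..<n. l2norm S (\<lambda>\<omega>. F (seq_shift i \<omega>)))"
    using l2norm_sum_le[of "{m..<n}" S "\<lambda>i \<omega>. F (seq_shift i \<omega>)"] approximable_sq_int[OF F] by auto
  also have "\<dots> = real (n - m) * l2norm S F" using l2norm_shift[OF approximable_sq_int[OF F]] by simp
  finally show ?thesis .
qed

lemma block_distr: "distr S borel (\<lambda>\<omega>. block L (seq_shift n \<omega>)) = distr S borel (block L)"
proof -
  have "distr S borel (\<lambda>\<omega>. block L (seq_shift n \<omega>)) = distr (distr S S (seq_shift n)) borel (block L)"
    using sq_int_measurable[OF block_sq_int, of L] by (subst distr_distr) (auto simp: comp_def)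
  then show ?thesis using meas_pres_shift[of n] by (simp add: meas_pres_def)
qed

lemma block_indep: "PS.indep_vars (\<lambda>_. borel) (\<lambda>b \<omega>. block L (seq_shift (b * L) \<omega>)) UNIV"
proof (rule indep_vars_blocks[where A = "\<lambda>b. {b * L..<b * L + L}"])
  show "(\<lambda>\<omega>. block L (seq_shift (b * L) \<omega>)) \<in> borel_measurable S" for b
    by (rule sq_int_measurable[OF sq_int_shift[OF block_sq_int]])
next
  fix b \<omega> \<omega>' assume "\<And>i. i \<in> {b * L..<b * L + L} \<Longrightarrow> \<omega> i = (\<omega>' i :: real)"
  then have "seq_trunc L (seq_shift (b * L) \<omega>) = seq_trunc L (seq_shift (b * L) \<omega>')"
    by (intro ext) (simp add: seq_trunc_def seq_shift_def)
  then show "block L (seq_shift (b * L) \<omega>) = block L (seq_shift (b * L) \<omega>')" by (simp add: block_def)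
next
  have "i = j" if "x \<in> {i * L..<i * L + L}" "x \<in> {j * L..<j * L + L}" for x i j :: nat
  proof -
    have "x div L = i" if "x \<in> {i * L..<i * L + L}" for i
      using that by (intro div_nat_eqI) (auto simp: algebra_simps)
    then show ?thesis using that by blast
  qed
  then show "disjoint_family (\<lambda>b. {b * L..<b * L + L})" unfolding disjoint_family_on_def by blast
qed

text \<open>The normalisation counts the N L original summands instead of the N blocks, so the
  limiting variance is the block variance per summand.\<close>

lemma block_char:
  assumes L: "L > 0"
  shows "(\<lambda>N. CLINT \<omega>|S. iexp (t * (bsum L N \<omega> / sqrt (N * L)))) \<longlonglongrightarrow> exp (- (t\<^sup>2 * (bvar L / L)) / 2)"
proof (cases "bvar L = 0")
  \<comment> \<open>With zero variance the classical theorem does not apply; the blocks vanish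
    almost everywhere and both sides equal 1.\<close>
  case True
  have "(CLINT \<omega>|S. iexp (t * (bsum L N \<omega> / sqrt (N * L)))) = 1" for N
  proof -
    have "AE \<omega> in S. (block L \<omega>)\<^sup>2 = 0"
      using True integral_nonneg_eq_0_iff_AE[of S "\<lambda>\<omega>. (block L \<omega>)\<^sup>2"] block_sq_int[of L]
      by (auto simp: bvar_def l2norm_power2 sq_int_def)
    then have "AE \<omega> in S. (block L (seq_shift (b * L) \<omega>))\<^sup>2 = 0" for b by (rule meas_pres_AE[OF meas_pres_shift])
    then have "AE \<omega> in S. \<forall>b. (block L (seq_shift (b * L) \<omega>))\<^sup>2 = 0" by (simp add: AE_all_countable)
    then have "AE \<omega> in S. iexp (t * (bsum L N \<omega> / sqrt (N * L))) = 1"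
      by eventually_elim (simp add: bsum_def)
    then have "(CLINT \<omega>|S. iexp (t * (bsum L N \<omega> / sqrt (N * L)))) = (CLINT \<omega>|S. 1)"
      using sq_int_measurable[OF bsum_sq_int, of L N] by (intro integral_cong_AE) auto
    then show ?thesis by simp
  qed
  then show ?thesis using True by simp
next
  case False
  define \<sigma> where "\<sigma> = l2norm S (block L)"
  have \<sigma>: "\<sigma> > 0" "\<sigma>\<^sup>2 = bvar L" using False l2norm_nonneg[of S "block L"] by (auto simp: bvar_def \<sigma>_def less_le)
  have wc: "weak_conv_m (\<lambda>N. distr S borel (\<lambda>\<omega>. (\<Sum>b<N. block L (seq_shift (b * L) \<omega>)) / sqrt (N * \<sigma>\<^sup>2))) std_normal_distribution"
  proof (rule PS.central_limit_theorem_zero_mean[OF block_indep _ \<sigma>(1)])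
    fix b
    have m0: "(\<integral>\<omega>. block L (seq_shift (b * L) \<omega>) \<partial>S) = 0"
      using meas_pres_integral[OF meas_pres_shift sq_int_measurable[OF block_sq_int]] block_mean by simp
    then show "(\<integral>\<omega>. block L (seq_shift (b * L) \<omega>) \<partial>S) = 0" .
    show "integrable S (\<lambda>\<omega>. (block L (seq_shift (b * L) \<omega>))\<^sup>2)"
      using sq_int_shift[OF block_sq_int] by (simp add: sq_int_def)
    show "PS.variance (\<lambda>\<omega>. block L (seq_shift (b * L) \<omega>)) = \<sigma>\<^sup>2"
      using l2norm_shift[OF block_sq_int, of L "b * L"] unfolding m0 \<sigma>_def by (simp flip: l2norm_power2)
    show "distr S borel (\<lambda>\<omega>. block L (seq_shift (b * L) \<omega>)) = distr S borel (block L)" by (rule block_distr)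
  qed
  \<comment> \<open>\<open>u\<close> converts the normalisation by sqrt(N \<sigma>^2) into the one
    by sqrt(N L).\<close>
  define u where "u = t * \<sigma> / sqrt L"
  have [measurable]: "bsum L N \<in> borel_measurable S" for N by (rule sq_int_measurable[OF bsum_sq_int])
  have "(\<lambda>N. char (distr S borel (\<lambda>\<omega>. bsum L N \<omega> / sqrt (N * \<sigma>\<^sup>2))) u) \<longlonglongrightarrow> char std_normal_distribution u"
    using wc unfolding bsum_def[symmetric]
    by (intro levy_continuity1) (auto intro!: PS.real_distribution_distr real_dist_normal_dist)
  moreover have "char (distr S borel (\<lambda>\<omega>. bsum L N \<omega> / sqrt (N * \<sigma>\<^sup>2))) u = (CLINT \<omega>|S. iexp (t * (bsum L N \<omega> / sqrt (N * L))))" for N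
  proof -
    have "u * (x / sqrt (N * \<sigma>\<^sup>2)) = t * (x / sqrt (N * L))" for x
      using \<sigma>(1) by (simp add: u_def real_sqrt_mult)
    then show ?thesis by (subst PS.char_distr) auto
  qed
  moreover have "u\<^sup>2 = t\<^sup>2 * (bvar L / L)"
    using \<sigma> L by (simp add: u_def power_divide power_mult_distrib)
  ultimately show ?thesis by (simp add: char_std_normal_distribution)
qed

text \<open>The three terms come from the fewer than \<open>L\<close> summands left over after the
  last full block, from replacing full blocks by independent ones, and from normalising by sqrt(N L)
  instead of sqrt(n). Only the middle one persists as n grows with \<open>L\<close> fixed.\<close>

lemma l2norm_psum_bsum_scaled:
  assumes L: "L > 0" and n: "n > 0"
  defines "N \<equiv> n div L" and "e \<equiv> sqrt (suminf D * ((\<Sum>s<L. tail_influence (Suc s)) / L))"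
  shows "l2norm S (\<lambda>\<omega>. psum n \<omega> / sqrt n - bsum L N \<omega> / sqrt (N * L))
    \<le> L * l2norm S F / sqrt n + e + (suminf D + e) * \<bar>sqrt (N * L / n) - 1\<bar>"
proof -
  have NL: "N * L \<le> n" by (simp add: N_def)
  have tail0: "tail_influence r \<ge> 0" for r
    unfolding tail_influence_def using influence_tail
    by (intro suminf_nonneg summable_comparison_test'[OF summable_mult[OF D, of 2], of 0]) auto
  have T: "(\<Sum>s<L. tail_influence (Suc s)) \<ge> 0" by (intro sum_nonneg tail0)
  have e0: "e \<ge> 0" using T suminf_D_nonneg by (simp add: e_def)
  have pb: "l2norm S (\<lambda>\<omega>. psum (N * L) \<omega> - bsum L N \<omega>) \<le> e * sqrt (N * L)"
  proof (rule power2_le_imp_le)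
    have "suminf D * (N * (\<Sum>s<L. tail_influence (Suc s))) = (e * sqrt (N * L))\<^sup>2"
      using L suminf_D_nonneg T unfolding e_def
      by (simp add: power_mult_distrib)
    then show "(l2norm S (\<lambda>\<omega>. psum (N * L) \<omega> - bsum L N \<omega>))\<^sup>2 \<le> (e * sqrt (N * L))\<^sup>2"
      using l2norm_psum_bsum[of N L] by simp
  qed (simp add: e0)
  have b: "l2norm S (bsum L N) \<le> (suminf D + e) * sqrt (N * L)"
  proof -
    have "l2norm S (\<lambda>\<omega>. psum (N * L) \<omega> - (psum (N * L) \<omega> - bsum L N \<omega>)) \<le> suminf D * sqrt (N * L) + e * sqrt (N * L)"
      using l2norm_diff_le[OF psum_sq_int sq_int_diff[OF psum_sq_int bsum_sq_int]] l2norm_psum_le[of "N * L"] pb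
      by (meson add_mono order_trans)
    then show ?thesis by (simp add: distrib_right)
  qed
  have d: "l2norm S (\<lambda>\<omega>. psum n \<omega> - psum (N * L) \<omega>) \<le> L * l2norm S F"
  proof -
    have "n - N * L \<le> L" using L by (simp add: N_def minus_div_mult_eq_mod less_imp_le)
    then have "(n - N * L) * l2norm S F \<le> L * l2norm S F" by (intro mult_right_mono) auto
    then show ?thesis using l2norm_psum_diff[OF NL] by linarith
  qed
  define X Y where "X \<omega> = psum n \<omega> - psum (N * L) \<omega>" and "Y \<omega> = psum (N * L) \<omega> - bsum L N \<omega>" for \<omega>
  have X: "sq_int S X" and Y: "sq_int S Y"
    unfolding X_def[abs_def] Y_def[abs_def] by (intro sq_int_diff psum_sq_int bsum_sq_int)+
  have "l2norm S (\<lambda>\<omega>. psum n \<omega> / sqrt n - bsum L N \<omega> / sqrt (N * L))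
      = l2norm S (\<lambda>\<omega>. (1 / sqrt n) * (X \<omega> + Y \<omega>) + (1 / sqrt n - 1 / sqrt (N * L)) * bsum L N \<omega>)"
    by (rule arg_cong[where f = "l2norm S"]) (simp add: fun_eq_iff algebra_simps diff_divide_distrib X_def Y_def)
  also have "\<dots> \<le> \<bar>1 / sqrt n\<bar> * l2norm S (\<lambda>\<omega>. X \<omega> + Y \<omega>) + \<bar>1 / sqrt n - 1 / sqrt (N * L)\<bar> * l2norm S (bsum L N)"
    unfolding l2norm_scale[symmetric] by (intro l2norm_triangle sq_int_scale sq_int_add X Y bsum_sq_int)
  also have "\<dots> \<le> \<bar>1 / sqrt n\<bar> * (l2norm S X + l2norm S Y) + \<bar>1 / sqrt n - 1 / sqrt (N * L)\<bar> * l2norm S (bsum L N)"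
    by (intro add_right_mono mult_left_mono l2norm_triangle X Y) simp
  also have "\<dots> \<le> \<bar>1 / sqrt n\<bar> * (L * l2norm S F + e * sqrt (N * L))
      + \<bar>1 / sqrt n - 1 / sqrt (N * L)\<bar> * ((suminf D + e) * sqrt (N * L))"
    unfolding X_def[abs_def] Y_def[abs_def] by (intro add_mono mult_left_mono d pb b) auto
  also have "\<dots> = L * l2norm S F / sqrt n + e * (sqrt (N * L) / sqrt n)
      + (suminf D + e) * (\<bar>1 / sqrt n - 1 / sqrt (N * L)\<bar> * sqrt (N * L))"
    using n by (simp add: field_simps)
  also have "\<dots> \<le> L * l2norm S F / sqrt n + e * 1 + (suminf D + e) * \<bar>sqrt (N * L / n) - 1\<bar>"
  proof (intro add_mono mult_left_mono order_refl)
    show "sqrt (N * L) / sqrt n \<le> 1"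
      using n NL by (simp add: divide_le_eq_1 flip: of_nat_mult)
    show "\<bar>1 / sqrt n - 1 / sqrt (N * L)\<bar> * sqrt (N * L) \<le> \<bar>sqrt (N * L / n) - 1\<bar>"
    proof (cases "N * L = 0")
      case False
      have "\<bar>1 / sqrt n - 1 / sqrt (N * L)\<bar> * sqrt (N * L) = \<bar>(1 / sqrt n - 1 / sqrt (N * L)) * sqrt (N * L)\<bar>"
        by (simp add: abs_mult)
      also have "(1 / sqrt n - 1 / sqrt (N * L)) * sqrt (N * L) = sqrt (N * L / n) - 1"
        using False by (simp add: left_diff_distrib real_sqrt_divide)
      finally show ?thesis by simp
    next
      \<comment> \<open>For n < L there is no full block; the factor sqrt 0 makes the left side
        0.\<close>
      case True
      then have "real N * real L = 0" by (metis of_nat_0 of_nat_mult)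
      then show ?thesis unfolding of_nat_mult by (simp only: real_sqrt_zero mult_zero_right abs_ge_zero)
    qed
  qed (simp_all add: e0 suminf_D_nonneg)
  finally show ?thesis by simp
qed

text \<open>The threshold |t| e is what remains of the error as n tends to infinity: the leftover
  and normalisation errors vanish, and the characteristic function of the blocks converges to the
  Gaussian one.\<close>

lemma char_psum_bsum:
  assumes L: "L > 0"
  defines "e \<equiv> sqrt (suminf D * ((\<Sum>s<L. tail_influence (Suc s)) / L))"
  assumes \<epsilon>: "\<epsilon> > \<bar>t\<bar> * e"
  shows "\<forall>\<^sub>F n in sequentially. cmod ((CLINT \<omega>|S. iexp (t * (psum n \<omega> / sqrt n)))
    - exp (- (t\<^sup>2 * (bvar L / L)) / 2)) < \<epsilon>"
proof -
  define B where "B n = (CLINT \<omega>|S. iexp (t * (bsum L (n div L) \<omega> / sqrt ((n div L) * L))))" for n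
  define E where "E = complex_of_real (exp (- (t\<^sup>2 * (bvar L / L)) / 2))"
  define r where "r n = \<bar>t\<bar> * (L * l2norm S F / sqrt n + e + (suminf D + e) * \<bar>sqrt ((n div L) * L / n) - 1\<bar>)" for n :: nat
  have div_top: "filterlim (\<lambda>n. n div L) at_top sequentially"
  proof (rule filterlim_at_top[THEN iffD2], rule allI)
    fix Z
    show "\<forall>\<^sub>F n in sequentially. Z \<le> n div L"
      using L by (intro eventually_sequentiallyI[of "Z * L"]) (simp add: less_eq_div_iff_mult_less_eq)
  qed
  have B: "B \<longlonglongrightarrow> E"
    unfolding B_def E_def by (rule filterlim_compose[OF block_char[OF L] div_top])
  have ratio: "(\<lambda>n. real ((n div L) * L) / n) \<longlonglongrightarrow> 1"
  proof (rule tendsto_sandwich[where f = "\<lambda>n. 1 - real L / real n" and h = "\<lambda>_. 1"])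
    have "1 - real L / n \<le> real ((n div L) * L) / n" if "n > 0" for n
    proof -
      have "n \<le> n div L * L + L"
        using L div_mult_mod_eq[of n L] mod_less_divisor[of L n] by linarith
      then have "real n - real L \<le> real (n div L * L)" by linarith
      then have "(real n - real L) / n \<le> real (n div L * L) / n" by (rule divide_right_mono) simp
      then show ?thesis using that by (simp add: diff_divide_distrib)
    qed
    then show "\<forall>\<^sub>F n in sequentially. 1 - real L / n \<le> real ((n div L) * L) / n"
      by (intro eventually_sequentiallyI[of 1]) auto
    show "\<forall>\<^sub>F n in sequentially. real ((n div L) * L) / n \<le> 1"
      by (intro always_eventually) (auto simp: divide_le_eq_1 simp flip: of_nat_mult)
    have "(\<lambda>n. 1 - real L / real n) \<longlonglongrightarrow> 1 - 0"
      by (intro tendsto_diff tendsto_const lim_const_over_n)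
    then show "(\<lambda>n. 1 - real L / real n) \<longlonglongrightarrow> 1" by simp
  qed simp
  have "(\<lambda>n. \<bar>sqrt (real ((n div L) * L) / n) - 1\<bar>) \<longlonglongrightarrow> \<bar>sqrt 1 - 1\<bar>"
    by (intro tendsto_intros ratio)
  moreover have "(\<lambda>n. L * l2norm S F / sqrt n) \<longlonglongrightarrow> 0"
    by (intro tendsto_divide_0[OF tendsto_const] filterlim_at_top_imp_at_infinity
        filterlim_compose[OF sqrt_at_top filterlim_real_sequentially])
  ultimately have "r \<longlonglongrightarrow> \<bar>t\<bar> * (0 + e + (suminf D + e) * \<bar>sqrt 1 - 1\<bar>)"
    unfolding r_def by (intro tendsto_mult tendsto_add tendsto_const)
  moreover have "(\<lambda>n. cmod (B n - E)) \<longlonglongrightarrow> 0"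
    using B by (intro tendsto_norm_zero) (simp add: LIM_zero)
  ultimately have "(\<lambda>n. r n + cmod (B n - E)) \<longlonglongrightarrow> \<bar>t\<bar> * (0 + e + (suminf D + e) * \<bar>sqrt 1 - 1\<bar>) + 0"
    by (rule tendsto_add)
  then have "(\<lambda>n. r n + cmod (B n - E)) \<longlonglongrightarrow> \<bar>t\<bar> * e" by simp
  then have "\<forall>\<^sub>F n in sequentially. r n + cmod (B n - E) < \<epsilon>"
    using \<epsilon> by (rule order_tendstoD(2))
  moreover have "\<forall>\<^sub>F n in sequentially. cmod ((CLINT \<omega>|S. iexp (t * (psum n \<omega> / sqrt n))) - E) \<le> r n + cmod (B n - E)"
  proof (rule eventually_sequentiallyI[of 1])
    fix n :: nat assume n: "n \<ge> 1"
    let ?b = "\<lambda>\<omega>. bsum L (n div L) \<omega> / sqrt ((n div L) * L)"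
    have s1: "sq_int S (\<lambda>\<omega>. psum n \<omega> / sqrt n)" and s2: "sq_int S ?b"
      using sq_int_scale[OF psum_sq_int, of "1 / sqrt n" n] sq_int_scale[OF bsum_sq_int, of "1 / sqrt ((n div L) * L)" L "n div L"] by auto
    have "cmod ((CLINT \<omega>|S. iexp (t * (psum n \<omega> / sqrt n))) - B n) \<le> l2norm S (\<lambda>\<omega>. t * (psum n \<omega> / sqrt n) - t * ?b \<omega>)"
      unfolding B_def by (intro PS.norm_expectation_iexp_diff_le sq_int_scale s1 s2)
    also have "\<dots> = \<bar>t\<bar> * l2norm S (\<lambda>\<omega>. psum n \<omega> / sqrt n - ?b \<omega>)"
      unfolding l2norm_scale[symmetric] by (simp only: right_diff_distrib)
    also have "\<dots> \<le> r n"
      using l2norm_psum_bsum_scaled[OF L, of n] n unfolding r_def e_def by (intro mult_left_mono) auto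
    finally show "cmod ((CLINT \<omega>|S. iexp (t * (psum n \<omega> / sqrt n))) - E) \<le> r n + cmod (B n - E)"
      using norm_triangle_ineq[of "(CLINT \<omega>|S. iexp (t * (psum n \<omega> / sqrt n))) - B n" "B n - E"] by simp
  qed
  ultimately show ?thesis unfolding E_def by eventually_elim simp
qed

text \<open>A subsequence of block lengths along which the normalised block deviations converge is
  enough. Each such length describes the characteristic function for all large n up to an error that
  tends to 0 along the subsequence, so the full sequence in n converges.\<close>

theorem central_limit:
  "\<exists>s\<ge>0. weak_conv_m (\<lambda>n. distr S borel (\<lambda>\<omega>. (\<Sum>i<Suc n. F (seq_shift i \<omega>)) / sqrt (real (Suc n)))) (gaussian0 s)"
proof -
  define \<sigma> where "\<sigma> L = sqrt (bvar L / L)" for L :: nat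
  define e where "e L = sqrt (suminf D * ((\<Sum>s<L. tail_influence (Suc s)) / L))" for L :: nat
  have bvar0: "bvar L \<ge> 0" for L by (simp add: bvar_def)
  have \<sigma>2: "(\<sigma> L)\<^sup>2 = bvar L / L" for L by (simp add: \<sigma>_def bvar0)
  have \<sigma>_in: "\<sigma> L \<in> {0..suminf D}" for L
  proof (cases "L = 0")
    case False
    have "bvar L / L \<le> (suminf D)\<^sup>2" using bvar_le[of L] False by (simp add: field_simps)
    then show ?thesis using bvar0 suminf_D_nonneg by (auto simp: \<sigma>_def intro: real_le_lsqrt)
  qed (simp add: \<sigma>_def suminf_D_nonneg)
  obtain s q where s: "s \<in> {0..suminf D}" and q: "strict_mono q" and lim: "(\<sigma> \<circ> q) \<longlonglongrightarrow> s"
    using \<sigma>_in compact_Icc[of 0 "suminf D"] unfolding compact_eq_seq_compact_metric seq_compact_def by metis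
  have e: "e \<longlonglongrightarrow> 0"
    unfolding e_def using tendsto_real_sqrt[OF tendsto_mult[OF tendsto_const Cesaro_null[OF tail_influence_tendsto_0]]] by simp
  have char: "(\<lambda>n. CLINT \<omega>|S. iexp (t * (psum n \<omega> / sqrt n))) \<longlonglongrightarrow> exp (- (t\<^sup>2 * s\<^sup>2) / 2)" for t
  proof (rule tendstoI)
    fix \<epsilon> :: real assume \<epsilon>: "\<epsilon> > 0"
    define E where "E L = complex_of_real (exp (- (t\<^sup>2 * (bvar L / L)) / 2))" for L :: nat
    have "(\<lambda>k. \<bar>t\<bar> * e (q k)) \<longlonglongrightarrow> \<bar>t\<bar> * 0"
      using LIMSEQ_subseq_LIMSEQ[OF e q] by (intro tendsto_intros) (simp add: comp_def)
    then have 1: "\<forall>\<^sub>F k in sequentially. \<bar>t\<bar> * e (q k) < \<epsilon> / 2"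
      using \<epsilon> by (intro order_tendstoD(2)) auto
    have "(\<lambda>k. complex_of_real (exp (- (t\<^sup>2 * (\<sigma> (q k))\<^sup>2) / 2))) \<longlonglongrightarrow> exp (- (t\<^sup>2 * s\<^sup>2) / 2)"
      using lim by (intro tendsto_intros) (auto simp: comp_def)
    then have 2: "\<forall>\<^sub>F k in sequentially. dist (E (q k)) (exp (- (t\<^sup>2 * s\<^sup>2) / 2)) < \<epsilon> / 2"
      unfolding \<sigma>2 E_def[symmetric] using \<epsilon> by (intro tendstoD) auto
    have 3: "\<forall>\<^sub>F k in sequentially. q k > 0"
      using filterlim_subseq[OF q] eventually_gt_at_top[of 0] by (rule filterlim_iff[THEN iffD1, rule_format])
    \<comment> \<open>The block length is fixed first, with both its blocking error and the distance
      of its Gaussian from the limiting one below half of \<epsilon>; only then does n grow.\<close>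
    obtain k where k: "\<bar>t\<bar> * e (q k) < \<epsilon> / 2" "dist (E (q k)) (exp (- (t\<^sup>2 * s\<^sup>2) / 2)) < \<epsilon> / 2" "q k > 0"
      using eventually_happens[OF eventually_conj[OF 1 eventually_conj[OF 2 3]]] by auto
    have "\<forall>\<^sub>F n in sequentially. cmod ((CLINT \<omega>|S. iexp (t * (psum n \<omega> / sqrt n))) - E (q k)) < \<epsilon> / 2"
      unfolding E_def using k by (intro char_psum_bsum) (auto simp: e_def)
    then show "\<forall>\<^sub>F n in sequentially. dist (CLINT \<omega>|S. iexp (t * (psum n \<omega> / sqrt n))) (exp (- (t\<^sup>2 * s\<^sup>2) / 2)) < \<epsilon>"
    proof eventually_elim
      case (elim n)
      then show ?case
        using k(2) dist_triangle_half_l[of "CLINT \<omega>|S. iexp (t * (psum n \<omega> / sqrt n))" "E (q k)" \<epsilon> "exp (- (t\<^sup>2 * s\<^sup>2) / 2)"]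
        by (simp add: dist_norm norm_minus_commute)
    qed
  qed
  have [measurable]: "psum n \<in> borel_measurable S" for n by (rule sq_int_measurable[OF psum_sq_int])
  have "weak_conv_m (\<lambda>n. distr S borel (\<lambda>\<omega>. psum (Suc n) \<omega> / sqrt (real (Suc n)))) (gaussian0 s)"
  proof (rule levy_continuity)
    fix t
    show "(\<lambda>n. char (distr S borel (\<lambda>\<omega>. psum (Suc n) \<omega> / sqrt (real (Suc n)))) t) \<longlonglongrightarrow> char (gaussian0 s) t"
      using LIMSEQ_Suc[OF char[of t]] s by (simp add: char_gaussian0 PS.char_distr)
  qed (use s in \<open>auto intro!: PS.real_distribution_distr real_distribution_gaussian0\<close>)
  then show ?thesis using s unfolding psum_def by auto
qed

end

section \<open>Mixing of the Bernoulli shift\<close>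

context iid_real
begin

lemma indep_measure:
  fixes A B :: "('i \<Rightarrow> real) set"
  assumes A: "A \<in> sets prodm" and B: "B \<in> sets prodm"
    and dA: "\<And>z z'. (\<And>i. i \<in> I \<Longrightarrow> z i = z' i) \<Longrightarrow> z \<in> A \<longleftrightarrow> z' \<in> A"
    and dB: "\<And>z z'. (\<And>i. i \<in> J \<Longrightarrow> z i = z' i) \<Longrightarrow> z \<in> B \<longleftrightarrow> z' \<in> B"
    and IJ: "I \<inter> J = {}"
  shows "measure prodm (A \<inter> B) = measure prodm A * measure prodm B"
proof -
  interpret P: prob_space "prodm :: ('i \<Rightarrow> real) measure" by (rule prob_space_prodm)
  have "(\<integral>z. indicator A z * indicator B z \<partial>prodm) = (\<integral>z. indicator A z \<partial>prodm) * (\<integral>z. indicator B z \<partial>prodm :: real)"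
  proof (rule indep_integral[OF _ _ _ _ IJ])
    show "integrable prodm (indicator A :: _ \<Rightarrow> real)" "integrable prodm (indicator B :: _ \<Rightarrow> real)"
      using A B by (auto intro: P.integrable_const_bound[of _ 1])
    show "indicator A z = (indicator A z' :: real)" if "\<And>i. i \<in> I \<Longrightarrow> z i = z' i" for z z'
      using dA[OF that] by (simp add: indicator_def)
    show "indicator B z = (indicator B z' :: real)" if "\<And>i. i \<in> J \<Longrightarrow> z i = z' i" for z z'
      using dB[OF that] by (simp add: indicator_def)
  qed
  then show ?thesis using A B by (simp flip: indicator_inter_arith)
qed

text \<open>Only \<open>A\<close> has to be approximated. If \<open>A\<close> is a cylinder over the
  first N coordinates, then for n \<ge> N the preimage of an arbitrary \<open>B\<close> reads other
  coordinates and the limit is attained exactly. The sets \<open>A\<close> with the property are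
  closed under complements and countable disjoint unions; for unions the measures of the pieces
  dominate.\<close>

theorem seq_shift_mixing:
  assumes A: "A \<in> sets S" and B: "B \<in> sets S"
  shows "(\<lambda>n. measure S (A \<inter> seq_shift n -` B)) \<longlonglongrightarrow> measure S A * measure S B"
proof -
  have Bn: "seq_shift n -` B \<in> sets S" for n
    using measurable_sets[OF seq_shift_measurable B] by simp
  have PB: "measure S (seq_shift n -` B) = measure S B" for n
    using meas_pres_shift[of n] measure_distr[OF seq_shift_measurable B, of n] by (simp add: meas_pres_def)
  have "A \<in> sigma_sets (\<Pi>\<^sub>E i\<in>UNIV. space \<nu>) (prod_algebra UNIV (\<lambda>_. \<nu>))"
    using A by (simp add: sets_PiM)
  with Int_stable_prod_algebra prod_algebra_sets_into_space show ?thesis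
  proof (induction rule: sigma_sets_induct_disjoint)
    case (basic A)
    then obtain J E where J: "A = prod_emb UNIV (\<lambda>_. \<nu>) J (Pi\<^sub>E J E)" "finite J" "\<And>i. i \<in> J \<Longrightarrow> E i \<in> sets \<nu>"
      by (elim prod_algebraE) auto
    then have A: "A \<in> sets S" by (simp add: sets_PiM_I)
    obtain N where N: "J \<subseteq> {..<N}" using finite_nat_iff_bounded[of J] J by blast
    have "measure S (A \<inter> seq_shift n -` B) = measure S A * measure S B" if n: "n \<ge> N" for n
      unfolding PB[of n, symmetric]
    proof (rule indep_measure[OF A Bn, of "{..<N}" "{N..}"])
      show "\<omega> \<in> A \<longleftrightarrow> \<omega>' \<in> A" if "\<And>i. i \<in> {..<N} \<Longrightarrow> \<omega> i = \<omega>' i" for \<omega> \<omega>' :: "nat \<Rightarrow> real"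
        using that N unfolding J by (auto simp: prod_emb_def PiE_iff subset_eq)
      show "\<omega> \<in> seq_shift n -` B \<longleftrightarrow> \<omega>' \<in> seq_shift n -` B" if "\<And>i. i \<in> {N..} \<Longrightarrow> \<omega> i = \<omega>' i" for \<omega> \<omega>' :: "nat \<Rightarrow> real"
      proof -
        have "seq_shift n \<omega> = seq_shift n \<omega>'" using that n by (simp add: seq_shift_def)
        then show ?thesis by simp
      qed
    qed auto
    then show ?case by (intro tendsto_eventually eventually_sequentiallyI[of N])
  next
    case empty
    then show ?case by simp
  next
    case (compl A)
    then have A: "A \<in> sets S" by (simp add: sets_PiM)
    have "measure S ((UNIV - A) \<inter> seq_shift n -` B) = measure S B - measure S (A \<inter> seq_shift n -` B)" for n
    proof -
      have "(UNIV - A) \<inter> seq_shift n -` B = seq_shift n -` B - A" by auto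
      then show ?thesis using PS.finite_measure_Diff'[OF Bn A, of n] PB[of n] by (simp add: Int_commute)
    qed
    moreover have "measure S (UNIV - A) = 1 - measure S A"
      using PS.prob_compl[OF A] by simp
    moreover have "(\<lambda>n. measure S B - measure S (A \<inter> seq_shift n -` B)) \<longlonglongrightarrow> measure S B - measure S A * measure S B"
      by (intro tendsto_intros compl)
    ultimately show ?case by (simp add: left_diff_distrib)
  next
    case (union A)
    then have A: "range A \<subseteq> sets S" by (auto simp: sets_PiM)
    have sA: "(\<lambda>i. measure S (A i)) sums measure S (\<Union>i. A i)"
      using A union by (intro PS.finite_measure_UNION)
    have sAB: "(\<lambda>i. measure S (A i \<inter> seq_shift n -` B)) sums measure S ((\<Union>i. A i) \<inter> seq_shift n -` B)" for n
    proof -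
      have "(\<lambda>i. measure S (A i \<inter> seq_shift n -` B)) sums measure S (\<Union>i. A i \<inter> seq_shift n -` B)"
        using A union Bn by (intro PS.finite_measure_UNION) (auto simp: disjoint_family_on_def)
      then show ?thesis by (simp add: Int_UN_distrib2)
    qed
    have "((\<lambda>n. \<Sum>i. measure S (A i \<inter> seq_shift n -` B)) \<longlongrightarrow> (\<Sum>i. measure S (A i) * measure S B)) sequentially"
    proof (rule tannerys_theorem[THEN conjunct2, THEN conjunct2])
      show "(\<lambda>n. measure S (A i \<inter> seq_shift n -` B)) \<longlonglongrightarrow> measure S (A i) * measure S B" for i
        using union by auto
      show "\<forall>\<^sub>F (i, n) in sequentially \<times>\<^sub>F sequentially. norm (measure S (A i \<inter> seq_shift n -` B)) \<le> measure S (A i)"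
        using A by (intro always_eventually) (auto intro!: PS.finite_measure_mono)
      show "summable (\<lambda>i. measure S (A i))" using sA by (rule sums_summable)
    qed simp
    moreover have "(\<Sum>i. measure S (A i) * measure S B) = measure S (\<Union>i. A i) * measure S B"
      using sums_unique[OF sums_mult2[OF sA]] by simp
    ultimately show ?case using sums_unique[OF sAB] by simp
  qed
qed

end

text \<open>Dividing the normal density by 1 + h makes \<open>h\<close> integrable however fast it
  grows and keeps the density strictly positive, which gives full support.\<close>

lemma full_support_measure_exists:
  fixes h :: "real \<Rightarrow> real"
  assumes h [measurable]: "h \<in> borel_measurable borel" and pos: "\<And>x. h x \<ge> 0"
  obtains \<nu> where "prob_space \<nu>" "sets \<nu> = sets borel" "integrable \<nu> h"
    "\<And>U. open U \<Longrightarrow> U \<noteq> {} \<Longrightarrow> emeasure \<nu> U > 0"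
proof -
  define g where "g x = std_normal_density x / (1 + h x)" for x
  have h1: "1 + h x > 0" for x using pos[of x] by linarith
  have gpos: "g x > 0" for x using h1[of x] by (simp add: g_def normal_density_pos)
  have [measurable]: "g \<in> borel_measurable borel" unfolding g_def[abs_def] by measurable
  have gle: "g x \<le> std_normal_density x" "h x * g x \<le> std_normal_density x" for x
  proof -
    have "std_normal_density x \<ge> 0" by simp
    moreover have "1 / (1 + h x) \<le> 1" "h x / (1 + h x) \<le> 1" using pos[of x] by (auto simp: divide_le_eq_1)
    ultimately show "g x \<le> std_normal_density x" "h x * g x \<le> std_normal_density x"
      using mult_left_mono[of _ 1 "std_normal_density x"] by (fastforce simp: g_def mult.commute)+
  qed
  have gi: "integrable lborel g"
    by (rule Bochner_Integration.integrable_bound[OF integrable_normal_density[of 1 0]])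
       (use gle gpos in \<open>auto simp: less_imp_le\<close>)
  have hgi: "integrable lborel (\<lambda>x. h x * g x)"
    by (rule Bochner_Integration.integrable_bound[OF integrable_normal_density[of 1 0]])
       (use gle gpos pos in \<open>auto simp: less_imp_le\<close>)
  define Z where "Z = (\<integral>x. g x \<partial>lborel)"
  have "Z \<noteq> 0"
  proof
    assume "Z = 0"
    then have "AE x in lborel. g x = 0"
      using integral_nonneg_eq_0_iff_AE[OF gi] gpos by (auto simp: Z_def less_imp_le)
    then have "AE x :: real in lborel. False" using gpos by (simp add: less_imp_neq[symmetric])
    then show False using AE_iff_measurable[of UNIV lborel "\<lambda>_ :: real. False"] by simp
  qed
  then have Z: "Z > 0" unfolding Z_def using gpos by (simp add: less_le less_imp_le integral_nonneg)
  define \<nu> where "\<nu> = density lborel (\<lambda>x. ennreal (g x / Z))"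
  show thesis
  proof (rule that[of \<nu>])
    show "prob_space \<nu>"
    proof (rule prob_spaceI)
      have "emeasure \<nu> (space \<nu>) = (\<integral>\<^sup>+x. ennreal (g x / Z) \<partial>lborel)"
        by (simp add: \<nu>_def emeasure_density)
      also have "\<dots> = ennreal (\<integral>x. g x / Z \<partial>lborel)"
        using gi gpos Z by (intro nn_integral_eq_integral) (auto simp: less_imp_le)
      also have "\<dots> = 1" using Z by (simp add: Z_def)
      finally show "emeasure \<nu> (space \<nu>) = 1" .
    qed
    show "sets \<nu> = sets borel" by (simp add: \<nu>_def)
    show "integrable \<nu> h"
      unfolding \<nu>_def using hgi gpos Z
      by (subst integrable_density) (auto simp: less_imp_le mult.commute)
    fix U :: "real set" assume U: "open U" "U \<noteq> {}"
    have "emeasure \<nu> U \<noteq> 0"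
    proof
      assume "emeasure \<nu> U = 0"
      then have "AE x in lborel. ennreal (g x / Z) * indicator U x = 0"
        using U by (simp add: \<nu>_def emeasure_density nn_integral_0_iff_AE)
      then have "AE x in lborel. x \<notin> U"
      proof eventually_elim
        case (elim x)
        moreover have "ennreal (g x / Z) \<noteq> 0" using gpos[of x] Z by (simp add: ennreal_eq_0_iff not_le)
        ultimately show ?case by (auto simp: indicator_def)
      qed
      then have "emeasure lborel U = 0"
        using U AE_iff_measurable[of U lborel "\<lambda>x. x \<notin> U"] by auto
      moreover obtain x e where "e > 0" "ball x e \<subseteq> U" using U open_contains_ball by blast
      moreover from this have "emeasure lborel (ball x e) \<le> emeasure lborel U"
        using U by (intro emeasure_mono) auto
      ultimately show False by (simp add: ball_eq_greaterThanLessThan)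
    qed
    then show "emeasure \<nu> U > 0" by (simp add: zero_less_iff_neq_zero)
  qed
qed

section \<open>Topology and Borel sets of the sequence space\<close>

lemma lp_mono:
  assumes "y \<in> lp p" "\<And>n. \<bar>x n\<bar> \<le> \<bar>y n\<bar>" "p \<ge> 0" shows "x \<in> lp p"
proof -
  have "summable (\<lambda>n. \<bar>y n\<bar> powr p)" using assms(1) by (simp add: lp_def)
  then have "summable (\<lambda>n. \<bar>x n\<bar> powr p)"
    by (rule summable_comparison_test'[of _ 0]) (use assms in \<open>auto intro: powr_mono2\<close>)
  then show ?thesis by (simp add: lp_def)
qed

lemma lpnorm_mono:
  assumes "y \<in> lp p" "\<And>n. \<bar>x n\<bar> \<le> \<bar>y n\<bar>" "p > 0" shows "lpnorm p x \<le> lpnorm p y"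
proof -
  have "x \<in> lp p" using assms by (intro lp_mono[of y p x]) auto
  then have "(\<Sum>n. \<bar>x n\<bar> powr p) \<le> (\<Sum>n. \<bar>y n\<bar> powr p)"
    using assms by (intro suminf_le) (auto simp: lp_def intro: powr_mono2)
  then show ?thesis unfolding lpnorm_def
    using \<open>x \<in> lp p\<close> assms(3) by (intro powr_mono2 suminf_nonneg) (auto simp: lp_def)
qed

lemma lp_single: "(\<lambda>n. if n = k then a else 0) \<in> lp p"
  unfolding lp_def by (auto intro!: summable_finite[of "{k}"] split: if_splits)

lemma lpnorm_single:
  assumes "p > 0" shows "lpnorm p (\<lambda>n. if n = k then a else 0) = \<bar>a\<bar>"
proof -
  have "(\<lambda>n. \<bar>if n = k then a else 0\<bar> powr p) = (\<lambda>n. if n = k then \<bar>a\<bar> powr p else 0)" by auto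
  then have "(\<Sum>n. \<bar>if n = k then a else 0\<bar> powr p) = \<bar>a\<bar> powr p"
    using sums_unique[OF sums_single[of k "\<lambda>_. \<bar>a\<bar> powr p"]] by simp
  then show ?thesis using assms by (simp add: lpnorm_def powr_powr)
qed

lemma lp_trunc: "seq_trunc N x \<in> lp p"
  unfolding lp_def by (auto simp: seq_trunc_def intro!: summable_finite[of "{..<N}"] split: if_splits)

lemma lpnorm_trunc_le:
  assumes "x \<in> lp p" "p > 0" shows "lpnorm p (seq_trunc N x) \<le> lpnorm p x"
  using assms by (intro lpnorm_mono) (auto simp: seq_trunc_def)

lemma lpnorm_trunc_le_sum:
  assumes "p \<ge> 1" shows "lpnorm p (seq_trunc N x) \<le> (\<Sum>n<N. \<bar>x n\<bar>)"
proof (induction N)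
  case 0
  then show ?case by (simp add: seq_trunc_def lpnorm_zero)
next
  case (Suc N)
  have "seq_trunc (Suc N) x = (\<lambda>n. seq_trunc N x n + (if n = N then x N else 0))"
    by (auto simp: seq_trunc_def)
  then have "lpnorm p (seq_trunc (Suc N) x) \<le> lpnorm p (seq_trunc N x) + lpnorm p (\<lambda>n. if n = N then x N else 0)"
    using lpnorm_triangle[OF assms lp_trunc[of N x p] lp_single[of N "x N" p]] by simp
  then show ?case using Suc assms by (simp add: lpnorm_single)
qed

lemma lpnorm_trunc_tendsto:
  assumes x: "x \<in> lp p" and p: "p > 0"
  shows "(\<lambda>N. lpnorm p (\<lambda>n. x n - seq_trunc N x n)) \<longlonglongrightarrow> 0"
proof -
  let ?f = "\<lambda>n. \<bar>x n\<bar> powr p"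
  have s: "summable ?f" using x by (simp add: lp_def)
  have e: "(\<Sum>n. \<bar>x n - seq_trunc N x n\<bar> powr p) = suminf ?f - (\<Sum>n<N. ?f n)" for N
  proof -
    have "(\<lambda>n. \<bar>x (n + N) - seq_trunc N x (n + N)\<bar> powr p) sums (suminf ?f - (\<Sum>n<N. ?f n))"
      using sums_split_initial_segment[OF summable_sums[OF s], of N] by (simp add: seq_trunc_def)
    then show ?thesis
      by (subst (asm) sums_zero_iff_shift) (auto simp: seq_trunc_def sums_iff)
  qed
  have "(\<lambda>N. suminf ?f - (\<Sum>n<N. ?f n)) \<longlonglongrightarrow> suminf ?f - suminf ?f"
    by (intro tendsto_diff tendsto_const summable_LIMSEQ s)
  then have "(\<lambda>N. (suminf ?f - (\<Sum>n<N. ?f n)) powr (1 / p)) \<longlonglongrightarrow> 0"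
    using p s by (intro tendsto_zero_powrI[where b = "1 / p"]) (auto intro!: always_eventually sum_le_suminf)
  then show ?thesis by (simp add: lpnorm_def e)
qed

lemma space_lp_borel [simp]: "space (lp_borel p) = lp p"
  unfolding lp_borel_def by (rule space_measure_of) (auto simp: lp_open_def)

lemma sets_lp_borel: "sets (lp_borel p) = sigma_sets (lp p) {U. lp_open p U}"
  unfolding lp_borel_def by (rule sets_measure_of) (auto simp: lp_open_def)

lemma lp_open_sets: "lp_open p U \<Longrightarrow> U \<in> sets (lp_borel p)"
  by (auto simp: sets_lp_borel)

lemma lp_continuous_measurable:
  fixes f :: "(nat \<Rightarrow> real) \<Rightarrow> real"
  assumes "\<And>x e. x \<in> lp p \<Longrightarrow> e > 0 \<Longrightarrow> \<exists>d>0. \<forall>y\<in>lp p. lpnorm p (\<lambda>n. y n - x n) < d \<longrightarrow> \<bar>f y - f x\<bar> < e"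
  shows "f \<in> borel_measurable (lp_borel p)"
proof (rule borel_measurableI)
  fix T :: "real set" assume T: "open T"
  have "lp_open p (f -` T \<inter> lp p)"
    unfolding lp_open_def
  proof safe
    fix x assume x: "x \<in> lp p" "f x \<in> T"
    obtain e where e: "e > 0" "\<And>y. \<bar>y - f x\<bar> < e \<Longrightarrow> y \<in> T"
      using T x(2) unfolding open_dist dist_real_def by blast
    obtain d where "d > 0" "\<forall>y\<in>lp p. lpnorm p (\<lambda>n. y n - x n) < d \<longrightarrow> \<bar>f y - f x\<bar> < e"
      using assms[OF x(1) e(1)] by blast
    then show "\<exists>d>0. \<forall>y\<in>lp p. lpnorm p (\<lambda>n. y n - x n) < d \<longrightarrow> y \<in> f -` T \<inter> lp p"
      using e(2) by auto
  qed
  then show "f -` T \<inter> space (lp_borel p) \<in> sets (lp_borel p)" by (simp add: lp_open_sets)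
qed

lemma lpnorm_measurable:
  assumes p: "p \<ge> 1" shows "lpnorm p \<in> borel_measurable (lp_borel p)"
proof (rule lp_continuous_measurable)
  fix x e assume x: "x \<in> lp p" "(e::real) > 0"
  show "\<exists>d>0. \<forall>y\<in>lp p. lpnorm p (\<lambda>n. y n - x n) < d \<longrightarrow> \<bar>lpnorm p y - lpnorm p x\<bar> < e"
    using lpnorm_triangle_diff[OF p _ x(1)] lpnorm_triangle_diff[OF p x(1)] lpnorm_minus_commute[of p x] x(2)
    by (intro exI[of _ e]) (fastforce simp: abs_less_iff)
qed

lemma exp_lipschitz_measurable:
  assumes p: "p \<ge> 1" and f: "exp_lipschitz p f K"
  shows "f \<in> borel_measurable (lp_borel p)"
proof (rule lp_continuous_measurable)
  fix x e assume x: "x \<in> lp p" and e: "(e::real) > 0"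
  define R where "R = lpnorm p x + 1"
  have K: "K \<ge> 0" using f by (simp add: exp_lipschitz_def)
  \<comment> \<open>\<open>R\<close> bounds the norm on the unit ball around \<open>x\<close>, hence
    the minimum with 1; K + 1 keeps the quotient meaningful when K = 0.\<close>
  define d where "d = min 1 (e / ((K + 1) * exp R))"
  have Ke: "(K + 1) * exp R > 0" using K by (intro mult_pos_pos) auto
  have "\<bar>f y - f x\<bar> < e" if y: "y \<in> lp p" "lpnorm p (\<lambda>n. y n - x n) < d" for y
  proof -
    have "lpnorm p y \<le> R" "lpnorm p x \<le> R"
      using lpnorm_triangle_diff[OF p y(1) x] y(2) by (auto simp: R_def d_def)
    then have "\<bar>f y - f x\<bar> \<le> K * lpnorm p (\<lambda>n. y n - x n) * exp R"
      using f x y(1) by (auto simp: exp_lipschitz_def)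
    also have "\<dots> \<le> (K + 1) * lpnorm p (\<lambda>n. y n - x n) * exp R"
      using lpnorm_nonneg by (intro mult_right_mono) auto
    also have "\<dots> = lpnorm p (\<lambda>n. y n - x n) * ((K + 1) * exp R)" by simp
    also have "\<dots> < e"
      using y(2) Ke by (simp add: d_def pos_less_divide_eq)
    finally show ?thesis .
  qed
  then show "\<exists>d>0. \<forall>y\<in>lp p. lpnorm p (\<lambda>n. y n - x n) < d \<longrightarrow> \<bar>f y - f x\<bar> < e"
    using e Ke by (intro exI[of _ d]) (auto simp: d_def)
qed

section \<open>Separability and measurable maps into the sequence space\<close>

definition rat_seq :: "rat list \<Rightarrow> nat \<Rightarrow> real" where
  "rat_seq l n = (if n < length l then of_rat (l ! n) else 0)"

lemma rat_seq_lp: "rat_seq l \<in> lp p"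
proof -
  have "rat_seq l = seq_trunc (length l) (rat_seq l)" by (auto simp: rat_seq_def seq_trunc_def)
  then show ?thesis using lp_trunc by metis
qed

lemma rat_seq_dense:
  assumes p: "p \<ge> 1" and x: "x \<in> lp p" and e: "e > 0"
  obtains l where "lpnorm p (\<lambda>n. x n - rat_seq l n) < e"
proof -
  have "\<forall>\<^sub>F N in sequentially. lpnorm p (\<lambda>n. x n - seq_trunc N x n) < e / 2"
    using lpnorm_trunc_tendsto[OF x] p e by (intro order_tendstoD(2)) auto
  then obtain N where N: "lpnorm p (\<lambda>n. x n - seq_trunc N x n) < e / 2"
    using eventually_happens by (auto simp: eventually_sequentially)
  \<comment> \<open>The accuracy is shared among N coordinates; N + 1 in the denominator covers N =
    0.\<close>
  define \<delta> where "\<delta> = e / (2 * (real N + 1))"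
  have "\<exists>q. \<bar>x n - of_rat q\<bar> < \<delta>" for n
  proof -
    have "\<delta> > 0" using e by (simp add: \<delta>_def)
    then obtain q where "x n - \<delta> < of_rat q" "of_rat q < x n" using of_rat_dense[of "x n - \<delta>" "x n"] by auto
    then show ?thesis by (intro exI[of _ q]) auto
  qed
  then obtain q where q: "\<And>n. \<bar>x n - of_rat (q n)\<bar> < \<delta>" by metis
  define l where "l = map q [0..<N]"
  have l: "(\<lambda>n. seq_trunc N x n - rat_seq l n) = seq_trunc N (\<lambda>n. x n - of_rat (q n))"
    by (auto simp: l_def rat_seq_def seq_trunc_def)
  have "lpnorm p (\<lambda>n. seq_trunc N x n - rat_seq l n) \<le> (\<Sum>n<N. \<bar>x n - of_rat (q n)\<bar>)"
    unfolding l by (rule lpnorm_trunc_le_sum[OF p])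
  also have "\<dots> \<le> (\<Sum>n<N. \<delta>)" using q by (intro sum_mono less_imp_le)
  also have "\<dots> \<le> e / 2" using e by (simp add: \<delta>_def field_simps)
  finally have "lpnorm p (\<lambda>n. x n - rat_seq l n) < e"
    using lpnorm_triangle3[OF p x lp_trunc[of N x p] rat_seq_lp[of l p]] N by linarith
  then show thesis by (rule that)
qed

text \<open>By separability an open set is a countable union of balls with rational, finitely
  supported centres and radii 1 / (k + 1). The distance to such a centre is a series in the
  coordinates, so the preimage of each ball is measurable.\<close>

lemma measurable_lp_borelI:
  assumes p: "p \<ge> 1" and g: "\<And>\<omega>. \<omega> \<in> space M \<Longrightarrow> g \<omega> \<in> lp p"
    and [measurable]: "\<And>n. (\<lambda>\<omega>. g \<omega> n) \<in> borel_measurable M"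
  shows "g \<in> measurable M (lp_borel p)"
  unfolding lp_borel_def
proof (rule measurable_measure_of)
  show "{U. lp_open p U} \<subseteq> Pow (lp p)" by (auto simp: lp_open_def)
  show "g \<in> space M \<rightarrow> lp p" using g by auto
  fix U assume "U \<in> {U. lp_open p U}"
  then have U: "lp_open p U" by simp
  define b where "b l k = {y \<in> lp p. lpnorm p (\<lambda>n. y n - rat_seq l n) < 1 / real (Suc k)}" for l k
  define I where "I = {(l, k). b l k \<subseteq> U}"
  have "U \<subseteq> (\<Union>(l, k)\<in>I. b l k)"
  proof
    fix x assume x: "x \<in> U"
    then have xl: "x \<in> lp p" using U by (auto simp: lp_open_def)
    obtain e where e: "e > 0" "\<And>y. y \<in> lp p \<Longrightarrow> lpnorm p (\<lambda>n. y n - x n) < e \<Longrightarrow> y \<in> U"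
      using U x unfolding lp_open_def by blast
    \<comment> \<open>With radius below e / 2, a ball that contains \<open>x\<close> stays within
      distance e of \<open>x\<close>, hence inside \<open>U\<close>.\<close>
    obtain k where k: "1 / real (Suc k) < e / 2" using reals_Archimedean[of "e / 2"] e(1) by (auto simp: inverse_eq_divide)
    obtain l where l: "lpnorm p (\<lambda>n. x n - rat_seq l n) < 1 / real (Suc k)"
      using rat_seq_dense[OF p xl, of "1 / real (Suc k)"] by auto
    have "b l k \<subseteq> U"
    proof
      fix y assume y: "y \<in> b l k"
      then have "lpnorm p (\<lambda>n. y n - x n) \<le> lpnorm p (\<lambda>n. y n - rat_seq l n) + lpnorm p (\<lambda>n. rat_seq l n - x n)"
        using xl by (intro lpnorm_triangle3[OF p _ rat_seq_lp]) (auto simp: b_def)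
      also have "lpnorm p (\<lambda>n. rat_seq l n - x n) = lpnorm p (\<lambda>n. x n - rat_seq l n)" by (rule lpnorm_minus_commute)
      finally show "y \<in> U" using y l k by (intro e(2)) (auto simp: b_def)
    qed
    then show "x \<in> (\<Union>(l, k)\<in>I. b l k)" using l xl by (auto simp: I_def b_def)
  qed
  then have "U = (\<Union>(l, k)\<in>I. b l k)" by (auto simp: I_def)
  then have "g -` U \<inter> space M = (\<Union>(l, k)\<in>I. g -` b l k \<inter> space M)" by blast
  also have "\<dots> \<in> sets M"
  proof (rule sets.countable_UN'')
    show "countable I" by simp
    fix lk assume "lk \<in> I"
    obtain l k where lk: "lk = (l, k)" by force
    have "g -` b l k \<inter> space M = {\<omega> \<in> space M. lpnorm p (\<lambda>n. g \<omega> n - rat_seq l n) < 1 / real (Suc k)}"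
      using g by (auto simp: b_def)
    also have "\<dots> \<in> sets M" unfolding lpnorm_def by measurable
    finally show "(case lk of (l, k) \<Rightarrow> g -` b l k \<inter> space M) \<in> sets M" by (simp add: lk)
  qed
  finally show "g -` U \<inter> space M \<in> sets M" .
qed

lemma Bw_lp:
  assumes "p \<ge> 1" "\<And>n. \<bar>w (Suc n)\<bar> \<le> M" "x \<in> lp p"
  shows "Bw w x \<in> lp p"
proof -
  have s: "summable (\<lambda>n. \<bar>x (Suc n)\<bar> powr p)" using assms(3) by (simp add: lp_def summable_Suc_iff[of "\<lambda>n. \<bar>x n\<bar> powr p"])
  have "(\<lambda>n. M * x (Suc n)) \<in> lp p" using s by (intro lp_scale) (simp add: lp_def)
  then show ?thesis
  proof (rule lp_mono)
    have "\<bar>w (Suc n)\<bar> \<le> \<bar>M\<bar>" for n using assms(2)[of n] by linarith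
    then show "\<bar>Bw w x n\<bar> \<le> \<bar>M * x (Suc n)\<bar>" for n
      unfolding Bw_def abs_mult by (intro mult_right_mono) auto
  qed (use assms(1) in simp)
qed

lemma measurable_coord_lp:
  assumes p: "p \<ge> 1" shows "(\<lambda>x. x n) \<in> borel_measurable (lp_borel p)"
proof (rule lp_continuous_measurable)
  fix x e assume x: "x \<in> lp p" "(e::real) > 0"
  have "\<bar>y n - x n\<bar> \<le> lpnorm p (\<lambda>n. y n - x n)" if y: "y \<in> lp p" for y
  proof -
    have "lpnorm p (\<lambda>i. if i = n then y n - x n else 0) \<le> lpnorm p (\<lambda>n. y n - x n)"
      using p by (intro lpnorm_mono lp_diff y x) auto
    then show ?thesis using p by (simp add: lpnorm_single)
  qed
  then show "\<exists>d>0. \<forall>y\<in>lp p. lpnorm p (\<lambda>n. y n - x n) < d \<longrightarrow> \<bar>y n - x n\<bar> < e"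
    using x(2) by (intro exI[of _ e]) (auto intro: le_less_trans)
qed

lemma Bw_measurable:
  assumes "p \<ge> 1" "\<And>n. \<bar>w (Suc n)\<bar> \<le> M"
  shows "Bw w \<in> measurable (lp_borel p) (lp_borel p)"
proof (rule measurable_lp_borelI[OF assms(1)])
  show "Bw w x \<in> lp p" if "x \<in> space (lp_borel p)" for x
    by (rule Bw_lp[OF assms(1), where w = w and M = M]) (use assms(2) that in auto)
  show "(\<lambda>x. Bw w x n) \<in> borel_measurable (lp_borel p)" for n
    unfolding Bw_def using measurable_coord_lp[OF assms(1), of "Suc n"] by measurable
qed

section \<open>The random vector with independent coordinates\<close>

lemma sets_Collect_summable:
  fixes f :: "nat \<Rightarrow> 'a \<Rightarrow> real"
  assumes [measurable]: "\<And>n. f n \<in> borel_measurable M"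
  shows "{x \<in> space M. summable (\<lambda>n. f n x)} \<in> sets M"
  unfolding summable_iff_convergent Cauchy_convergent_iff[symmetric] by measurable

lemma le_one_plus_powr:
  fixes x p :: real
  assumes "p \<ge> 1" "x \<ge> 0" shows "x \<le> 1 + x powr p"
proof (cases "x \<le> 1")
  case False
  then have "x powr 1 \<le> x powr p" using assms by (intro powr_mono) auto
  then show ?thesis using False by simp
qed (use powr_ge_zero[of x p] in linarith)

definition wprod :: "(nat \<Rightarrow> real) \<Rightarrow> nat \<Rightarrow> real" where
  "wprod w n = (\<Prod>i\<in>{1..n}. w i)"

lemma wprod_0 [simp]: "wprod w 0 = 1"
  by (simp add: wprod_def)

lemma wprod_Suc: "wprod w (Suc n) = wprod w n * w (Suc n)"
  by (simp add: wprod_def)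

text \<open>The constant in \<open>exp_moment\<close> is the one for which Jensen's inequality gives
  a finite expectation of exp(8 ||x||). The fourth moment handles the increment of a resampled
  coordinate after it has been separated from the exponential factor.\<close>

locale random_lp_vector = iid_real +
  fixes p :: real and w :: "nat \<Rightarrow> real" and M :: real
  assumes p: "p \<ge> 1" and w_pos: "\<And>n. n \<ge> 1 \<Longrightarrow> w n > 0" and w_le: "\<And>n. n \<ge> 1 \<Longrightarrow> w n \<le> M"
    and c_summable: "summable (\<lambda>n. wprod w n powr (- p))"
    and exp_moment: "integrable \<nu> (\<lambda>x. exp (8 * (\<Sum>n. wprod w n powr (- p)) * \<bar>x\<bar> powr p))"
    and moment4: "integrable \<nu> (\<lambda>x. x ^ 4)"
    and supp: "\<And>U. open U \<Longrightarrow> U \<noteq> {} \<Longrightarrow> emeasure \<nu> U > 0"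
begin

definition c :: "nat \<Rightarrow> real" where "c n = wprod w n powr (- p)"
definition C0 :: real where "C0 = suminf c"

definition rescale :: "(nat \<Rightarrow> real) \<Rightarrow> nat \<Rightarrow> real" where
  "rescale \<omega> = (\<lambda>n. \<omega> n / wprod w n)"

text \<open>The value on the null set where \<open>rescale\<close> leaves the space is set to zero,
  so that \<open>X\<close> maps every point into \<open>lp p\<close>.\<close>

definition X :: "(nat \<Rightarrow> real) \<Rightarrow> nat \<Rightarrow> real" where
  "X \<omega> = (if rescale \<omega> \<in> lp p then rescale \<omega> else (\<lambda>_. 0))"

definition \<mu> :: "(nat \<Rightarrow> real) measure" where
  "\<mu> = distr S (lp_borel p) X"

lemma wprod_pos: "wprod w n > 0"
  unfolding wprod_def using w_pos by (intro prod_pos) auto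

lemma p_pos: "p > 0" using p by simp

lemma c_sums: "c sums C0" and c_pos: "c n > 0" and C0_pos: "C0 > 0"
proof -
  show "c sums C0" unfolding C0_def using c_summable by (intro summable_sums) (simp add: c_def[abs_def])
  show "c n > 0" for n using wprod_pos[of n] by (simp add: c_def)
  then show "C0 > 0" unfolding C0_def using c_summable by (intro suminf_pos) (auto simp: c_def[abs_def])
qed

lemma powr_rescale: "\<bar>rescale \<omega> n\<bar> powr p = c n * \<bar>\<omega> n\<bar> powr p"
  using wprod_pos[of n] by (simp add: rescale_def c_def abs_divide powr_divide powr_minus field_simps)

lemma X_lp: "X \<omega> \<in> lp p"
  by (simp add: X_def lp_zero)

lemma X_measurable [measurable]: "X \<in> measurable S (lp_borel p)"
proof (rule measurable_lp_borelI[OF p X_lp])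
  have [measurable]: "{\<omega> \<in> space S. summable (\<lambda>n. \<bar>rescale \<omega> n\<bar> powr p)} \<in> sets S"
    unfolding rescale_def by (rule sets_Collect_summable) measurable
  have [measurable]: "Measurable.pred S (\<lambda>\<omega>. rescale \<omega> \<in> lp p)"
    using \<open>{\<omega> \<in> space S. summable (\<lambda>n. \<bar>rescale \<omega> n\<bar> powr p)} \<in> sets S\<close> by (simp add: pred_def lp_def)
  have "X \<omega> n = (if rescale \<omega> \<in> lp p then \<omega> n / wprod w n else 0)" for \<omega> n
    by (simp add: X_def rescale_def)
  then show "(\<lambda>\<omega>. X \<omega> n) \<in> borel_measurable S" for n by simp
qed

lemma rescale_trunc: "rescale (seq_trunc r \<omega>) = seq_trunc r (rescale \<omega>)"
  by (auto simp: rescale_def seq_trunc_def)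

lemma X_trunc: "X (seq_trunc r \<omega>) = seq_trunc r (rescale \<omega>)"
  by (simp add: X_def rescale_trunc lp_trunc)

lemma Bw_rescale: "Bw w (rescale \<omega>) = rescale (seq_shift 1 \<omega>)"
proof
  fix n
  have "w (Suc n) > 0" using w_pos[of "Suc n"] by simp
  then show "Bw w (rescale \<omega>) n = rescale (seq_shift 1 \<omega>) n"
    by (simp add: Bw_def rescale_def seq_shift_def wprod_Suc)
qed

lemma Bw_abs_le: "\<bar>w (Suc n)\<bar> \<le> M"
  using w_pos[of "Suc n"] w_le[of "Suc n"] by simp

text \<open>The converse of \<open>rescale \<omega> \<in> lp p \<Longrightarrow> rescale (seq_shift n \<omega>) \<in> lp p\<close> can fail because the weights may be
  arbitrarily small, so the conjugacy holds only almost everywhere.\<close>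

lemma Bw_pow_X:
  assumes "rescale \<omega> \<in> lp p" shows "(Bw w ^^ n) (X \<omega>) = X (seq_shift n \<omega>)"
proof -
  have "rescale (seq_shift n \<omega>) \<in> lp p \<and> (Bw w ^^ n) (rescale \<omega>) = rescale (seq_shift n \<omega>)"
  proof (induction n)
    case 0
    then show ?case using assms by (simp add: seq_shift_def)
  next
    case (Suc n)
    have e: "seq_shift (Suc n) \<omega> = seq_shift 1 (seq_shift n \<omega>)" by (simp add: seq_shift_def)
    show ?case unfolding e Bw_rescale[symmetric] using Suc Bw_lp[OF p, of w M] Bw_abs_le by simp
  qed
  then show ?thesis using assms by (simp add: X_def)
qed

text \<open>Up to a constant factor, an integrable majorant of exp(8 ||X||) that involves each
  coordinate separately.\<close>

definition env :: "(nat \<Rightarrow> real) \<Rightarrow> real" where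
  "env \<omega> = (\<Sum>n. c n * exp (8 * C0 * \<bar>\<omega> n\<bar> powr p))"

lemma exp_moment': "integrable \<nu> (\<lambda>x. exp (8 * C0 * \<bar>x\<bar> powr p))"
  using exp_moment by (simp add: C0_def c_def[abs_def])

text \<open>By Tonelli and the common law of the coordinates the expected series is a multiple of
  the sum of the \<open>c n\<close>, hence finite.\<close>

lemma env_summable: "AE \<omega> in S. summable (\<lambda>n. c n * exp (8 * C0 * \<bar>\<omega> n\<bar> powr p))"
  and env_integrable: "integrable S env"
proof -
  let ?h = "\<lambda>x. exp (8 * C0 * \<bar>x\<bar> powr p)"
  define m where "m = (\<integral>x. ?h x \<partial>\<nu>)"
  have i: "integrable S (\<lambda>\<omega>. c n * ?h (\<omega> n))" for n
    by (intro integrable_mult_right meas_pres_integrable[OF meas_pres_coord exp_moment'])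
  have ie: "(\<integral>\<omega>. c n * ?h (\<omega> n) \<partial>S) = c n * m" for n
    using meas_pres_integral[OF meas_pres_coord[where i = n], of ?h] exp_moment' by (simp add: m_def)
  have "(\<integral>\<^sup>+\<omega>. (\<Sum>n. ennreal (c n * ?h (\<omega> n))) \<partial>S) = (\<Sum>n. \<integral>\<^sup>+\<omega>. ennreal (c n * ?h (\<omega> n)) \<partial>S)"
    by (intro nn_integral_suminf) measurable
  also have "\<dots> = (\<Sum>n. ennreal (c n * m))"
    using i c_pos unfolding ie[symmetric]
    by (intro suminf_cong nn_integral_eq_integral) (auto simp: less_imp_le)
  also have "\<dots> = ennreal (\<Sum>n. c n * m)"
    using c_pos sums_summable[OF sums_mult2[OF c_sums]]
    by (intro suminf_ennreal2) (auto simp: m_def less_imp_le)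
  finally have "(\<integral>\<^sup>+\<omega>. (\<Sum>n. ennreal (c n * ?h (\<omega> n))) \<partial>S) \<noteq> \<infinity>" by simp
  then have "AE \<omega> in S. (\<Sum>n. ennreal (c n * ?h (\<omega> n))) \<noteq> \<infinity>"
    by (intro nn_integral_PInf_AE) auto
  then show s: "AE \<omega> in S. summable (\<lambda>n. c n * ?h (\<omega> n))"
    by eventually_elim (use c_pos in \<open>auto intro!: summable_suminf_not_top simp: less_imp_le\<close>)
  show "integrable S env"
    unfolding env_def[abs_def]
  proof (rule integrable_suminf[OF i])
    show "AE \<omega> in S. summable (\<lambda>n. norm (c n * ?h (\<omega> n)))"
      using s by eventually_elim (use c_pos in \<open>simp add: abs_mult less_imp_le\<close>)
    have "(\<integral>\<omega>. norm (c n * ?h (\<omega> n)) \<partial>S) = c n * m" for n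
      using c_pos[of n] ie[of n] by (simp add: abs_mult less_imp_le)
    then show "summable (\<lambda>n. \<integral>\<omega>. norm (c n * ?h (\<omega> n)) \<partial>S)"
      using sums_summable[OF sums_mult2[OF c_sums]] by simp
  qed
qed

text \<open>This is Jensen's inequality for the probability weights \<open>c n / C0\<close>.\<close>

lemma exp_lpnorm_le_env:
  assumes s: "summable (\<lambda>n. c n * exp (8 * C0 * \<bar>\<omega> n\<bar> powr p))"
  shows "rescale \<omega> \<in> lp p" and "exp (8 * lpnorm p (X \<omega>)) \<le> exp 8 / C0 * env \<omega>"
proof -
  define y where "y n = 8 * C0 * \<bar>\<omega> n\<bar> powr p" for n
  have y0: "y n \<ge> 0" for n using C0_pos by (simp add: y_def)
  have sy: "summable (\<lambda>n. c n * y n)"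
  proof (rule summable_comparison_test'[OF s[folded y_def], of 0])
    fix n
    have "y n \<le> exp (y n)" using exp_ge_add_one_self[of "y n"] by linarith
    then show "norm (c n * y n) \<le> c n * exp (y n)"
      using c_pos[of n] y0[of n] by (simp add: abs_mult less_imp_le)
  qed
  have cy: "c n * y n = 8 * C0 * \<bar>rescale \<omega> n\<bar> powr p" for n by (simp add: y_def powr_rescale)
  then have s1: "summable (\<lambda>n. \<bar>rescale \<omega> n\<bar> powr p)"
    using sy C0_pos by (simp add: summable_cmult_iff)
  then show r: "rescale \<omega> \<in> lp p" by (simp add: lp_def)
  define V where "V = 8 * lpnorm p (X \<omega>) powr p"
  have V: "(\<lambda>n. c n * y n) sums (C0 * V)"
    using sums_mult[OF summable_sums[OF s1], of "8 * C0"] lpnorm_powr[OF p_pos r] r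
    unfolding cy V_def X_def by (simp add: mult_ac)
  \<comment> \<open>\<open>V\<close> is the mean of the \<open>y n\<close> under the weights c n /
    C0. The tangent line of exp at \<open>V\<close> lies below exp; summed against \<open>c\<close>
    it collapses to C0 exp V.\<close>
  have "(\<lambda>n. exp V * ((1 - V) * c n + c n * y n)) sums (exp V * ((1 - V) * C0 + C0 * V))"
    by (intro sums_mult sums_add c_sums V)
  moreover have "exp V * ((1 - V) * c n + c n * y n) \<le> c n * exp (y n)" for n
  proof -
    have "exp V * (1 + (y n - V)) \<le> exp V * exp (y n - V)"
      using exp_ge_add_one_self[of "y n - V"] by (intro mult_left_mono) auto
    also have "\<dots> = exp (y n)" by (simp flip: exp_add)
    finally have "c n * (exp V * (1 + (y n - V))) \<le> c n * exp (y n)"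
      using c_pos[of n] by (intro mult_left_mono) auto
    then show ?thesis by (simp add: algebra_simps)
  qed
  ultimately have "exp V * ((1 - V) * C0 + C0 * V) \<le> env \<omega>"
    unfolding env_def y_def[symmetric] by (intro sums_le[OF _ _ summable_sums[OF s[folded y_def]]]) auto
  then have "exp V \<le> env \<omega> / C0" using C0_pos by (simp add: field_simps)
  \<comment> \<open>The norm is at most 1 plus its p-th power, which costs the factor exp 8.\<close>
  moreover have "exp (8 * lpnorm p (X \<omega>)) \<le> exp (8 + V)"
    using le_one_plus_powr[OF p lpnorm_nonneg, of p "X \<omega>"] by (simp add: V_def)
  ultimately have "exp (8 * lpnorm p (X \<omega>)) \<le> exp 8 * (env \<omega> / C0)"
    unfolding exp_add by (meson exp_ge_zero mult_left_mono order_trans)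
  then show "exp (8 * lpnorm p (X \<omega>)) \<le> exp 8 / C0 * env \<omega>" by simp
qed

lemma AE_rescale_lp: "AE \<omega> in S. rescale \<omega> \<in> lp p"
  using env_summable by eventually_elim (rule exp_lpnorm_le_env(1))

lemma lpnorm_X_measurable [measurable]: "(\<lambda>\<omega>. lpnorm p (X \<omega>)) \<in> borel_measurable S"
  by (rule measurable_compose[OF X_measurable lpnorm_measurable[OF p]])

lemma exp8_integrable: "integrable S (\<lambda>\<omega>. exp (8 * lpnorm p (X \<omega>)))"
proof (rule Bochner_Integration.integrable_bound)
  show "integrable S (\<lambda>\<omega>. exp 8 / C0 * env \<omega>)" using env_integrable by simp
  show "AE \<omega> in S. norm (exp (8 * lpnorm p (X \<omega>))) \<le> norm (exp 8 / C0 * env \<omega>)"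
    using env_summable
  proof eventually_elim
    case (elim \<omega>)
    have "norm (exp (8 * lpnorm p (X \<omega>))) = exp (8 * lpnorm p (X \<omega>))" by simp
    also have "\<dots> \<le> exp 8 / C0 * env \<omega>" by (rule exp_lpnorm_le_env(2)[OF elim])
    also have "\<dots> \<le> norm (exp 8 / C0 * env \<omega>)" unfolding real_norm_def by (rule abs_ge_self)
    finally show ?case .
  qed
qed measurable

lemma exp2_integrable: "integrable S (\<lambda>\<omega>. exp (2 * lpnorm p (X \<omega>)))"
  by (rule Bochner_Integration.integrable_bound[OF exp8_integrable])
     (auto intro!: always_eventually simp: lpnorm_nonneg)

lemma lpnorm_X_trunc_le: "rescale \<omega> \<in> lp p \<Longrightarrow> lpnorm p (X (seq_trunc r \<omega>)) \<le> lpnorm p (X \<omega>)"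
  unfolding X_trunc using lpnorm_trunc_le[OF _ p_pos] by (simp add: X_def)

section \<open>Exponentially Lipschitz functions of the random vector\<close>

context
  fixes f K assumes f: "exp_lipschitz p f K"
begin

lemma f_le: "\<bar>f (X \<omega>)\<bar> \<le> K * exp (lpnorm p (X \<omega>))" and K_nonneg: "K \<ge> 0"
  using f X_lp by (auto simp: exp_lipschitz_def)

lemma f_diff_le:
  "lpnorm p (X \<omega>) \<le> R \<Longrightarrow> lpnorm p (X \<omega>') \<le> R \<Longrightarrow>
    \<bar>f (X \<omega>) - f (X \<omega>')\<bar> \<le> K * lpnorm p (\<lambda>n. X \<omega> n - X \<omega>' n) * exp R"
  using f X_lp by (auto simp: exp_lipschitz_def)

lemma fX_measurable [measurable]: "(\<lambda>\<omega>. f (X \<omega>)) \<in> borel_measurable S"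
  by (rule measurable_compose[OF X_measurable exp_lipschitz_measurable[OF p f]])

lemma fX_square_le:
  assumes "rescale \<omega> \<in> lp p"
  shows "(f (X (seq_trunc r \<omega>)))\<^sup>2 \<le> K\<^sup>2 * exp (2 * lpnorm p (X \<omega>))"
    and "(f (X \<omega>))\<^sup>2 \<le> K\<^sup>2 * exp (2 * lpnorm p (X \<omega>))"
proof -
  have *: "(f (X \<omega>'))\<^sup>2 \<le> K\<^sup>2 * exp (2 * lpnorm p (X \<omega>))" if "lpnorm p (X \<omega>') \<le> lpnorm p (X \<omega>)" for \<omega>'
  proof -
    have "\<bar>f (X \<omega>')\<bar> \<le> K * exp (lpnorm p (X \<omega>))"
      using f_le[of \<omega>'] mult_left_mono[OF _ K_nonneg, of "exp (lpnorm p (X \<omega>'))" "exp (lpnorm p (X \<omega>))"] that by simp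
    then have "(f (X \<omega>'))\<^sup>2 \<le> (K * exp (lpnorm p (X \<omega>)))\<^sup>2" by (rule abs_le_square_iff[THEN iffD1, OF order_trans]) simp
    then show ?thesis by (simp add: power_mult_distrib exp_double)
  qed
  show "(f (X (seq_trunc r \<omega>)))\<^sup>2 \<le> K\<^sup>2 * exp (2 * lpnorm p (X \<omega>))"
    using assms by (intro * lpnorm_X_trunc_le)
  show "(f (X \<omega>))\<^sup>2 \<le> K\<^sup>2 * exp (2 * lpnorm p (X \<omega>))" by (intro *) simp
qed

lemma fX_sq_int: "sq_int S (\<lambda>\<omega>. f (X \<omega>))" and fX_trunc_sq_int: "sq_int S (\<lambda>\<omega>. f (X (seq_trunc r \<omega>)))"
proof -
  have b: "integrable S (\<lambda>\<omega>. K\<^sup>2 * exp (2 * lpnorm p (X \<omega>)))" using exp2_integrable by simp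
  show "sq_int S (\<lambda>\<omega>. f (X \<omega>))"
    unfolding sq_int_def
  proof (intro conjI fX_measurable Bochner_Integration.integrable_bound[OF b])
    show "AE \<omega> in S. norm ((f (X \<omega>))\<^sup>2) \<le> norm (K\<^sup>2 * exp (2 * lpnorm p (X \<omega>)))"
      using AE_rescale_lp by eventually_elim (use fX_square_le in simp)
  qed measurable
  have [measurable]: "(\<lambda>\<omega>. f (X (seq_trunc r \<omega>))) \<in> borel_measurable S"
    by (rule measurable_compose[OF seq_trunc_measurable fX_measurable])
  show "sq_int S (\<lambda>\<omega>. f (X (seq_trunc r \<omega>)))"
    unfolding sq_int_def
  proof (intro conjI Bochner_Integration.integrable_bound[OF b])
    show "AE \<omega> in S. norm ((f (X (seq_trunc r \<omega>)))\<^sup>2) \<le> norm (K\<^sup>2 * exp (2 * lpnorm p (X \<omega>)))"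
      using AE_rescale_lp by eventually_elim (use fX_square_le in simp)
  qed measurable
qed

text \<open>Truncation does not increase the norm, so all truncated values share the majorant in
  exp(2 ||X||). Pointwise convergence is the Lipschitz bound combined with convergence of
  truncations in the space.\<close>

lemma fX_approximable: "approximable (\<lambda>\<omega>. f (X \<omega>))"
  unfolding approximable_def
proof (intro conjI allI fX_sq_int fX_trunc_sq_int)
  have [measurable]: "(\<lambda>\<omega>. f (X (seq_trunc r \<omega>))) \<in> borel_measurable S" for r
    by (rule measurable_compose[OF seq_trunc_measurable fX_measurable])
  have "(\<lambda>r. \<integral>\<omega>. (f (X \<omega>) - f (X (seq_trunc r \<omega>)))\<^sup>2 \<partial>S) \<longlonglongrightarrow> (\<integral>\<omega>. 0 \<partial>S)"
  proof (rule integral_dominated_convergence[where w = "\<lambda>\<omega>. 4 * (K\<^sup>2 * exp (2 * lpnorm p (X \<omega>)))"])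
    show "integrable S (\<lambda>\<omega>. 4 * (K\<^sup>2 * exp (2 * lpnorm p (X \<omega>))))" using exp2_integrable by simp
    show "AE \<omega> in S. norm ((f (X \<omega>) - f (X (seq_trunc r \<omega>)))\<^sup>2) \<le> 4 * (K\<^sup>2 * exp (2 * lpnorm p (X \<omega>)))" for r
      using AE_rescale_lp
    proof eventually_elim
      case (elim \<omega>)
      have "(a - b)\<^sup>2 \<le> 2 * a\<^sup>2 + 2 * b\<^sup>2" for a b :: real
        using zero_le_power2[of "a + b"] by (simp add: power2_sum power2_diff)
      from this[of "f (X \<omega>)" "f (X (seq_trunc r \<omega>))"] fX_square_le(1)[OF elim, of r] fX_square_le(2)[OF elim] show ?case by simp
    qed
    show "AE \<omega> in S. (\<lambda>r. (f (X \<omega>) - f (X (seq_trunc r \<omega>)))\<^sup>2) \<longlonglongrightarrow> 0"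
      using AE_rescale_lp
    proof eventually_elim
      case (elim \<omega>)
      have lim: "(\<lambda>r. K * lpnorm p (\<lambda>n. rescale \<omega> n - seq_trunc r (rescale \<omega>) n) * exp (lpnorm p (X \<omega>))) \<longlonglongrightarrow> 0"
        by (intro tendsto_mult_left_zero tendsto_mult_right_zero lpnorm_trunc_tendsto[OF elim p_pos])
      have "(\<lambda>r. f (X \<omega>) - f (X (seq_trunc r \<omega>))) \<longlonglongrightarrow> 0"
      proof (rule Lim_null_comparison[OF always_eventually lim], rule allI)
        fix r
        show "norm (f (X \<omega>) - f (X (seq_trunc r \<omega>))) \<le> K * lpnorm p (\<lambda>n. rescale \<omega> n - seq_trunc r (rescale \<omega>) n) * exp (lpnorm p (X \<omega>))"
          using f_diff_le[OF order_refl lpnorm_X_trunc_le[OF elim], of r] elim unfolding X_trunc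
          by (simp add: X_def)
      qed
      from tendsto_power[OF this, of 2] show ?case by simp
    qed
  qed measurable
  from tendsto_real_sqrt[OF this] show "(\<lambda>N. l2norm S (\<lambda>\<omega>. f (X \<omega>) - f (X (seq_trunc N \<omega>)))) \<longlonglongrightarrow> 0"
    by (simp add: l2norm_def)
qed

end

text \<open>The L^2 norm of the majorant used next: the fourth moment counts 8 for each of the two
  copies, and the exponential moment once for each copy.\<close>

definition infl :: real where
  "infl = sqrt (16 * (\<integral>x. x ^ 4 \<partial>\<nu>) + 2 * (\<integral>\<omega>. exp (8 * lpnorm p (X \<omega>)) \<partial>S))"

text \<open>The increment d of the resampled coordinate and the norm bound R are not independent.
  They are separated by d^2 exp(2R) \<le> d^4 + exp(4R), after which d^4 is bounded by fourth powers
  of the two copies and exp(4R) by the sum of the exponential bounds at the two points.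
  \<open>H\<close> is left general to cover both the functional and its truncations.\<close>

lemma influence_le_infl:
  assumes H: "sq_int S H" and K: "K \<ge> 0"
    and le: "\<And>z R. rescale (hybrid {} z) \<in> lp p \<Longrightarrow> rescale (hybrid {k} z) \<in> lp p \<Longrightarrow> lpnorm p (X (hybrid {} z)) \<le> R
        \<Longrightarrow> lpnorm p (X (hybrid {k} z)) \<le> R
        \<Longrightarrow> \<bar>H (hybrid {} z) - H (hybrid {k} z)\<bar> \<le> K * (\<bar>z (k, False) - z (k, True)\<bar> / wprod w k) * exp R"
  shows "influence k H \<le> K * infl / wprod w k"
proof -
  let ?a = "\<lambda>z. lpnorm p (X (hybrid {} z))" and ?b = "\<lambda>z. lpnorm p (X (hybrid {k} z))"
  let ?U = "\<lambda>z. 8 * (z (k, False) ^ 4 + z (k, True) ^ 4) + (exp (8 * ?a z) + exp (8 * ?b z))"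
  have e8: "integrable RR (\<lambda>z. exp (8 * lpnorm p (X (hybrid A z))))"
    "(\<integral>z. exp (8 * lpnorm p (X (hybrid A z))) \<partial>RR) = (\<integral>\<omega>. exp (8 * lpnorm p (X \<omega>)) \<partial>S)" for A
    by (rule meas_pres_integrable[OF meas_pres_hybrid exp8_integrable]) (rule meas_pres_integral[OF meas_pres_hybrid], measurable)
  have m4: "integrable RR (\<lambda>z. z i ^ 4)" "(\<integral>z. z i ^ 4 \<partial>RR) = (\<integral>x. x ^ 4 \<partial>\<nu>)" for i
    using meas_pres_integrable[OF meas_pres_coord[where i = i] moment4] meas_pres_integral[OF meas_pres_coord[where i = i] borel_measurable_integrable[OF moment4]] by simp_all
  have U: "integrable RR ?U" "(\<integral>z. ?U z \<partial>RR) = infl\<^sup>2"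
  proof -
    show "integrable RR ?U" using e8(1) m4(1) by simp
    have "infl\<^sup>2 = 16 * (\<integral>x. x ^ 4 \<partial>\<nu>) + 2 * (\<integral>\<omega>. exp (8 * lpnorm p (X \<omega>)) \<partial>S)"
      unfolding infl_def by (intro real_sqrt_pow2 add_nonneg_nonneg mult_nonneg_nonneg integral_nonneg_AE) auto
    then show "(\<integral>z. ?U z \<partial>RR) = infl\<^sup>2" using e8 m4 by simp
  qed
  have sq: "(H (hybrid {} z) - H (hybrid {k} z))\<^sup>2 \<le> (K / wprod w k)\<^sup>2 * ?U z"
    if good: "rescale (hybrid {} z) \<in> lp p" "rescale (hybrid {k} z) \<in> lp p" for z
  proof -
    define R where "R = max (?a z) (?b z)"
    have R0: "R \<ge> 0" using lpnorm_nonneg[of p] by (simp add: R_def le_max_iff_disj)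
    define d where "d = z (k, False) - z (k, True)"
    have "\<bar>H (hybrid {} z) - H (hybrid {k} z)\<bar> \<le> K * (\<bar>d\<bar> / wprod w k) * exp R"
      unfolding d_def using good by (intro le) (auto simp: R_def)
    then have "(H (hybrid {} z) - H (hybrid {k} z))\<^sup>2 \<le> (K * (\<bar>d\<bar> / wprod w k) * exp R)\<^sup>2"
      by (metis abs_ge_zero power2_abs power_mono)
    also have "\<dots> = (K / wprod w k)\<^sup>2 * (d\<^sup>2 * exp (2 * R))"
      by (simp add: power_mult_distrib power_divide exp_double)
    also have "\<dots> \<le> (K / wprod w k)\<^sup>2 * ?U z"
    proof (intro mult_left_mono)
      have "d\<^sup>2 * exp (2 * R) \<le> (d\<^sup>2)\<^sup>2 + (exp (2 * R))\<^sup>2"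
        using sum_squares_bound[of "d\<^sup>2" "exp (2 * R)"] mult_nonneg_nonneg[of "d\<^sup>2" "exp (2 * R)", OF zero_le_power2 exp_ge_zero]
        unfolding mult.assoc by linarith
      also have "(exp (2 * R))\<^sup>2 \<le> exp (8 * R)"
        using R0 by (simp flip: exp_double)
      also have "exp (8 * R) \<le> exp (8 * ?a z) + exp (8 * ?b z)"
        by (simp add: R_def max_def)
      also have "(d\<^sup>2)\<^sup>2 \<le> 8 * (z (k, False) ^ 4 + z (k, True) ^ 4)"
      proof -
        have q: "(a + b)\<^sup>2 \<le> 2 * a\<^sup>2 + 2 * b\<^sup>2" for a b :: real
          using zero_le_power2[of "a - b"] by (simp add: power2_sum power2_diff)
        have "d\<^sup>2 \<le> 2 * (z (k, False))\<^sup>2 + 2 * (z (k, True))\<^sup>2"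
          using q[of "z (k, False)" "- z (k, True)"] by (simp add: d_def)
        then have "(d\<^sup>2)\<^sup>2 \<le> (2 * (z (k, False))\<^sup>2 + 2 * (z (k, True))\<^sup>2)\<^sup>2" by (intro power_mono) auto
        also have "\<dots> \<le> 2 * (2 * (z (k, False))\<^sup>2)\<^sup>2 + 2 * (2 * (z (k, True))\<^sup>2)\<^sup>2" by (rule q)
        finally show ?thesis by (simp add: power_mult_distrib flip: power_mult)
      qed
      finally show "d\<^sup>2 * exp (2 * R) \<le> ?U z" by simp
    qed simp
    finally show ?thesis .
  qed
  have "(influence k H)\<^sup>2 = (\<integral>z. (H (hybrid {} z) - H (hybrid {k} z))\<^sup>2 \<partial>RR)" by (simp add: influence_def l2norm_power2)
  also have "\<dots> \<le> (\<integral>z. (K / wprod w k)\<^sup>2 * ?U z \<partial>RR)"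
  proof (rule integral_mono_AE)
    show "integrable RR (\<lambda>z. (H (hybrid {} z) - H (hybrid {k} z))\<^sup>2)"
      using sq_int_diff[OF sq_int_hybrid[OF H] sq_int_hybrid[OF H]] unfolding sq_int_def by blast
    show "integrable RR (\<lambda>z. (K / wprod w k)\<^sup>2 * ?U z)" using U(1) by (rule integrable_mult_right)
    show "AE z in RR. (H (hybrid {} z) - H (hybrid {k} z))\<^sup>2 \<le> (K / wprod w k)\<^sup>2 * ?U z"
      using meas_pres_AE[OF meas_pres_hybrid[of "{}"] AE_rescale_lp] meas_pres_AE[OF meas_pres_hybrid[of "{k}"] AE_rescale_lp]
      by eventually_elim (rule sq)
  qed
  also have "\<dots> = (K / wprod w k)\<^sup>2 * infl\<^sup>2"
    using U by (simp only: integral_mult_right_zero)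
  also have "\<dots> = (K * infl / wprod w k)\<^sup>2" by (simp add: power_mult_distrib power_divide)
  finally show ?thesis
    by (rule power2_le_imp_le) (use K wprod_pos[of k] in \<open>simp add: infl_def less_imp_le integral_nonneg_AE\<close>)
qed

lemma rescale_hybrid_diff:
  "rescale (hybrid {} z) n - rescale (hybrid {k} z) n = (if n = k then (z (k, False) - z (k, True)) / wprod w k else 0)"
  by (simp add: rescale_def hybrid_def diff_divide_distrib)

lemma influence_fX_le:
  assumes f: "exp_lipschitz p f K"
  shows "influence k (\<lambda>\<omega>. f (X \<omega>)) \<le> K * infl / wprod w k"
    and "influence k (\<lambda>\<omega>. f (X (seq_trunc r \<omega>))) \<le> K * infl / wprod w k"
proof -
  show "influence k (\<lambda>\<omega>. f (X \<omega>)) \<le> K * infl / wprod w k"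
  proof (rule influence_le_infl[OF fX_sq_int[OF f] K_nonneg[OF f]])
    fix z R assume good: "rescale (hybrid {} z) \<in> lp p" "rescale (hybrid {k} z) \<in> lp p"
      and R: "lpnorm p (X (hybrid {} z)) \<le> R" "lpnorm p (X (hybrid {k} z)) \<le> R"
    have "(\<lambda>n. X (hybrid {} z) n - X (hybrid {k} z) n) = (\<lambda>n. if n = k then (z (k, False) - z (k, True)) / wprod w k else 0)"
      using good rescale_hybrid_diff[of z _ k] by (simp add: X_def)
    then have "lpnorm p (\<lambda>n. X (hybrid {} z) n - X (hybrid {k} z) n) = \<bar>z (k, False) - z (k, True)\<bar> / wprod w k"
      using wprod_pos[of k] by (simp add: lpnorm_single[OF p_pos])
    then show "\<bar>f (X (hybrid {} z)) - f (X (hybrid {k} z))\<bar> \<le> K * (\<bar>z (k, False) - z (k, True)\<bar> / wprod w k) * exp R"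
      using f_diff_le[OF f R] by simp
  qed
  show "influence k (\<lambda>\<omega>. f (X (seq_trunc r \<omega>))) \<le> K * infl / wprod w k"
  proof (rule influence_le_infl[OF fX_trunc_sq_int[OF f] K_nonneg[OF f]])
    fix z R assume good: "rescale (hybrid {} z) \<in> lp p" "rescale (hybrid {k} z) \<in> lp p"
      and R: "lpnorm p (X (hybrid {} z)) \<le> R" "lpnorm p (X (hybrid {k} z)) \<le> R"
    have R': "lpnorm p (X (seq_trunc r (hybrid {} z))) \<le> R" "lpnorm p (X (seq_trunc r (hybrid {k} z))) \<le> R"
      using lpnorm_X_trunc_le[OF good(1), of r] lpnorm_X_trunc_le[OF good(2), of r] R by linarith+
    \<comment> \<open>Only an inequality: for k \<ge> r the truncation removes the one coordinate in
      which the two points differ.\<close>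
    have "lpnorm p (\<lambda>n. X (seq_trunc r (hybrid {} z)) n - X (seq_trunc r (hybrid {k} z)) n)
        \<le> lpnorm p (\<lambda>n. if n = k then (z (k, False) - z (k, True)) / wprod w k else 0)"
      unfolding X_trunc rescale_hybrid_diff[symmetric]
      by (intro lpnorm_mono lp_diff good p p_pos) (auto simp: seq_trunc_def)
    also have "\<dots> = \<bar>z (k, False) - z (k, True)\<bar> / wprod w k"
      using wprod_pos[of k] by (simp add: lpnorm_single[OF p_pos])
    finally have "K * lpnorm p (\<lambda>n. X (seq_trunc r (hybrid {} z)) n - X (seq_trunc r (hybrid {k} z)) n) * exp R
        \<le> K * (\<bar>z (k, False) - z (k, True)\<bar> / wprod w k) * exp R"
      using K_nonneg[OF f] by (intro mult_right_mono mult_left_mono) auto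
    then show "\<bar>f (X (seq_trunc r (hybrid {} z))) - f (X (seq_trunc r (hybrid {k} z)))\<bar> \<le> K * (\<bar>z (k, False) - z (k, True)\<bar> / wprod w k) * exp R"
      using f_diff_le[OF f R'] by linarith
  qed
qed

end

section \<open>Decay of convolutions of weights\<close>

text \<open>The mean value theorem stands in for comparison with an integral. The factor 1 - a
  carries the sign, so the same identity serves partial sums for a < 1 and tails for a > 1.\<close>

lemma powr_increment:
  fixes x a :: real
  assumes "x > 0"
  obtains z where "x < z" "z < x + 1" "(x + 1) powr (1 - a) - x powr (1 - a) = (1 - a) * z powr (- a)"
proof -
  have "\<exists>z>x. z < x + 1 \<and> (x + 1) powr (1 - a) - x powr (1 - a) = (x + 1 - x) * ((1 - a) * z powr (1 - a - 1))"
    using assms by (intro MVT2 has_real_derivative_powr) auto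
  then show thesis using that by auto
qed

lemma sum_powr_minus_le:
  assumes "0 \<le> a" "a < 1"
  shows "(\<Sum>j<n. real (Suc j) powr (- a)) \<le> real n powr (1 - a) / (1 - a)"
proof (induction n)
  case (Suc n)
  show ?case
  proof (cases "n = 0")
    case True
    then show ?thesis using assms by simp
  next
    case False
    then obtain z where z: "real n < z" "z < real n + 1"
      "(real n + 1) powr (1 - a) - real n powr (1 - a) = (1 - a) * z powr (- a)"
      using powr_increment[of "real n" a] by auto
    have "(real n + 1) powr (- a) \<le> z powr (- a)"
      using z assms by (intro powr_mono2') auto
    also have "\<dots> = ((real n + 1) powr (1 - a) - real n powr (1 - a)) / (1 - a)"
      using z(3) assms by simp
    finally show ?thesis using Suc by (simp add: diff_divide_distrib add.commute)
  qed
qed simp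

lemma sum_inverse_le: "(\<Sum>j<n. real (Suc j) powr (- 1)) \<le> 1 + ln (real n)" if "n \<ge> 1"
  using that
proof (induction n rule: nat_induct_at_least)
  case (Suc n)
  have "ln (real n / (real n + 1)) \<le> real n / (real n + 1) - 1"
    using Suc by (intro ln_le_minus_one) auto
  also have "\<dots> = - (1 / (real n + 1))" by (simp add: field_simps)
  finally have "1 / (real n + 1) \<le> ln (real n + 1) - ln (real n)" using Suc by (simp add: ln_div)
  then show ?case using Suc by (simp add: powr_minus_divide add.commute)
qed simp

lemma sum_tail_powr_minus_le:
  assumes "s > 1" "n \<ge> 1"
  shows "(\<Sum>j<m. real (Suc (n + j)) powr (- s)) \<le> real n powr (1 - s) / (s - 1)"
proof -
  have "(\<Sum>j<m. real (Suc (n + j)) powr (- s)) \<le> (real n powr (1 - s) - real (n + m) powr (1 - s)) / (s - 1)"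
  proof (induction m)
    case (Suc m)
    obtain z where z: "real (n + m) < z" "z < real (n + m) + 1"
      "(real (n + m) + 1) powr (1 - s) - real (n + m) powr (1 - s) = (1 - s) * z powr (- s)"
      using powr_increment[of "real (n + m)" s] assms by auto
    have "(real (n + m) + 1) powr (- s) \<le> z powr (- s)"
      using z assms by (intro powr_mono2') auto
    also have "\<dots> = (real (n + m) powr (1 - s) - (real (n + m) + 1) powr (1 - s)) / (s - 1)"
      using z(3) assms by (simp add: field_simps)
    finally have "real (Suc (n + m)) powr (- s) \<le> (real (n + m) powr (1 - s) - real (n + Suc m) powr (1 - s)) / (s - 1)"
      by (simp add: add_ac)
    then show ?case using Suc by (simp add: diff_divide_distrib)
  qed simp
  also have "\<dots> \<le> real n powr (1 - s) / (s - 1)"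
    using assms by (intro divide_right_mono) auto
  finally show ?thesis .
qed

text \<open>Split at j = n. Below, the second factor is at most n^(-a). From there on both factors
  are at most (j + 1)^(-a), which leaves a tail with exponent 2a > 1.\<close>

lemma sum_convolution_split_le:
  assumes "a > 1/2" "n \<ge> 1"
  shows "(\<Sum>j<m. real (Suc j) powr (- a) * real (Suc j + n) powr (- a))
    \<le> (\<Sum>j<n. real (Suc j) powr (- a)) * real n powr (- a) + real n powr (1 - 2 * a) / (2 * a - 1)"
proof -
  let ?u = "\<lambda>j. real (Suc j) powr (- a) * real (Suc j + n) powr (- a)"
  \<comment> \<open>Extending the range by n terms makes the split at n possible for every
    m.\<close>
  have "(\<Sum>j<m. ?u j) \<le> (\<Sum>j<n + m. ?u j)"
    by (intro sum_mono2) auto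
  also have "\<dots> = (\<Sum>j<n. ?u j) + (\<Sum>j<m. ?u (n + j))"
    by (induction m) auto
  also have "(\<Sum>j<n. ?u j) \<le> (\<Sum>j<n. real (Suc j) powr (- a) * real n powr (- a))"
    using assms by (intro sum_mono mult_left_mono powr_mono2') auto
  also have "\<dots> = (\<Sum>j<n. real (Suc j) powr (- a)) * real n powr (- a)"
    by (rule sum_distrib_right[symmetric])
  also have "(\<Sum>j<m. ?u (n + j)) \<le> (\<Sum>j<m. real (Suc (n + j)) powr (- (2 * a)))"
  proof (intro sum_mono)
    fix j
    have "?u (n + j) \<le> real (Suc (n + j)) powr (- a) * real (Suc (n + j)) powr (- a)"
      using assms by (intro mult_left_mono powr_mono2') auto
    also have "\<dots> = real (Suc (n + j)) powr (- (2 * a))" by (simp flip: powr_add)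
    finally show "?u (n + j) \<le> real (Suc (n + j)) powr (- (2 * a))" .
  qed
  also have "\<dots> \<le> real n powr (1 - 2 * a) / (2 * a - 1)"
    using assms by (intro sum_tail_powr_minus_le) auto
  finally show ?thesis by simp
qed

text \<open>For a < 1 both parts of the split are of order n^(1 - 2a); for a = 1 the partial
  harmonic sum produces the logarithm; for a > 1 the first factor is summable and bounding the
  second by n^(-a) throughout is enough. The bound on n^(-a) itself is for the term of index 0 in
  the application.\<close>

lemma convolution_decay:
  assumes a: "a > 1/2"
  obtains K where "K \<ge> 0"
    and "\<And>n. n \<ge> 1 \<Longrightarrow> real n powr (- a) \<le> K * decay_rate a n"
    and "\<And>n m. n \<ge> 1 \<Longrightarrow> (\<Sum>j<m. real (Suc j) powr (- a) * real (Suc j + n) powr (- a)) \<le> K * decay_rate a n"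
proof -
  consider "a < 1" | "a = 1" | "a > 1" by linarith
  then show thesis
  proof cases
    case 1
    define K where "K = 1 + 1 / (1 - a) + 1 / (2 * a - 1)"
    have K: "K \<ge> 1" using a 1 by (simp add: K_def)
    have d: "decay_rate a n = real n powr (1 - 2 * a)" for n using 1 by (simp add: decay_rate_def)
    show thesis
    proof (rule that[of K])
      show "K \<ge> 0" using K by simp
      fix n :: nat assume n: "n \<ge> 1"
      have "real n powr (- a) \<le> 1 * real n powr (1 - 2 * a)" using n 1 by (simp add: powr_mono)
      also have "\<dots> \<le> K * real n powr (1 - 2 * a)" using K by (intro mult_right_mono) auto
      finally show "real n powr (- a) \<le> K * decay_rate a n" by (simp add: d)
      fix m
      have "(\<Sum>j<n. real (Suc j) powr (- a)) * real n powr (- a) \<le> real n powr (1 - a) / (1 - a) * real n powr (- a)"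
        using a 1 by (intro mult_right_mono sum_powr_minus_le) auto
      also have "\<dots> = real n powr (1 - 2 * a) / (1 - a)" by (simp flip: powr_add)
      finally have "(\<Sum>j<m. real (Suc j) powr (- a) * real (Suc j + n) powr (- a))
          \<le> real n powr (1 - 2 * a) / (1 - a) + real n powr (1 - 2 * a) / (2 * a - 1)"
        using sum_convolution_split_le[OF a n, of m] by linarith
      also have "\<dots> \<le> K * real n powr (1 - 2 * a)" by (simp add: K_def algebra_simps)
      finally show "(\<Sum>j<m. real (Suc j) powr (- a) * real (Suc j + n) powr (- a)) \<le> K * decay_rate a n"
        by (simp add: d)
    qed
  next
    case 2
    \<comment> \<open>For n \<ge> 1 the quotient ln(n + 1) / ln 2 is at least 1, so twice this
      quotient absorbs the additive constant 2 in 2 + ln n.\<close>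
    define K :: real where "K = 1 + 2 / ln 2"
    have ln2: "ln 2 > (0::real)" by simp
    have K: "K \<ge> 0" using ln2 by (simp add: K_def)
    have le: "1 \<le> ln (real n + 1) / ln 2" if "n \<ge> 1" for n using that ln2 by (simp add: field_simps)
    show thesis
    proof (rule that[OF K])
      fix n :: nat assume n: "n \<ge> 1"
      have d: "decay_rate a n = ln (real n + 1) * real n powr (- 1)" using 2 n by (simp add: decay_rate_def powr_minus_divide)
      have l0: "ln (real n + 1) \<ge> 0" by simp
      have K_ln: "K * ln (real n + 1) = ln (real n + 1) + 2 * (ln (real n + 1) / ln 2)"
        by (simp add: K_def algebra_simps)
      have "1 \<le> K * ln (real n + 1)" unfolding K_ln using le[OF n] l0 by linarith
      then have "1 * real n powr (- 1) \<le> (K * ln (real n + 1)) * real n powr (- 1)" by (intro mult_right_mono) auto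
      then show "real n powr (- a) \<le> K * decay_rate a n" using d 2 by simp
      fix m
      have "(\<Sum>j<n. real (Suc j) powr (- a)) * real n powr (- a) \<le> (1 + ln (real n)) * real n powr (- 1)"
        unfolding 2 using n by (intro mult_right_mono sum_inverse_le) auto
      moreover have "real n powr (1 - 2 * a) / (2 * a - 1) = real n powr (- 1)" by (simp add: 2)
      moreover have "(2 + ln (real n)) * real n powr (- 1) = (1 + ln (real n)) * real n powr (- 1) + real n powr (- 1)" by (simp add: algebra_simps)
      ultimately have "(\<Sum>j<m. real (Suc j) powr (- a) * real (Suc j + n) powr (- a))
          \<le> (2 + ln (real n)) * real n powr (- 1)"
        using sum_convolution_split_le[OF a n, of m] by linarith
      also have "\<dots> \<le> (K * ln (real n + 1)) * real n powr (- 1)"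
      proof (intro mult_right_mono)
        have "ln (real n) \<le> ln (real n + 1)" using n by simp
        then show "2 + ln (real n) \<le> K * ln (real n + 1)" unfolding K_ln using le[OF n] by linarith
      qed simp
      finally show "(\<Sum>j<m. real (Suc j) powr (- a) * real (Suc j + n) powr (- a)) \<le> K * decay_rate a n"
        using d by simp
    qed
  next
    case 3
    define K where "K = 1 + (\<Sum>j. real (Suc j) powr (- a))"
    have s: "summable (\<lambda>j. real (Suc j) powr (- a))"
      using 3 summable_Suc_iff[of "\<lambda>j. real j powr (- a)"] by (simp add: summable_real_powr_iff)
    have K: "K \<ge> 1" using suminf_nonneg[OF s] by (simp add: K_def)
    have d: "decay_rate a n = real n powr (- a)" for n using 3 by (simp add: decay_rate_def)
    show thesis
    proof (rule that[of K])
      show "K \<ge> 0" using K by simp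
      fix n :: nat assume n: "n \<ge> 1"
      show "real n powr (- a) \<le> K * decay_rate a n"
        using K mult_right_mono[of 1 K "real n powr (- a)"] by (simp add: d)
      fix m
      have "(\<Sum>j<m. real (Suc j) powr (- a) * real (Suc j + n) powr (- a)) \<le> (\<Sum>j<m. real (Suc j) powr (- a) * real n powr (- a))"
        using n 3 by (intro sum_mono mult_left_mono powr_mono2') auto
      also have "\<dots> = (\<Sum>j<m. real (Suc j) powr (- a)) * real n powr (- a)" by (rule sum_distrib_right[symmetric])
      also have "\<dots> \<le> K * real n powr (- a)"
        using sum_le_suminf[OF s, of "{..<m}"] by (intro mult_right_mono) (auto simp: K_def)
      finally show "(\<Sum>j<m. real (Suc j) powr (- a) * real (Suc j + n) powr (- a)) \<le> K * decay_rate a n"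
        by (simp add: d)
    qed
  qed
qed

text \<open>The lower bound on \<open>W\<close> starts at index 1. The term j = 0 equals 1 / W n and
  is estimated by itself; the remaining terms form the convolution of powers.\<close>

lemma weight_convolution_decay:
  fixes W :: "nat \<Rightarrow> real"
  assumes a: "a > 1/2" and C: "C > 0" and W0: "W 0 = 1"
    and W: "\<And>n. n \<ge> 1 \<Longrightarrow> W n \<ge> C * real n powr a"
  obtains K where "K \<ge> 0"
    and "\<And>n. n \<ge> 1 \<Longrightarrow> summable (\<lambda>j. 1 / (W j * W (j + n)))"
    and "\<And>n. n \<ge> 1 \<Longrightarrow> (\<Sum>j. 1 / (W j * W (j + n))) \<le> K * decay_rate a n"
proof -
  obtain K where K: "K \<ge> 0" "\<And>n. n \<ge> 1 \<Longrightarrow> real n powr (- a) \<le> K * decay_rate a n"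
    "\<And>n m. n \<ge> 1 \<Longrightarrow> (\<Sum>j<m. real (Suc j) powr (- a) * real (Suc j + n) powr (- a)) \<le> K * decay_rate a n"
    using convolution_decay[OF a] by blast
  have Wpos: "W n > 0" for n
    using W[of n] W0 C by (cases "n = 0") (auto intro: less_le_trans[rotated])
  have Winv: "1 / W n \<le> (1 / C) * real n powr (- a)" if "n \<ge> 1" for n
  proof -
    have "C * real n powr a > 0" using C that by simp
    then have "1 / W n \<le> 1 / (C * real n powr a)" using W[OF that] by (intro divide_left_mono) (auto intro: mult_pos_pos Wpos)
    then show ?thesis by (simp add: powr_minus_divide)
  qed
  define K' where "K' = (1 / C + 1 / C\<^sup>2) * K"
  have part: "(\<Sum>j<m. 1 / (W j * W (j + n))) \<le> K' * decay_rate a n" if n: "n \<ge> 1" for n m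
  proof -
    \<comment> \<open>One extra term is added so that m terms remain after the index 0 has been
      split off.\<close>
    have "(\<Sum>j<m. 1 / (W j * W (j + n))) \<le> (\<Sum>j<Suc m. 1 / (W j * W (j + n)))"
      using Wpos by (intro sum_mono2) (auto simp: less_imp_le)
    also have "\<dots> = 1 / W n + (\<Sum>j<m. (1 / W (Suc j)) * (1 / W (Suc j + n)))"
      unfolding sum.lessThan_Suc_shift using W0 by simp
    also have "\<dots> \<le> 1 / C * real n powr (- a) + (\<Sum>j<m. ((1 / C) * real (Suc j) powr (- a)) * ((1 / C) * real (Suc j + n) powr (- a)))"
      using n Wpos C by (intro add_mono sum_mono mult_mono Winv) (auto simp: less_imp_le)
    also have "\<dots> = 1 / C * real n powr (- a) + 1 / C\<^sup>2 * (\<Sum>j<m. real (Suc j) powr (- a) * real (Suc j + n) powr (- a))"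
      by (simp add: sum_distrib_left power2_eq_square field_simps)
    also have "\<dots> \<le> 1 / C * (K * decay_rate a n) + 1 / C\<^sup>2 * (K * decay_rate a n)"
      using K n C by (intro add_mono mult_left_mono) auto
    also have "\<dots> = K' * decay_rate a n" by (simp add: K'_def algebra_simps)
    finally show ?thesis .
  qed
  have nn: "0 \<le> 1 / (W j * W (j + n))" for j n using Wpos by (simp add: less_imp_le)
  show thesis
  proof (rule that[of K'])
    show "K' \<ge> 0" using K(1) C by (simp add: K'_def)
    fix n :: nat assume n: "n \<ge> 1"
    show s: "summable (\<lambda>j. 1 / (W j * W (j + n)))"
      by (rule summableI_nonneg_bounded[OF nn part[OF n]])
    show "(\<Sum>j. 1 / (W j * W (j + n))) \<le> K' * decay_rate a n"
      by (rule suminf_le_const[OF s part[OF n]])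
  qed
qed

section \<open>The invariant measure\<close>

context random_lp_vector
begin

lemma sets_mu: "sets \<mu> = sets (lp_borel p)" and space_mu [simp]: "space \<mu> = lp p"
  by (simp_all add: \<mu>_def)

lemma prob_space_mu: "prob_space \<mu>"
  unfolding \<mu>_def by (rule PS.prob_space_distr) (rule X_measurable)

lemma Bw_pow_measurable: "(Bw w ^^ n) \<in> measurable (lp_borel p) (lp_borel p)"
proof (induction n)
  case (Suc n)
  then show ?case
    using measurable_comp[OF Suc Bw_measurable[OF p, of w M]] Bw_abs_le by (simp add: comp_def)
qed simp

lemma AE_Bw_pow_X: "AE \<omega> in S. \<forall>n. (Bw w ^^ n) (X \<omega>) = X (seq_shift n \<omega>)"
  using AE_rescale_lp by eventually_elim (simp add: Bw_pow_X)

lemma vimage_X_sets: "A \<in> sets (lp_borel p) \<Longrightarrow> X -` A \<in> sets S"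
  using measurable_sets[OF X_measurable] by simp

lemma emeasure_mu: "A \<in> sets (lp_borel p) \<Longrightarrow> emeasure \<mu> A = emeasure S (X -` A)"
  unfolding \<mu>_def by (subst emeasure_distr) auto

lemma Bw_vimage_sets: "A \<in> sets (lp_borel p) \<Longrightarrow> (Bw w ^^ n) -` A \<inter> lp p \<in> sets (lp_borel p)"
  using measurable_sets[OF Bw_pow_measurable] by simp

text \<open>Transfers the almost-everywhere conjugacy to sets. With \<open>A\<close> the whole space
  it yields invariance, and with general \<open>A\<close> mixing.\<close>

lemma mu_Bw_vimage:
  assumes A: "A \<in> sets (lp_borel p)" and B: "B \<in> sets (lp_borel p)"
  shows "emeasure \<mu> (A \<inter> ((Bw w ^^ n) -` B \<inter> lp p)) = emeasure S (X -` A \<inter> seq_shift n -` (X -` B))"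
proof -
  have "emeasure \<mu> (A \<inter> ((Bw w ^^ n) -` B \<inter> lp p)) = emeasure S (X -` (A \<inter> ((Bw w ^^ n) -` B \<inter> lp p)))"
    using A Bw_vimage_sets[OF B] by (intro emeasure_mu) auto
  also have "\<dots> = emeasure S (X -` A \<inter> seq_shift n -` (X -` B))"
  proof (rule emeasure_eq_AE)
    show "AE \<omega> in S. \<omega> \<in> X -` (A \<inter> ((Bw w ^^ n) -` B \<inter> lp p)) \<longleftrightarrow> \<omega> \<in> X -` A \<inter> seq_shift n -` (X -` B)"
      using AE_Bw_pow_X by eventually_elim (use X_lp in auto)
    show "X -` (A \<inter> ((Bw w ^^ n) -` B \<inter> lp p)) \<in> sets S"
      using A Bw_vimage_sets[OF B] by (intro vimage_X_sets) auto
    show "X -` A \<inter> seq_shift n -` (X -` B) \<in> sets S"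
      using vimage_X_sets[OF A] measurable_sets[OF seq_shift_measurable vimage_X_sets[OF B]] by auto
  qed
  finally show ?thesis .
qed

lemma mu_invariant:
  assumes A: "A \<in> sets (lp_borel p)" shows "emeasure \<mu> (Bw w -` A \<inter> lp p) = emeasure \<mu> A"
proof -
  have lp: "lp p \<in> sets (lp_borel p)" using sets.top[of "lp_borel p"] by simp
  have "X -` lp p = UNIV" using X_lp by auto
  then have "emeasure \<mu> (Bw w -` A \<inter> lp p) = emeasure S (seq_shift 1 -` (X -` A))"
    using mu_Bw_vimage[OF lp A, of 1] by (simp add: Int_absorb1 Int_commute)
  also have "\<dots> = emeasure (distr S S (seq_shift 1)) (X -` A)"
    using vimage_X_sets[OF A] by (subst emeasure_distr) auto
  also have "\<dots> = emeasure \<mu> A" using meas_pres_shift[of 1] emeasure_mu[OF A] by (simp add: meas_pres_def)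
  finally show ?thesis .
qed

lemma mu_mixing:
  assumes A: "A \<in> sets (lp_borel p)" and B: "B \<in> sets (lp_borel p)"
  shows "(\<lambda>n. measure \<mu> (A \<inter> ((Bw w ^^ n) -` B \<inter> lp p))) \<longlonglongrightarrow> measure \<mu> A * measure \<mu> B"
  using seq_shift_mixing[OF vimage_X_sets[OF A] vimage_X_sets[OF B]]
  by (simp add: measure_def mu_Bw_vimage[OF A B] emeasure_mu A B)

section \<open>Full support\<close>

lemma cylinder_pos:
  assumes "\<delta> > 0"
  shows "{\<omega>. \<forall>n<N. \<bar>\<omega> n - a n\<bar> < \<delta>} \<in> sets S" "measure S {\<omega>. \<forall>n<N. \<bar>\<omega> n - a n\<bar> < \<delta>} > 0"
proof -
  define E where "E n = {a n - \<delta><..<a n + \<delta>}" for n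
  have e: "{\<omega>. \<forall>n<N. \<bar>\<omega> n - a n\<bar> < \<delta>} = prod_emb UNIV (\<lambda>_. \<nu>) {..<N} (Pi\<^sub>E {..<N} E)"
  proof -
    have "\<bar>x - a n\<bar> < \<delta> \<longleftrightarrow> x \<in> E n" for x n unfolding E_def abs_less_iff greaterThanLessThan_iff by linarith
    moreover have "\<omega> \<in> prod_emb UNIV (\<lambda>_. \<nu>) {..<N} (Pi\<^sub>E {..<N} E) \<longleftrightarrow> (\<forall>n<N. \<omega> n \<in> E n)" for \<omega>
      by (auto simp: prod_emb_def PiE_iff)
    ultimately show ?thesis by blast
  qed
  have E: "E n \<in> sets \<nu>" for n by (simp add: E_def)
  show "{\<omega>. \<forall>n<N. \<bar>\<omega> n - a n\<bar> < \<delta>} \<in> sets S" unfolding e using E by (intro sets_PiM_I) auto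
  have pos: "measure \<nu> (E n) > 0" for n
    using supp[of "E n"] assms by (simp add: E_def emeasure_eq_measure)
  have "emeasure S {\<omega>. \<forall>n<N. \<bar>\<omega> n - a n\<bar> < \<delta>} = (\<Prod>n<N. emeasure \<nu> (E n))"
    unfolding e using E prob_space_nu by (intro emeasure_PiM_emb) auto
  also have "\<dots> = ennreal (\<Prod>n<N. measure \<nu> (E n))"
    by (simp add: emeasure_eq_measure prod_ennreal)
  finally have "measure S {\<omega>. \<forall>n<N. \<bar>\<omega> n - a n\<bar> < \<delta>} = (\<Prod>n<N. measure \<nu> (E n))"
    by (simp add: measure_def prod_nonneg)
  then show "measure S {\<omega>. \<forall>n<N. \<bar>\<omega> n - a n\<bar> < \<delta>} > 0" using pos by (simp add: prod_pos)
qed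

text \<open>A condition on the coordinates from \<open>N\<close> on only, hence independent of any
  prescription of the first N.\<close>

definition tail_event :: "real \<Rightarrow> nat \<Rightarrow> (nat \<Rightarrow> real) set" where
  "tail_event \<epsilon> N = {\<omega>. rescale \<omega> \<in> lp p \<and> lpnorm p (\<lambda>n. rescale \<omega> n - seq_trunc N (rescale \<omega>) n) < \<epsilon>}"

lemma tail_event_sets: "tail_event \<epsilon> N \<in> sets S"
proof -
  have 1: "{\<omega> \<in> space S. summable (\<lambda>n. \<bar>rescale \<omega> n\<bar> powr p)} \<in> sets S"
    unfolding rescale_def by (rule sets_Collect_summable) measurable
  have 2: "{\<omega> \<in> space S. lpnorm p (\<lambda>n. rescale \<omega> n - seq_trunc N (rescale \<omega>) n) < \<epsilon>} \<in> sets S"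
    unfolding rescale_def seq_trunc_def lpnorm_def by measurable
  have "tail_event \<epsilon> N = {\<omega> \<in> space S. summable (\<lambda>n. \<bar>rescale \<omega> n\<bar> powr p)}
      \<inter> {\<omega> \<in> space S. lpnorm p (\<lambda>n. rescale \<omega> n - seq_trunc N (rescale \<omega>) n) < \<epsilon>}"
    by (auto simp: tail_event_def lp_def)
  then show ?thesis using sets.Int[OF 1 2] by simp
qed

lemma tail_event_dep:
  assumes "\<And>n. n \<in> {N..} \<Longrightarrow> \<omega> n = \<omega>' n" shows "\<omega> \<in> tail_event \<epsilon> N \<longleftrightarrow> \<omega>' \<in> tail_event \<epsilon> N"
proof -
  have e: "rescale \<omega> n = rescale \<omega>' n" if "n \<ge> N" for n using assms that by (simp add: rescale_def)
  have "summable (\<lambda>n. \<bar>rescale \<omega> n\<bar> powr p) \<longleftrightarrow> summable (\<lambda>n. \<bar>rescale \<omega>' n\<bar> powr p)"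
    by (rule summable_cong) (use e in \<open>auto intro: eventually_sequentiallyI[of N]\<close>)
  moreover have "(\<lambda>n. rescale \<omega> n - seq_trunc N (rescale \<omega>) n) = (\<lambda>n. rescale \<omega>' n - seq_trunc N (rescale \<omega>') n)"
    using e by (auto simp: seq_trunc_def)
  ultimately show ?thesis by (simp add: tail_event_def lp_def)
qed

text \<open>Almost every point has tails tending to 0 and so lies in the event for all large N; the
  events from N0 on cannot all be null. The lower bound N0 lets the same index also truncate the
  target point accurately.\<close>

lemma tail_event_pos:
  assumes "\<epsilon> > 0" obtains N where "N \<ge> N0" "measure S (tail_event \<epsilon> N) > 0"
proof -
  have "\<exists>N\<ge>N0. measure S (tail_event \<epsilon> N) > 0"
  proof (rule ccontr)
    assume "\<not> ?thesis"
    then have "measure S (tail_event \<epsilon> N) = 0" if "N \<ge> N0" for N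
      using that measure_nonneg[of S "tail_event \<epsilon> N"] by (auto simp: not_less intro: antisym)
    then have "tail_event \<epsilon> N \<in> null_sets S" if "N \<ge> N0" for N
      using that tail_event_sets by (auto simp: null_sets_def PS.emeasure_eq_measure)
    then have "AE \<omega> in S. \<omega> \<notin> tail_event \<epsilon> N" if "N \<ge> N0" for N
      using that AE_not_in by blast
    then have "AE \<omega> in S. \<forall>N\<in>{N0..}. \<omega> \<notin> tail_event \<epsilon> N"
      by (intro AE_ball_countable[THEN iffD2]) auto
    then have "AE \<omega> in S. False"
      using AE_rescale_lp
    proof eventually_elim
      case (elim \<omega>)
      have "\<forall>\<^sub>F N in sequentially. lpnorm p (\<lambda>n. rescale \<omega> n - seq_trunc N (rescale \<omega>) n) < \<epsilon>"
        using lpnorm_trunc_tendsto[OF elim(2) p_pos] assms by (intro order_tendstoD(2)) auto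
      then have "\<forall>\<^sub>F N in sequentially. \<omega> \<in> tail_event \<epsilon> N"
        by eventually_elim (use elim(2) in \<open>simp add: tail_event_def\<close>)
      from eventually_happens'[OF _ eventually_conj[OF this eventually_ge_at_top[of N0]]] show False
        using elim(1) by auto
    qed
    then show False by (simp add: PS.AE_False)
  qed
  then show thesis using that by blast
qed

text \<open>The distance to \<open>u\<close> is split at N into three parts below e / 3: the random
  tail, the first N coordinates, and the tail of \<open>u\<close>. The first two constraints are
  independent events of positive probability.\<close>

lemma mu_full_support:
  assumes U: "lp_open p U" "U \<noteq> {}" shows "emeasure \<mu> U > 0"
proof -
  obtain u where u: "u \<in> U" using U by auto
  then have ul: "u \<in> lp p" using U by (auto simp: lp_open_def)
  obtain e where e: "e > 0" "\<And>y. y \<in> lp p \<Longrightarrow> lpnorm p (\<lambda>n. y n - u n) < e \<Longrightarrow> y \<in> U"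
    using U u unfolding lp_open_def by blast
  have "\<forall>\<^sub>F N in sequentially. lpnorm p (\<lambda>n. u n - seq_trunc N u n) < e / 3"
    using lpnorm_trunc_tendsto[OF ul p_pos] e by (intro order_tendstoD(2)) auto
  then obtain N0 where N0: "\<And>N. N \<ge> N0 \<Longrightarrow> lpnorm p (\<lambda>n. u n - seq_trunc N u n) < e / 3"
    by (auto simp: eventually_sequentially)
  obtain N where N: "N \<ge> N0" "measure S (tail_event (e / 3) N) > 0"
    using tail_event_pos[of "e / 3" N0] e by auto
  \<comment> \<open>A positive lower bound for the first N products of weights; inserting 1 keeps
    the set nonempty when N = 0.\<close>
  define m where "m = Min (insert 1 (wprod w ` {..<N}))"
  have m: "m > 0" "\<And>n. n < N \<Longrightarrow> m \<le> wprod w n" unfolding m_def using wprod_pos by (auto simp: Min_gr_iff)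
  \<comment> \<open>After division by \<open>wprod w n\<close>, which is at least \<open>m\<close>,
    each of the N coordinates is off by at most e / (3 (N + 1)), so together by at most e /
    3.\<close>
  define \<delta> where "\<delta> = e / (3 * (real N + 1)) * m"
  have \<delta>: "\<delta> > 0" using e m by (simp add: \<delta>_def)
  define A where "A = {\<omega>. \<forall>n<N. \<bar>\<omega> n - u n * wprod w n\<bar> < \<delta>}"
  note A = cylinder_pos[OF \<delta>, of N "\<lambda>n. u n * wprod w n", folded A_def]
  have "measure S (A \<inter> tail_event (e / 3) N) = measure S A * measure S (tail_event (e / 3) N)"
    by (rule indep_measure[OF A(1) tail_event_sets, of "{..<N}" "{N..}"])
       (auto simp: A_def intro: tail_event_dep[THEN iffD1])
  then have "measure S (A \<inter> tail_event (e / 3) N) > 0" using A(2) N(2) by simp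
  moreover have "A \<inter> tail_event (e / 3) N \<subseteq> X -` U"
  proof
    fix \<omega> assume \<omega>: "\<omega> \<in> A \<inter> tail_event (e / 3) N"
    let ?x = "rescale \<omega>"
    have x: "?x \<in> lp p" and t: "lpnorm p (\<lambda>n. ?x n - seq_trunc N ?x n) < e / 3"
      using \<omega> by (auto simp: tail_event_def)
    have "lpnorm p (\<lambda>n. seq_trunc N ?x n - seq_trunc N u n) = lpnorm p (seq_trunc N (\<lambda>n. ?x n - u n))"
      by (rule arg_cong[where f = "lpnorm p"]) (auto simp: seq_trunc_def)
    also have "\<dots> \<le> (\<Sum>n<N. \<bar>?x n - u n\<bar>)" by (rule lpnorm_trunc_le_sum[OF p])
    also have "\<dots> \<le> (\<Sum>n<N. e / (3 * (real N + 1)))"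
    proof (rule sum_mono)
      fix n assume n: "n \<in> {..<N}"
      have "\<bar>?x n - u n\<bar> = \<bar>\<omega> n - u n * wprod w n\<bar> / wprod w n"
        using wprod_pos[of n] by (simp add: rescale_def field_simps flip: abs_divide) (simp add: abs_divide)
      also have "\<dots> \<le> \<delta> / wprod w n"
        using \<omega> n wprod_pos[of n] by (intro divide_right_mono) (auto simp: A_def less_imp_le)
      also have "\<dots> \<le> e / (3 * (real N + 1))"
        using m(2)[of n] n wprod_pos[of n] e unfolding \<delta>_def
        by (simp add: pos_divide_le_eq mult_left_mono)
      finally show "\<bar>?x n - u n\<bar> \<le> e / (3 * (real N + 1))" .
    qed
    also have "\<dots> \<le> e / 3" using e by (simp add: field_simps)
    finally have 2: "lpnorm p (\<lambda>n. seq_trunc N ?x n - seq_trunc N u n) \<le> e / 3" .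
    have 3: "lpnorm p (\<lambda>n. seq_trunc N u n - u n) < e / 3"
      using N0[OF N(1)] lpnorm_minus_commute[of p u] by simp
    have "lpnorm p (\<lambda>n. ?x n - u n) < e"
      using lpnorm_triangle3[OF p x lp_trunc[of N ?x p] ul] lpnorm_triangle3[OF p lp_trunc[of N ?x p] lp_trunc[of N u p] ul] t 2 3
      by linarith
    then show "\<omega> \<in> X -` U" using e(2)[OF x] x by (simp add: X_def)
  qed
  moreover have "X -` U \<in> sets S" by (rule vimage_X_sets[OF lp_open_sets[OF U(1)]])
  ultimately have "measure S (X -` U) > 0"
    using PS.finite_measure_mono[of "A \<inter> tail_event (e / 3) N" "X -` U"] by linarith
  then show ?thesis by (simp add: emeasure_mu[OF lp_open_sets[OF U(1)]] PS.emeasure_eq_measure)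
qed

lemma E_omega_sq_int:
  assumes "\<forall>k. \<omega> k > 1" "f \<in> E_omega p \<omega>" shows "sq_int \<mu> f"
proof -
  obtain K where f: "exp_lipschitz p f K" using E_omega_exp_lipschitz[OF assms(2) p assms(1)] .
  have m: "f \<in> borel_measurable (lp_borel p)" by (rule exp_lipschitz_measurable[OF p f])
  then show ?thesis
    using fX_sq_int[OF f] unfolding sq_int_def \<mu>_def by (simp add: integrable_distr_eq)
qed

theorem good_measure_mu:
  assumes "\<forall>k. \<omega> k > 1" shows "good_measure p \<omega> w \<mu>"
  unfolding good_measure_def
proof (intro conjI ballI allI impI)
  show "Bw w \<in> measurable \<mu> \<mu>"
    using Bw_pow_measurable[of 1] by (simp add: measurable_cong_sets[OF sets_mu sets_mu])
qed (use prob_space_mu mu_invariant mu_mixing mu_full_support E_omega_sq_int[OF assms] in \<open>auto simp: sets_mu sq_int_def\<close>)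

section \<open>Covariances and the central limit theorem for the invariant measure\<close>

lemma Cov_mu:
  assumes f: "exp_lipschitz p f K" and g: "exp_lipschitz p g L"
  shows "Cov \<mu> (\<lambda>x. f ((Bw w ^^ n) x)) g = Cov S (\<lambda>\<omega>. f (X (seq_shift n \<omega>))) (\<lambda>\<omega>. g (X \<omega>))"
proof -
  have [measurable]: "f \<in> borel_measurable (lp_borel p)" "g \<in> borel_measurable (lp_borel p)"
    by (rule exp_lipschitz_measurable[OF p f], rule exp_lipschitz_measurable[OF p g])
  have [measurable]: "(Bw w ^^ n) \<in> measurable (lp_borel p) (lp_borel p)" by (rule Bw_pow_measurable)
  have ae: "AE \<omega> in S. (Bw w ^^ n) (X \<omega>) = X (seq_shift n \<omega>)"
    using AE_Bw_pow_X by eventually_elim simp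
  have "(\<integral>x. f ((Bw w ^^ n) x) * g x \<partial>\<mu>) = (\<integral>\<omega>. f ((Bw w ^^ n) (X \<omega>)) * g (X \<omega>) \<partial>S)"
    unfolding \<mu>_def by (subst integral_distr) auto
  also have "\<dots> = (\<integral>\<omega>. f (X (seq_shift n \<omega>)) * g (X \<omega>) \<partial>S)"
    using ae by (intro integral_cong_AE) auto
  finally have 1: "(\<integral>x. f ((Bw w ^^ n) x) * g x \<partial>\<mu>) = (\<integral>\<omega>. f (X (seq_shift n \<omega>)) * g (X \<omega>) \<partial>S)" .
  have "(\<integral>x. f ((Bw w ^^ n) x) \<partial>\<mu>) = (\<integral>\<omega>. f ((Bw w ^^ n) (X \<omega>)) \<partial>S)"
    unfolding \<mu>_def by (subst integral_distr) auto
  also have "\<dots> = (\<integral>\<omega>. f (X (seq_shift n \<omega>)) \<partial>S)"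
    using ae by (intro integral_cong_AE) auto
  finally have 2: "(\<integral>x. f ((Bw w ^^ n) x) \<partial>\<mu>) = (\<integral>\<omega>. f (X (seq_shift n \<omega>)) \<partial>S)" .
  have 3: "(\<integral>x. g x \<partial>\<mu>) = (\<integral>\<omega>. g (X \<omega>) \<partial>S)"
    unfolding \<mu>_def by (subst integral_distr) auto
  show ?thesis unfolding Cov_def 1 2 3 ..
qed

lemma infl_nonneg: "infl \<ge> 0"
  by (simp add: infl_def integral_nonneg_AE)

theorem covariance_decay:
  assumes \<omega>: "\<forall>k. \<omega> k > 1" and a: "\<alpha> > 1/2" and C: "C > 0"
    and W: "\<And>n. n \<ge> 1 \<Longrightarrow> wprod w n \<ge> C * real n powr \<alpha>"
    and f: "f \<in> E_omega p \<omega>" and g: "g \<in> E_omega p \<omega>"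
  shows "\<exists>K. \<forall>n\<ge>1. \<bar>Cov \<mu> (\<lambda>x. f ((Bw w ^^ n) x)) g\<bar> \<le> K * decay_rate \<alpha> n"
proof -
  obtain Kf where f: "exp_lipschitz p f Kf" using E_omega_exp_lipschitz[OF f p \<omega>] .
  obtain Kg where g: "exp_lipschitz p g Kg" using E_omega_exp_lipschitz[OF g p \<omega>] .
  obtain K where K: "K \<ge> 0" "\<And>n. n \<ge> 1 \<Longrightarrow> summable (\<lambda>j. 1 / (wprod w j * wprod w (j + n)))"
    "\<And>n. n \<ge> 1 \<Longrightarrow> (\<Sum>j. 1 / (wprod w j * wprod w (j + n))) \<le> K * decay_rate \<alpha> n"
    using weight_convolution_decay[OF a C wprod_0 W] by blast
  let ?F = "\<lambda>\<omega>. f (X \<omega>)" and ?G = "\<lambda>\<omega>. g (X \<omega>)"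
  define Q where "Q = Kf * infl * (Kg * infl)"
  have Q: "Q \<ge> 0" using K_nonneg[OF f] K_nonneg[OF g] infl_nonneg by (simp add: Q_def)
  have "\<bar>Cov \<mu> (\<lambda>x. f ((Bw w ^^ n) x)) g\<bar> \<le> (Q * K / 2) * decay_rate \<alpha> n" if n: "n \<ge> 1" for n
  proof -
    have le: "influence j ?F * influence (j + n) ?G \<le> Q * (1 / (wprod w j * wprod w (j + n)))" for j
    proof -
      have "influence j ?F * influence (j + n) ?G \<le> (Kf * infl / wprod w j) * (Kg * infl / wprod w (j + n))"
        using influence_fX_le(1)[OF f] influence_fX_le(1)[OF g] K_nonneg[OF f] infl_nonneg wprod_pos
        by (intro mult_mono) (auto simp: less_imp_le)
      then show ?thesis by (simp add: Q_def)
    qed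
    have sm: "summable (\<lambda>j. influence j ?F * influence (j + n) ?G)"
      using le by (intro summable_comparison_test'[OF summable_mult[OF K(2)[OF n], of Q], of 0]) auto
    \<comment> \<open>Coordinates below n have no influence on the shifted functional. Writing k as
      k - n + n exhibits a delayed sequence, whose sum is the convolution.\<close>
    have e: "(\<lambda>k. influence k (\<lambda>\<omega>. f (X (seq_shift n \<omega>))) * influence k ?G)
        = (\<lambda>k. if n \<le> k then influence (k - n) ?F * influence (k - n + n) ?G else 0)"
      using influence_shift[OF fX_sq_int[OF f]] by auto
    have sums: "(\<lambda>k. influence k (\<lambda>\<omega>. f (X (seq_shift n \<omega>))) * influence k ?G) sums (\<Sum>j. influence j ?F * influence (j + n) ?G)"
      unfolding e by (rule sums_delayed[OF summable_sums[OF sm]])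
    have "\<bar>Cov \<mu> (\<lambda>x. f ((Bw w ^^ n) x)) g\<bar> \<le> (\<Sum>j. influence j ?F * influence (j + n) ?G) / 2"
      using Efron_Stein[OF approximable_shift[OF fX_approximable[OF f]] fX_sq_int[OF g] sums_summable[OF sums]]
      unfolding Cov_mu[OF f g] sums_unique[OF sums, symmetric] .
    also have "(\<Sum>j. influence j ?F * influence (j + n) ?G) \<le> (\<Sum>j. Q * (1 / (wprod w j * wprod w (j + n))))"
      by (intro suminf_le le sm summable_mult K(2) n)
    also have "\<dots> = Q * (\<Sum>j. 1 / (wprod w j * wprod w (j + n)))" by (rule suminf_mult[OF K(2)[OF n]])
    also have "\<dots> \<le> Q * (K * decay_rate \<alpha> n)" by (intro mult_left_mono K(3) n Q)
    finally show ?thesis by simp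
  qed
  then show ?thesis by blast
qed

theorem central_limit_mu:
  assumes \<omega>: "\<forall>k. \<omega> k > 1" and a: "\<alpha> > 1" and C: "C > 0"
    and W: "\<And>n. n \<ge> 1 \<Longrightarrow> wprod w n \<ge> C * real n powr \<alpha>"
    and f: "f \<in> E_omega p \<omega>" and mean: "(\<integral>x. f x \<partial>\<mu>) = 0"
  shows "\<exists>s\<ge>0. weak_conv_m
    (\<lambda>n. distr \<mu> borel (\<lambda>x. (\<Sum>i<Suc n. f ((Bw w ^^ i) x)) / sqrt (real (Suc n)))) (gaussian0 s)"
proof -
  obtain K where f: "exp_lipschitz p f K" using E_omega_exp_lipschitz[OF f p \<omega>] .
  have fm [measurable]: "f \<in> borel_measurable (lp_borel p)" by (rule exp_lipschitz_measurable[OF p f])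
  interpret summable_influence \<nu> "\<lambda>\<omega>. f (X \<omega>)" "\<lambda>k. K * infl / wprod w k"
  proof
    show "approximable (\<lambda>\<omega>. f (X \<omega>))" by (rule fX_approximable[OF f])
    show "(\<integral>\<omega>. f (X \<omega>) \<partial>S) = 0" using mean unfolding \<mu>_def by (subst (asm) integral_distr) auto
    show "influence k (\<lambda>\<omega>. f (X \<omega>)) \<le> K * infl / wprod w k" for k by (rule influence_fX_le(1)[OF f])
    show "influence k (\<lambda>\<omega>. f (X (seq_trunc r \<omega>))) \<le> K * infl / wprod w k" for k r by (rule influence_fX_le(2)[OF f])
    \<comment> \<open>The comparison is made from k = 1 on, where the lower bound on the weights
      begins.\<close>
    have "summable (\<lambda>k. (K * infl / C) * real k powr (- \<alpha>))"
      using a by (intro summable_mult) (simp add: summable_real_powr_iff)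
    then show "summable (\<lambda>k. K * infl / wprod w k)"
    proof (rule summable_comparison_test'[of _ 1])
      fix k :: nat assume k: "k \<ge> 1"
      have "C * real k powr \<alpha> > 0" using C k by simp
      then have "K * infl / wprod w k \<le> K * infl / (C * real k powr \<alpha>)"
        using W[OF k] K_nonneg[OF f] infl_nonneg wprod_pos[of k] by (intro divide_left_mono) auto
      then show "norm (K * infl / wprod w k) \<le> (K * infl / C) * real k powr (- \<alpha>)"
        using K_nonneg[OF f] infl_nonneg wprod_pos[of k] by (simp add: powr_minus_divide less_imp_le)
    qed
  qed
  have [measurable]: "(Bw w ^^ i) \<in> measurable (lp_borel p) (lp_borel p)" for i by (rule Bw_pow_measurable)
  have "distr \<mu> borel (\<lambda>x. (\<Sum>i<Suc n. f ((Bw w ^^ i) x)) / sqrt (real (Suc n)))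
      = distr S borel (\<lambda>\<omega>. (\<Sum>i<Suc n. f (X (seq_shift i \<omega>))) / sqrt (real (Suc n)))" for n
  proof -
    have "distr \<mu> borel (\<lambda>x. (\<Sum>i<Suc n. f ((Bw w ^^ i) x)) / sqrt (real (Suc n)))
      = distr S borel (\<lambda>\<omega>. (\<Sum>i<Suc n. f ((Bw w ^^ i) (X \<omega>))) / sqrt (real (Suc n)))"
      unfolding \<mu>_def by (subst distr_distr) (auto simp: comp_def)
    also have "\<dots> = distr S borel (\<lambda>\<omega>. (\<Sum>i<Suc n. f (X (seq_shift i \<omega>))) / sqrt (real (Suc n)))"
    proof (rule distr_cong_AE)
      show "AE \<omega> in S. (\<Sum>i<Suc n. f ((Bw w ^^ i) (X \<omega>))) / sqrt (real (Suc n))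
          = (\<Sum>i<Suc n. f (X (seq_shift i \<omega>))) / sqrt (real (Suc n))"
        using AE_Bw_pow_X by eventually_elim simp
    qed auto
    finally show ?thesis .
  qed
  then show ?thesis using central_limit by simp
qed

end

theorem theorem2p4:
  fixes p :: real and \<omega> :: "nat \<Rightarrow> real" and w :: "nat \<Rightarrow> real"
  assumes hp: "p \<ge> 1"
    and h\<omega>1: "\<forall>k. \<omega> k > 1"
    and h\<omega>2: "filterlim \<omega> at_top sequentially"
    and hwpos: "\<forall>n\<ge>1. w n > 0"
    and hwbdd: "\<exists>M. \<forall>n\<ge>1. w n \<le> M"
    and hsum: "summable (\<lambda>n. (\<Prod>i\<in>{1..Suc n}. w i) powr (- p))"
  shows "(\<exists>\<mu>. good_measure p \<omega> w \<mu>)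
    \<and> (\<forall>C \<alpha>. C > 0 \<and> \<alpha> > 1/2 \<and> (\<forall>n\<ge>1. (\<Prod>i\<in>{1..n}. w i) \<ge> C * real n powr \<alpha>) \<longrightarrow>
        (\<exists>\<mu>. good_measure p \<omega> w \<mu>
          \<and> (\<forall>f\<in>E_omega p \<omega>. \<forall>g\<in>E_omega p \<omega>. \<exists>K. \<forall>n\<ge>1.
               \<bar>Cov \<mu> (\<lambda>x. f ((Bw w ^^ n) x)) g\<bar> \<le> K * decay_rate \<alpha> n)
          \<and> (\<alpha> > 1 \<longrightarrow> (\<forall>f\<in>E_omega p \<omega>. (\<integral>x. f x \<partial>\<mu>) = 0 \<longrightarrow>
               (\<exists>s\<ge>0. weak_conv_m
                  (\<lambda>n. distr \<mu> borel (\<lambda>x. (\<Sum>i<Suc n. f ((Bw w ^^ i) x)) / sqrt (real (Suc n))))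
                  (gaussian0 s))))))"
proof -
  obtain M where M: "\<And>n. n \<ge> 1 \<Longrightarrow> w n \<le> M" using hwbdd by blast
  define C0 where "C0 = (\<Sum>n. wprod w n powr (- p))"
  \<comment> \<open>The hypothesis sums from n = 1; the series here also contains the empty product,
    the weight of coordinate 0.\<close>
  have c: "summable (\<lambda>n. wprod w n powr (- p))"
    using hsum summable_Suc_iff[of "\<lambda>n. wprod w n powr (- p)"] by (simp add: wprod_def)
  \<comment> \<open>One function dominates both required moments, so its integrability provides them
    together.\<close>
  define h where "h x = exp (8 * C0 * \<bar>x\<bar> powr p) + x ^ 4" for x :: real
  have h: "h \<in> borel_measurable borel" "\<And>x. h x \<ge> 0" unfolding h_def[abs_def] by auto
  obtain \<nu> where \<nu>: "prob_space \<nu>" "sets \<nu> = sets borel" "integrable \<nu> h"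
    "\<And>U. open U \<Longrightarrow> U \<noteq> {} \<Longrightarrow> emeasure \<nu> U > 0"
    using full_support_measure_exists[OF h] by blast
  have mb: "f \<in> borel_measurable borel \<Longrightarrow> f \<in> borel_measurable \<nu>" for f :: "real \<Rightarrow> real"
    by (simp add: measurable_cong_sets[OF \<nu>(2) refl])
  interpret random_lp_vector \<nu> p w M
  proof (intro random_lp_vector.intro iid_real.intro iid_real_axioms.intro random_lp_vector_axioms.intro \<nu> hp M c)
    show "w n > 0" if "n \<ge> 1" for n using hwpos that by blast
    have [measurable]: "(\<lambda>x. exp (8 * C0 * \<bar>x\<bar> powr p)) \<in> borel_measurable \<nu>" "(\<lambda>x. x ^ 4) \<in> borel_measurable \<nu>"
      by (rule mb, measurable)+
    have "integrable \<nu> (\<lambda>x. exp (8 * C0 * \<bar>x\<bar> powr p))"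
      by (rule Bochner_Integration.integrable_bound[OF \<nu>(3)]) (auto simp: h_def)
    then show "integrable \<nu> (\<lambda>x. exp (8 * (\<Sum>n. wprod w n powr (- p)) * \<bar>x\<bar> powr p))"
      by (simp add: C0_def)
    show "integrable \<nu> (\<lambda>x. x ^ 4)"
      by (rule Bochner_Integration.integrable_bound[OF \<nu>(3)]) (auto simp: h_def)
  qed
  \<comment> \<open>The same measure, fixed before C and \<alpha> are introduced, is the witness for
    both existential claims.\<close>
  show ?thesis
  proof (intro conjI allI impI exI[of _ \<mu>] ballI)
    show "good_measure p \<omega> w \<mu>" by (rule good_measure_mu[OF h\<omega>1])
    show "good_measure p \<omega> w \<mu>" by (rule good_measure_mu[OF h\<omega>1])
  next
    fix C \<alpha> :: real and f g
    assume "C > 0 \<and> \<alpha> > 1/2 \<and> (\<forall>n\<ge>1. (\<Prod>i\<in>{1..n}. w i) \<ge> C * real n powr \<alpha>)"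
      and "f \<in> E_omega p \<omega>" "g \<in> E_omega p \<omega>"
    then show "\<exists>K. \<forall>n\<ge>1. \<bar>Cov \<mu> (\<lambda>x. f ((Bw w ^^ n) x)) g\<bar> \<le> K * decay_rate \<alpha> n"
      by (intro covariance_decay[OF h\<omega>1, of \<alpha> C]) (auto simp: wprod_def)
  next
    fix C \<alpha> :: real and f
    assume "C > 0 \<and> \<alpha> > 1/2 \<and> (\<forall>n\<ge>1. (\<Prod>i\<in>{1..n}. w i) \<ge> C * real n powr \<alpha>)"
      and "\<alpha> > 1" "f \<in> E_omega p \<omega>" "(\<integral>x. f x \<partial>\<mu>) = 0"
    then show "\<exists>s\<ge>0. weak_conv_m
        (\<lambda>n. distr \<mu> borel (\<lambda>x. (\<Sum>i<Suc n. f ((Bw w ^^ i) x)) / sqrt (real (Suc n)))) (gaussian0 s)"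
      by (intro central_limit_mu[OF h\<omega>1, of \<alpha> C]) (auto simp: wprod_def)
  qed
qed

end
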